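(* Let $r,L>0$ and let $\boldsymbol B=(B^{(1)},\dots,B^{(m)})$ be communication budgets with associated bit adjusted sample size $N_{\text{bass}}$. Let $d\asymp N_{\text{bass}}^{1/(1+2r)}$ and let $C_0\in\mathbb R$ be such that, for all sufficiently small $\epsilon>0$, the sieve $\mathcal F_0(d,C_0,\epsilon)$ is contained in the model class $B_{2,2}^r(L)$ and the following three assumptions hold, with a constant $C>0$ not depending on $\epsilon,n,m,\boldsymbol B$. (1) (Expectation control) For all $\boldsymbol\beta,\boldsymbol\beta'\in\{-1,1\}^d$, all $i\in\{1,\dots,n\}$ and all $k\in\{1,\dots,m\}$, $\mathbb E_{\boldsymbol\beta}[W_d^{(k)}(X_i^{(k)},\boldsymbol\beta,\boldsymbol\beta')]\le C\epsilon^2d^{-2r}$. (2) (Decomposable structure) The sample space of a single observation can be partitioned into events $\chi_1,\dots,\chi_d$ such that $\mathbb P_{\boldsymbol\beta}(\chi_h)=1/d$ for all $\boldsymbol\beta\in\{-1,1\}^d$ and all $h$, and such that for all $i,k,h$ the conditional distribution of $X_i^{(k)}$ given $X_i^{(k)}\in\chi_h$ depends only on $\beta_h$ and not on $\beta_{h'}$, $h'\ne h$. (3) (Tail control) With $a_n=C\epsilon d^{-1/2-r}\sqrt{n\log N}$, the events $$E_h^{(k)}(a_n)=\Big\{X^{(k)}:\ \max_{\boldsymbol\beta,\boldsymbol\beta'}\sum_{i:\,X_i^{(k)}\in\chi_h}W_d^{(k)}(X_i^{(k)},\boldsymbol\beta,\boldsymbol\beta')\le a_n\Big\}$$ satisfy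 $\mathbb P_{\beta_h}(E_h^{(k)}(a_n))=1+o(m^{-2}d^{-2})$ for all $h\in\{1,\dots,d\}$, $k\in\{1,\dots,m\}$, $\beta_h\in\{-1,1\}$. Then $$\inf_{\hat f\in\mathcal F_{\text{dist}}(\boldsymbol B)}\ \sup_{f\in B_{2,2}^r(L)}\mathbb E_f\|\hat f-f\|_2^2\ \gtrsim\ N_{\text{bass}}^{-\frac{2r}{1+2r}}.$$
   Context: Distributed setting: there are $m$ machines; machine $k\in\{1,\dots,m\}$ observes $X^{(k)}=(X_1^{(k)},\dots,X_n^{(k)})$; all $nm$ observations are i.i.d. from a distribution $p_f$ indexed by $f\in L_2([0,1])$, with $f\in B_{2,2}^r(L)$. Put $N=nm$. Asymptotics are for $n\to\infty$, where $m$ and the budgets may depend on $n$, and $r,L$ are fixed and known. $a\gtrsim b$ (or $b\lesssim a$) means $a\ge cb$ for a constant $c>0$ not depending on $n,m,\boldsymbol B$; $a\asymp b$ means both inequalities. $\mathcal F_{\text{dist}}(\boldsymbol B)$ is the set of estimators $\hat f=\hat f(Y^{(1)},\dots,Y^{(m)})$ that depend on the data only through binary strings $Y^{(k)}$, where $Y^{(k)}$ is produced by machine $k$ from its local data $X^{(k)}$ and has length $l(Y^{(k)})\le B^{(k)}$ almost surely (one round of communication). Wavelets and Besov balls: $\{\psi_{jh}: j\ge 0,\ 0\le h\le 2^j-1\}$ is the orthonormal basis of $L_2([0,1])$ of compactly supported boundary-corrected Daubechies wavelets with $S>r$ vanishing moments (scaling function(s) included at level $j=0$). With $f_{jh}=\langle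 f,\psi_{jh}\rangle$, $\|f\|_{B^r_{2,2}}^2=\sum_j 2^{2jr}\sum_h f_{jh}^2$ and $B_{2,2}^r(L)=\{f\in L_2([0,1]):\|f\|_{B_{2,2}^r}<L\}$ (intersected with the functions for which the model $p_f$ is defined). Bit adjusted sample size: $N_{\text{bass}}$ is the solution of $$N_{\text{bass}}=\max\Big(n\log N,\ n\sum_{k=1}^m\Big(\frac{B^{(k)}\log N}{N_{\text{bass}}^{1/(1+2r)}}\wedge 1\Big)\Big).$$ Sieve: for $d=c2^j$ ($0<c<1$ a constant depending on $r$), partition $[0,1]$ into disjoint intervals $I_1,\dots,I_d$ such that each $I_h$ contains the full support of one wavelet of level $j$; re-index these wavelets as $\psi_{j1},\dots,\psi_{jd}$ (so they have pairwise disjoint supports), $j$ being the smallest level for which this is possible. For $\boldsymbol\beta\in\{-1,1\}^d$ let $f_{\boldsymbol\beta}(t)=\epsilon d^{-(r+1/2)}\sum_{h=1}^d\beta_h\psi_{jh}(t)$ and $\mathcal F_0(d,C_0,\epsilon)=\{f_{\boldsymbol\beta}+C_0:\boldsymbol\beta\in\{-1,1\}^d\}$. $\mathbb P_{\boldsymbol\beta},\mathbb E_{\boldsymbol\beta}$ refer to data generated with $f=f_{\boldsymbol\beta}+C_0$; $\mathbb P_{\beta_h}$ is used for events that depend on the distribution only through $\beta_h$. The single-observation log-likelihood ratio is $W_d^{(k)}(x,\boldsymbol\beta,\boldsymbol\beta')=\log\frac{p_{f_{\boldsymbol\beta}+C_0}(x)}{p_{f_{\boldsymbol\beta'}+C_0}(x)}$.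 *)

theory Defs
  imports "HOL-Probability.Probability" "HOL-Library.Landau_Symbols"
    "HOL-Computational_Algebra.Polynomial"
begin

text \<open>Elements of \<open>L\<^sub>2([0,1])\<close> are represented by functions on the real line, whose values outside
  the unit interval are ignored.\<close>

definition L2_unit :: "(real \<Rightarrow> real) set" where
  "L2_unit = {f. f \<in> borel_measurable (lebesgue_on {0..1}) \<and>
                 integrable (lebesgue_on {0..1}) (\<lambda>x. (f x)\<^sup>2)}"

definition l2_inner :: "(real \<Rightarrow> real) \<Rightarrow> (real \<Rightarrow> real) \<Rightarrow> real" where
  "l2_inner f g = (LINT x|lebesgue_on {0..1}. f x * g x)"

definition l2_dist_sq :: "(real \<Rightarrow> real) \<Rightarrow> (real \<Rightarrow> real) \<Rightarrow> ennreal" where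
  "l2_dist_sq f g = (\<integral>\<^sup>+x. ennreal ((f x - g x)\<^sup>2) \<partial>lebesgue_on {0..1})"


section \<open>Boundary-corrected Daubechies wavelets\<close>

definition daubechies_filter :: "nat \<Rightarrow> (int \<Rightarrow> real) \<Rightarrow> bool" where
  "daubechies_filter S a \<longleftrightarrow>
     1 \<le> S \<and>
     (\<forall>k. k \<notin> {1 - int S..int S} \<longrightarrow> a k = 0) \<and>
     (\<Sum>k\<in>{1 - int S..int S}. a k) = sqrt 2 \<and>
     (\<forall>l. (\<Sum>k\<in>{1 - int S..int S}. a k * a (k + 2 * l)) = (if l = 0 then 1 else 0)) \<and>
     (\<forall>q<S. (\<Sum>k\<in>{1 - int S..int S}. (-1) powi k * of_int k ^ q * a k) = 0)"

definition scaling_function :: "nat \<Rightarrow> (int \<Rightarrow> real) \<Rightarrow> (real \<Rightarrow> real) \<Rightarrow> bool" where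
  "scaling_function S a \<phi> \<longleftrightarrow>
     \<phi> \<in> borel_measurable borel \<and>
     (\<forall>x. x \<notin> {1 - real S..real S} \<longrightarrow> \<phi> x = 0) \<and>
     integrable lborel \<phi> \<and> integrable lborel (\<lambda>x. (\<phi> x)\<^sup>2) \<and>
     (LINT x|lborel. \<phi> x) = 1 \<and>
     (AE x in lborel. \<phi> x = sqrt 2 * (\<Sum>k\<in>{1 - int S..int S}. a k * \<phi> (2 * x - of_int k)))"

definition mother_wavelet :: "nat \<Rightarrow> (int \<Rightarrow> real) \<Rightarrow> (real \<Rightarrow> real) \<Rightarrow> real \<Rightarrow> real" where
  "mother_wavelet S a \<phi> x =
     sqrt 2 * (\<Sum>k\<in>{1 - int S..int S}. (-1) powi k * a (1 - k) * \<phi> (2 * x - of_int k))"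

definition dilate :: "nat \<Rightarrow> int \<Rightarrow> (real \<Rightarrow> real) \<Rightarrow> real \<Rightarrow> real" where
  "dilate j k g x = 2 powr (real j / 2) * g (2 ^ j * x - of_int k)"

text \<open>The multiresolution space at level \<open>j\<close> of Cohen, Daubechies and Vial. The integers \<open>k\<close> in the sum
  are those for which \<open>\<phi>\<^sub>j\<^sub>k\<close> meets the interior of the unit interval. The coefficients are free for
  \<open>S \<le> k < 2 ^ j - S\<close>, which gives the interior scaling functions; the other ones are values of a
  polynomial of degree less than \<open>S\<close>, which gives \<open>S\<close> boundary functions at each end point
  (and keeps all polynomials of degree less than \<open>S\<close> in the space). The dimension is \<open>2 ^ j\<close>.\<close>

definition mra_space :: "nat \<Rightarrow> (real \<Rightarrow> real) \<Rightarrow> nat \<Rightarrow> (real \<Rightarrow> real) set" where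
  "mra_space S \<phi> j =
     {g. \<exists>b :: int \<Rightarrow> real.
        (\<exists>q. degree q < S \<and> (\<forall>k. k < int S \<longrightarrow> b k = poly q (of_int k))) \<and>
        (\<exists>q. degree q < S \<and> (\<forall>k. 2 ^ j - int S \<le> k \<longrightarrow> b k = poly q (of_int k))) \<and>
        g = (\<lambda>x. indicator {0..1} x * (\<Sum>k\<in>{1 - int S..2 ^ j + int S - 2}. b k * dilate j k \<phi> x))}"

text \<open>The construction starts at a coarsest level \<open>J\<close> with \<open>2 ^ J \<ge> 2 * S\<close>. The \<open>2 ^ J\<close> scaling
  functions of level \<open>J\<close> are put at level \<open>0\<close> and the levels strictly between \<open>0\<close> and \<open>J\<close> are empty.\<close>

definition level_size :: "nat \<Rightarrow> nat \<Rightarrow> nat" where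
  "level_size J j = (if j = 0 then 2 ^ J else if j < J then 0 else 2 ^ j)"

text \<open>The boundary functions are only determined up to the choice of an orthonormal basis of the
  spaces they span; any choice is allowed. Since the family is orthonormal, membership of
  \<open>w j k\<close> in \<open>V\<^sub>j\<^sub>+\<^sub>1\<close> makes level \<open>j \<ge> J\<close> a basis of the orthogonal complement
  of \<open>V\<^sub>j\<close> in \<open>V\<^sub>j\<^sub>+\<^sub>1\<close>; as \<open>V\<^sub>j\<close> contains the polynomials of degree less than \<open>S\<close>, the boundary
  wavelets have \<open>S\<close> vanishing moments as well.\<close>

definition cdv_wavelet_basis :: "nat \<Rightarrow> nat \<Rightarrow> (nat \<Rightarrow> nat \<Rightarrow> real \<Rightarrow> real) \<Rightarrow> bool" where
  "cdv_wavelet_basis S J w \<longleftrightarrow>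
     2 * S \<le> 2 ^ J \<and>
     (\<exists>a \<phi>. daubechies_filter S a \<and> scaling_function S a \<phi> \<and>
        (\<forall>k<2 ^ J. w 0 k \<in> mra_space S \<phi> J) \<and>
        (\<forall>k. S \<le> k \<and> k + S < 2 ^ J \<longrightarrow> w 0 k = dilate J (int k) \<phi>) \<and>
        (\<forall>k<S. (\<forall>x. (2 * real S - 1) / 2 ^ J < x \<longrightarrow> w 0 k x = 0) \<and>
               (\<forall>x. x < 1 - (2 * real S - 1) / 2 ^ J \<longrightarrow> w 0 (2 ^ J - 1 - k) x = 0)) \<and>
        (\<forall>j\<ge>J. \<forall>k<2 ^ j. w j k \<in> mra_space S \<phi> (Suc j)) \<and>
        (\<forall>j\<ge>J. \<forall>k. S \<le> k \<and> k + S < 2 ^ j \<longrightarrow> w j k = dilate j (int k) (mother_wavelet S a \<phi>)) \<and>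
        (\<exists>wl wr. (\<forall>k<S. \<forall>y. y \<notin> {0..2 * real S - 1} \<longrightarrow> wl k y = 0 \<and> wr k y = 0) \<and>
           (\<forall>j\<ge>J. \<forall>k<S. w j k = (\<lambda>x. 2 powr (real j / 2) * wl k (2 ^ j * x)) \<and>
              w j (2 ^ j - 1 - k) = (\<lambda>x. 2 powr (real j / 2) * wr k (2 ^ j * (1 - x)))))) \<and>
     (\<forall>j k j' k'. k < level_size J j \<and> k' < level_size J j' \<longrightarrow>
        l2_inner (w j k) (w j' k') = (if j = j' \<and> k = k' then 1 else 0)) \<and>
     (\<forall>f\<in>L2_unit. (\<forall>j. \<forall>k<level_size J j. l2_inner f (w j k) = 0) \<longrightarrow>
        (AE x in lebesgue_on {0..1}. f x = 0))"

definition besov_norm_sq :: "nat \<Rightarrow> (nat \<Rightarrow> nat \<Rightarrow> real \<Rightarrow> real) \<Rightarrow> real \<Rightarrow> (real \<Rightarrow> real) \<Rightarrow> ennreal" where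
  "besov_norm_sq J w r f =
     (\<Sum>j. ennreal (2 powr (2 * real j * r) * (\<Sum>h<level_size J j. (l2_inner f (w j h))\<^sup>2)))"

definition besov_ball :: "nat \<Rightarrow> (nat \<Rightarrow> nat \<Rightarrow> real \<Rightarrow> real) \<Rightarrow> real \<Rightarrow> real \<Rightarrow> (real \<Rightarrow> real) set" where
  "besov_ball J w r L = {f \<in> L2_unit. besov_norm_sq J w r f < ennreal (L\<^sup>2)}"


section \<open>The distributed model\<close>

text \<open>\<open>p f\<close> is the density of a single observation with respect to \<open>\<mu>\<close>, and \<open>\<Theta>\<close> is the set
  of functions for which the model is defined.\<close>

definition stat_model :: "(real \<Rightarrow> real) set \<Rightarrow> 'x measure \<Rightarrow> ((real \<Rightarrow> real) \<Rightarrow> 'x \<Rightarrow> real) \<Rightarrow> bool" where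
  "stat_model \<Theta> \<mu> p \<longleftrightarrow>
     (\<forall>f\<in>\<Theta>. f \<in> L2_unit \<and> p f \<in> borel_measurable \<mu> \<and> (\<forall>x\<in>space \<mu>. 0 \<le> p f x) \<and>
             (\<integral>\<^sup>+x. ennreal (p f x) \<partial>\<mu>) = 1)"

definition obs_law :: "'x measure \<Rightarrow> ((real \<Rightarrow> real) \<Rightarrow> 'x \<Rightarrow> real) \<Rightarrow> (real \<Rightarrow> real) \<Rightarrow> 'x measure" where
  "obs_law \<mu> p f = density \<mu> (\<lambda>x. ennreal (p f x))"

definition local_law ::
  "'x measure \<Rightarrow> ((real \<Rightarrow> real) \<Rightarrow> 'x \<Rightarrow> real) \<Rightarrow> nat \<Rightarrow> (real \<Rightarrow> real) \<Rightarrow> (nat \<Rightarrow> 'x) measure" where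
  "local_law \<mu> p n f = PiM {..<n} (\<lambda>_. obs_law \<mu> p f)"

text \<open>In a data point \<open>X\<close>, the \<open>i\<close>-th observation of machine \<open>k\<close> is \<open>X k i\<close>
  (machines and observations are counted from \<open>0\<close>).\<close>

definition data_law ::
  "'x measure \<Rightarrow> ((real \<Rightarrow> real) \<Rightarrow> 'x \<Rightarrow> real) \<Rightarrow> nat \<Rightarrow> nat \<Rightarrow> (real \<Rightarrow> real) \<Rightarrow> (nat \<Rightarrow> nat \<Rightarrow> 'x) measure" where
  "data_law \<mu> p n m f = PiM {..<m} (\<lambda>_. local_law \<mu> p n f)"

definition dist_estimators ::
  "'x measure \<Rightarrow> ((real \<Rightarrow> real) \<Rightarrow> 'x \<Rightarrow> real) \<Rightarrow> (real \<Rightarrow> real) set \<Rightarrow> nat \<Rightarrow> nat \<Rightarrow> (nat \<Rightarrow> nat) \<Rightarrow>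
   ((nat \<Rightarrow> nat \<Rightarrow> 'x) \<Rightarrow> real \<Rightarrow> real) set" where
  "dist_estimators \<mu> p F n m B =
     {\<lambda>X. dec (map (\<lambda>k. enc k (X k)) [0..<m]) |
        (enc :: nat \<Rightarrow> (nat \<Rightarrow> 'x) \<Rightarrow> bool list) (dec :: bool list list \<Rightarrow> real \<Rightarrow> real).
        (\<forall>k<m. enc k \<in> measurable (PiM {..<n} (\<lambda>_. \<mu>)) (count_space UNIV) \<and>
               (\<forall>f\<in>F. AE x in local_law \<mu> p n f. length (enc k x) \<le> B k)) \<and>
        (\<forall>y. dec y \<in> L2_unit)}"

definition minimax_risk ::
  "'x measure \<Rightarrow> ((real \<Rightarrow> real) \<Rightarrow> 'x \<Rightarrow> real) \<Rightarrow> (real \<Rightarrow> real) set \<Rightarrow> nat \<Rightarrow> nat \<Rightarrow> (nat \<Rightarrow> nat) \<Rightarrow> ennreal" where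
  "minimax_risk \<mu> p F n m B =
     (INF est\<in>dist_estimators \<mu> p F n m B. SUP f\<in>F. \<integral>\<^sup>+X. l2_dist_sq (est X) f \<partial>data_law \<mu> p n m f)"

definition bass_rhs :: "real \<Rightarrow> nat \<Rightarrow> nat \<Rightarrow> (nat \<Rightarrow> nat) \<Rightarrow> real \<Rightarrow> real" where
  "bass_rhs r n m B x =
     max (real n * ln (real (n * m)))
       (real n * (\<Sum>k<m. min (real (B k) * ln (real (n * m)) / x powr (1 / (1 + 2 * r))) 1))"

definition N_bass :: "real \<Rightarrow> nat \<Rightarrow> nat \<Rightarrow> (nat \<Rightarrow> nat) \<Rightarrow> real" where
  "N_bass r n m B = (THE x. 0 < x \<and> x = bass_rhs r n m B x)"

lemma bass_ex1:
  assumes "0 < r" "2 \<le> n * m"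
  shows "\<exists>!x. 0 < x \<and> x = bass_rhs r n m B x"
proof -
  define G where "G = bass_rhs r n m B"
  have n: "0 < n" and m: "0 < m"
    using assms(2) by (auto intro!: Nat.gr0I)
  have ln: "0 < ln (real (n * m))"
    using assms(2) by (intro ln_gt_zero) linarith
  have anti: "G y \<le> G x" if "0 < x" "x \<le> y" for x y
    unfolding G_def bass_rhs_def using that assms ln
    by (intro max.mono mult_left_mono sum_mono min.mono divide_left_mono powr_mono2
          mult_nonneg_nonneg mult_pos_pos) auto
  define x0 where "x0 = real n * ln (real (n * m))"
  have x0: "0 < x0" using n ln by (simp add: x0_def)
  have low: "x0 \<le> G x" for x unfolding G_def bass_rhs_def x0_def by simp
  define x1 where "x1 = G x0"
  have x1: "x0 \<le> x1" unfolding x1_def by (rule low)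
  have cont: "continuous_on {x0..x1} (\<lambda>x. x - G x)"
    unfolding G_def bass_rhs_def using x0 by (intro continuous_intros) auto
  have "\<exists>x\<ge>x0. x \<le> x1 \<and> x - G x = 0"
    using x1 low[of x0] anti[OF x0 x1] cont by (intro IVT') (auto simp: x1_def)
  then obtain x where x: "x0 \<le> x" "x = G x" by auto
  show ?thesis
  proof (rule ex1I[of _ x])
    show "0 < x \<and> x = bass_rhs r n m B x" using x x0 by (simp add: G_def)
  next
    fix y assume "0 < y \<and> y = bass_rhs r n m B y"
    then show "y = x"
      using anti[of x y] anti[of y x] x x0 by (fastforce simp: G_def)
  qed
qed


section \<open>The sieve and the assumptions\<close>

definition signs :: "nat \<Rightarrow> (nat \<Rightarrow> real) set" where
  "signs d = {..<d} \<rightarrow>\<^sub>E {-1, 1}"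

definition sieve_layout ::
  "nat \<Rightarrow> (nat \<Rightarrow> nat \<Rightarrow> real \<Rightarrow> real) \<Rightarrow> nat \<Rightarrow> nat \<Rightarrow> (nat \<Rightarrow> real set) \<Rightarrow> (nat \<Rightarrow> nat) \<Rightarrow> bool" where
  "sieve_layout J w d j I \<kappa> \<longleftrightarrow>
     (\<forall>h<d. is_interval (I h)) \<and> disjoint_family_on I {..<d} \<and> (\<Union>h<d. I h) = {0..1} \<and>
     (\<forall>h<d. \<kappa> h < level_size J j \<and> closure {x. w j (\<kappa> h) x \<noteq> 0} \<subseteq> I h)"

definition minimal_sieve_layout ::
  "nat \<Rightarrow> (nat \<Rightarrow> nat \<Rightarrow> real \<Rightarrow> real) \<Rightarrow> nat \<Rightarrow> nat \<Rightarrow> (nat \<Rightarrow> real set) \<Rightarrow> (nat \<Rightarrow> nat) \<Rightarrow> bool" where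
  "minimal_sieve_layout J w d j I \<kappa> \<longleftrightarrow>
     sieve_layout J w d j I \<kappa> \<and> (\<forall>j'<j. \<nexists>I' \<kappa>'. sieve_layout J w d j' I' \<kappa>')"

text \<open>The element \<open>f\<^sub>\<beta> + C\<^sub>0\<close> of the sieve.\<close>

definition sieve_fn ::
  "(nat \<Rightarrow> nat \<Rightarrow> real \<Rightarrow> real) \<Rightarrow> real \<Rightarrow> nat \<Rightarrow> nat \<Rightarrow> (nat \<Rightarrow> nat) \<Rightarrow> real \<Rightarrow> real \<Rightarrow> (nat \<Rightarrow> real) \<Rightarrow> real \<Rightarrow> real" where
  "sieve_fn w r d j \<kappa> C0 \<epsilon> \<beta> t =
     \<epsilon> * real d powr (- (r + 1/2)) * (\<Sum>h<d. \<beta> h * w j (\<kappa> h) t) + C0"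

text \<open>At points where a density vanishes, the value of this expression is a junk value.\<close>

definition llr :: "((real \<Rightarrow> real) \<Rightarrow> 'x \<Rightarrow> real) \<Rightarrow> (real \<Rightarrow> real) \<Rightarrow> (real \<Rightarrow> real) \<Rightarrow> 'x \<Rightarrow> real" where
  "llr p f g x = ln (p f x / p g x)"

text \<open>In the assumptions below, \<open>g \<beta>\<close> stands for \<open>f\<^sub>\<beta> + C\<^sub>0\<close>. Read in the extended reals, a finite
  expectation of the log-likelihood ratio means that it is almost surely finite (so the denominator
  almost surely does not vanish) and integrable; both are spelled out, since \<open>ln\<close> and the
  integral are total functions. Consequently all densities of the sieve vanish on the same set
  up to null sets, and the junk values of \<open>llr\<close> do not matter in the tail event.\<close>

definition expectation_control ::
  "'x measure \<Rightarrow> ((real \<Rightarrow> real) \<Rightarrow> 'x \<Rightarrow> real) \<Rightarrow> nat \<Rightarrow> nat \<Rightarrow> nat \<Rightarrow> ((nat \<Rightarrow> real) \<Rightarrow> real \<Rightarrow> real) \<Rightarrow> real \<Rightarrow> bool" where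
  "expectation_control \<mu> p n m d g b \<longleftrightarrow>
     (\<forall>\<beta>\<in>signs d. \<forall>\<beta>'\<in>signs d. \<forall>i<n. \<forall>k<m.
        (AE X in data_law \<mu> p n m (g \<beta>). 0 < p (g \<beta>') (X k i)) \<and>
        integrable (data_law \<mu> p n m (g \<beta>)) (\<lambda>X. llr p (g \<beta>) (g \<beta>') (X k i)) \<and>
        (LINT X|data_law \<mu> p n m (g \<beta>). llr p (g \<beta>) (g \<beta>') (X k i)) \<le> b)"

text \<open>Conditional distribution of the random variable \<open>Y\<close> given the event \<open>Y \<in> A\<close>.\<close>

definition cond_distr :: "'a measure \<Rightarrow> 'x measure \<Rightarrow> ('a \<Rightarrow> 'x) \<Rightarrow> 'x set \<Rightarrow> 'x measure" where
  "cond_distr D \<mu> Y A = distr (uniform_measure D {\<omega> \<in> space D. Y \<omega> \<in> A}) \<mu> Y"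

definition decomposable_structure ::
  "'x measure \<Rightarrow> ((real \<Rightarrow> real) \<Rightarrow> 'x \<Rightarrow> real) \<Rightarrow> nat \<Rightarrow> nat \<Rightarrow> nat \<Rightarrow> ((nat \<Rightarrow> real) \<Rightarrow> real \<Rightarrow> real) \<Rightarrow>
   (nat \<Rightarrow> 'x set) \<Rightarrow> bool" where
  "decomposable_structure \<mu> p n m d g \<Xi> \<longleftrightarrow>
     (\<forall>h<d. \<Xi> h \<in> sets \<mu>) \<and> disjoint_family_on \<Xi> {..<d} \<and> (\<Union>h<d. \<Xi> h) = space \<mu> \<and>
     (\<forall>\<beta>\<in>signs d. \<forall>h<d. measure (obs_law \<mu> p (g \<beta>)) (\<Xi> h) = 1 / real d) \<and>
     (\<forall>i<n. \<forall>k<m. \<forall>h<d. \<forall>\<beta>\<in>signs d. \<forall>\<beta>'\<in>signs d. \<beta> h = \<beta>' h \<longrightarrow>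
        cond_distr (data_law \<mu> p n m (g \<beta>)) \<mu> (\<lambda>X. X k i) (\<Xi> h) =
        cond_distr (data_law \<mu> p n m (g \<beta>')) \<mu> (\<lambda>X. X k i) (\<Xi> h))"

definition tail_event ::
  "((real \<Rightarrow> real) \<Rightarrow> 'x \<Rightarrow> real) \<Rightarrow> nat \<Rightarrow> nat \<Rightarrow> ((nat \<Rightarrow> real) \<Rightarrow> real \<Rightarrow> real) \<Rightarrow> (nat \<Rightarrow> 'x set) \<Rightarrow>
   nat \<Rightarrow> real \<Rightarrow> (nat \<Rightarrow> 'x) set" where
  "tail_event p n d g \<Xi> h a =
     {x. Max ((\<lambda>(\<beta>, \<beta>'). \<Sum>i\<in>{i. i < n \<and> x i \<in> \<Xi> h}. llr p (g \<beta>) (g \<beta>') (x i)) ` (signs d \<times> signs d)) \<le> a}"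

text \<open>As the probability of the tail event depends on \<open>\<beta>\<close> only through \<open>\<beta> h\<close>, quantifying over
  \<open>\<beta>\<close> is the same as quantifying over the value of \<open>\<beta> h\<close>.\<close>

definition tail_control ::
  "'x measure \<Rightarrow> ((real \<Rightarrow> real) \<Rightarrow> 'x \<Rightarrow> real) \<Rightarrow> nat \<Rightarrow> nat \<Rightarrow> nat \<Rightarrow> ((nat \<Rightarrow> real) \<Rightarrow> real \<Rightarrow> real) \<Rightarrow>
   (nat \<Rightarrow> 'x set) \<Rightarrow> real \<Rightarrow> real \<Rightarrow> bool" where
  "tail_control \<mu> p n m d g \<Xi> a \<eta> \<longleftrightarrow>
     (\<forall>h<d. \<forall>k<m. \<forall>\<beta>\<in>signs d.
        \<bar>measure (data_law \<mu> p n m (g \<beta>))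
           {X \<in> space (data_law \<mu> p n m (g \<beta>)). X k \<in> tail_event p n d g \<Xi> h a} - 1\<bar> \<le> \<eta>)"

end

theory Submission
  imports Defs
begin

text \<open>The bound rests on three facts about the prior that draws \<open>\<beta>\<close> uniformly from the sign vectors.

  Assouad: write \<open>\<delta> = \<epsilon> d\<^bsup>-(r+1/2)\<^esup>\<close>. The wavelets of the sieve live in disjoint intervals, so the loss
  splits over the coordinates \<open>h\<close>, and an estimate cannot be within \<open>\<delta>\<close> in coordinate \<open>h\<close> both of \<open>\<beta>\<close>
  and of the vector obtained by flipping \<open>\<beta>\<^sub>h\<close>. Averaging over \<open>\<beta>\<close>, the risk is at least of order
  \<open>\<delta>\<^sup>2 d = \<epsilon>\<^sup>2 d\<^bsup>-2r\<^esup>\<close>, provided that for most \<open>h\<close> the flip is hardly visible in the messages. The machines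
  are independent once \<open>\<beta>\<close> is fixed, so visibility is measured by the Hellinger affinity
  \<open>\<Sum>\<^sub>y \<surd>(P(y) P'(y))\<close> of the message laws, which is multiplicative over the machines. It therefore
  suffices that the defects (one minus the affinity), summed over machines and flips, are at most
  \<open>d/4\<close> (\<open>distributed_assouad\<close>).

  No machine reveals more than its data: the affinity defect is at most half of the
  Kullback-Leibler divergence (\<open>affinity_le_of_KL\<close>). By the bin structure the divergences of the
  \<open>d\<close> flips add up to that of flipping all signs at once (\<open>sum_KL_flips_le\<close>), so expectation control
  bounds the sum of the defects of one machine by \<open>n C \<epsilon>\<^sup>2 d\<^bsup>-2r\<^esup> / 2\<close>.

  Few bits reveal little: let \<open>Z\<^sub>h\<close> be the likelihood ratio of the flip of \<open>\<beta>\<^sub>h\<close>. A message \<open>y\<close> changes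
  the likelihood of that flip by the conditional mean of \<open>Z\<^sub>h - 1\<close> given \<open>y\<close>. Given the bins
  that the \<open>n\<close> observations fall into, the \<open>Z\<^sub>h\<close> are independent with mean one, and by tail control
  they are within \<open>2 a\<^sub>n\<close> of one up to small probability. Conditioning \<open>d\<close> independent centred variables
  of size \<open>a\<close> on an event of probability \<open>q\<close> produces means whose squares sum to at most a multiple of
  \<open>a\<^sup>2 ln (1/q)\<close> (\<open>sum_sq_partial_mean_le\<close>). Averaged over the messages this becomes entropy, so the sum
  of the defects of a machine with budget \<open>B\<close> is of order \<open>a\<^sub>n\<^sup>2 B\<close>
  (\<open>hellinger_strong_data_processing\<close>, \<open>bounded_budget_affinity\<close>).

  As \<open>a\<^sub>n\<^sup>2 = C\<^sup>2 \<epsilon>\<^sup>2 d\<^bsup>-1-2r\<^esup> n log N\<close>, the smaller of the two bounds is of order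
  \<open>\<epsilon>\<^sup>2 n d\<^bsup>-2r\<^esup> min(1, B log N / d)\<close>. The defining equation of the bit adjusted sample size says exactly that
  these terms, summed over the machines, are of order \<open>\<epsilon>\<^sup>2 d\<close> when \<open>d\<close> is of order
  \<open>N\<^sub>b\<^sub>a\<^sub>s\<^sub>s\<^bsup>1/(1+2r)\<^esup>\<close> (\<open>information_budget\<close>); a small fixed \<open>\<epsilon>\<close> makes them less than \<open>d/4\<close>.\<close>

section \<open>Means of centred variables on events of given probability\<close>

text \<open>A main term \<open>U\<close> is charged through its square and an error \<open>R\<close> linearly: the left side is at most
  both \<open>\<bar>p' - q\<bar>\<close> and \<open>(p' - q)\<^sup>2 / q\<close>, and the bound to use depends on which of \<open>U\<close>, \<open>R\<close> is larger.
  Square-summability of the \<open>U\<close>'s and an \<open>L\<^sub>1\<close> bound on the truncation error \<open>R\<close> are what is at hand later.\<close>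

lemma sq_diff_sqrt_le:
  fixes q p' U R :: real
  assumes q: "0 < q" and p': "0 \<le> p'" and eq: "p' = q + U + R"
  shows "(sqrt q - sqrt p')\<^sup>2 \<le> 4 * U\<^sup>2 / q + 2 * \<bar>R\<bar>"
proof -
  define a b where "a = sqrt q" and "b = sqrt p'"
  have a: "0 < a" "a\<^sup>2 = q" and b: "0 \<le> b" "b\<^sup>2 = p'"
    using q p' by (auto simp: a_def b_def)
  have fac: "p' - q = (b - a) * (b + a)"
    using a b by (simp add: power2_eq_square algebra_simps)
  have 1: "(a - b)\<^sup>2 \<le> \<bar>p' - q\<bar>"
  proof -
    have "(a - b)\<^sup>2 = \<bar>b - a\<bar> * \<bar>b - a\<bar>"
      by (simp add: power2_eq_square algebra_simps)
    also have "\<dots> \<le> \<bar>b - a\<bar> * (b + a)" using a b by (intro mult_left_mono) auto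
    also have "\<dots> = \<bar>p' - q\<bar>" using a b by (simp add: fac abs_mult)
    finally show ?thesis .
  qed
  have 2: "(a - b)\<^sup>2 \<le> (p' - q)\<^sup>2 / q"
  proof -
    have "(a - b)\<^sup>2 * q \<le> (a - b)\<^sup>2 * (b + a)\<^sup>2"
      using a b by (intro mult_left_mono) (auto simp flip: a(2) intro!: power_mono)
    also have "\<dots> = (p' - q)\<^sup>2" by (simp add: fac power_mult_distrib power2_commute)
    finally show ?thesis using q by (simp add: field_simps)
  qed
  show ?thesis
  proof (cases "\<bar>R\<bar> \<le> \<bar>U\<bar>")
    case True
    then have "\<bar>p' - q\<bar> \<le> \<bar>2 * U\<bar>" using eq by linarith
    then have "(p' - q)\<^sup>2 \<le> (2 * U)\<^sup>2" by (simp only: abs_le_square_iff)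
    then have "(p' - q)\<^sup>2 / q \<le> 4 * U\<^sup>2 / q"
      using q by (intro divide_right_mono) (auto simp: power_mult_distrib)
    then show ?thesis using 2 unfolding a_def b_def by linarith
  next
    case False
    then have "\<bar>p' - q\<bar> \<le> 2 * \<bar>R\<bar>" using eq by linarith
    moreover have "0 \<le> 4 * U\<^sup>2 / q" using q by simp
    ultimately show ?thesis using 1 unfolding a_def b_def by linarith
  qed
qed

lemma sum_entropy_le_ln_card:
  fixes q :: "'y \<Rightarrow> real"
  assumes "finite Y" and q: "\<And>y. y \<in> Y \<Longrightarrow> 0 \<le> q y" and one: "(\<Sum>y\<in>Y. q y) = 1"
  shows "(\<Sum>y\<in>Y. q y * ln (1 / q y)) \<le> ln (real (card Y))"
proof -
  define K where "K = real (card Y)"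
  have "Y \<noteq> {}" using one by auto
  then have K: "0 < K" using assms(1) by (simp add: K_def card_gt_0_iff)
  have "q y * ln (1 / q y) \<le> q y * ln K + (1 / K - q y)" if "y \<in> Y" for y
  proof (cases "q y = 0")
    case False
    then have q0: "0 < q y" using q[OF that] by simp
    have "ln (1 / q y) - ln K = ln (1 / (q y * K))"
      using q0 K by (simp add: ln_div ln_mult)
    also have "\<dots> \<le> 1 / (q y * K) - 1" using q0 K by (intro ln_le_minus_one) simp
    finally have "q y * (ln (1 / q y) - ln K) \<le> q y * (1 / (q y * K) - 1)"
      using q0 by (intro mult_left_mono) auto
    also have "\<dots> = 1 / K - q y" using q0 K by (simp add: field_simps)
    finally show ?thesis by (simp add: algebra_simps)
  qed (use K in simp)
  then have "(\<Sum>y\<in>Y. q y * ln (1 / q y)) \<le> (\<Sum>y\<in>Y. q y * ln K + (1 / K - q y))"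
    by (rule sum_mono)
  also have "\<dots> = (\<Sum>y\<in>Y. q y) * ln K + (real (card Y) * (1 / K) - (\<Sum>y\<in>Y. q y))"
    by (simp add: sum.distrib sum_subtractf sum_distrib_right)
  also have "\<dots> = ln K" using one K by (simp add: K_def)
  finally show ?thesis by (simp add: K_def)
qed

lemma (in prob_space) centered_mgf_le:
  fixes V :: "'a \<Rightarrow> real"
  assumes [measurable]: "random_variable borel V"
    and rng: "AE \<omega> in M. V \<omega> \<in> {l..l + 2 * b}" and mean: "expectation V = 0"
  shows "(\<integral>\<^sup>+\<omega>. ennreal (exp (t * V \<omega>)) \<partial>M) \<le> ennreal (exp (t\<^sup>2 * b\<^sup>2 / 2))"
proof -
  consider "t = 0" | "0 < t" | "t < 0" by linarith
  then show ?thesis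
  proof cases
    case 1 then show ?thesis by (simp add: emeasure_space_1)
  next
    case 2
    interpret interval_bounded_random_variable M V l "l + 2 * b"
      by unfold_locales (use rng in auto)
    show ?thesis using Hoeffdings_lemma_nn_integral_0[OF 2 mean]
      by (simp add: power_mult_distrib mult_ac)
  next
    case 3
    interpret interval_bounded_random_variable M "\<lambda>\<omega>. - V \<omega>" "- l - 2 * b" "- l"
      by unfold_locales (use rng in auto)
    show ?thesis using Hoeffdings_lemma_nn_integral_0[of "- t"] 3 mean
      by (simp add: power_mult_distrib mult_ac)
  qed
qed

text \<open>Let \<open>u\<^sub>h\<close> be the conditional mean of \<open>V\<^sub>h\<close> given \<open>G\<close>, and \<open>W = \<Sum> u\<^sub>h V\<^sub>h\<close>. The conditional mean of \<open>W\<close> is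
  \<open>s = \<Sum> u\<^sub>h\<^sup>2\<close>. Conditioning on \<open>G\<close> increases the mean of \<open>exp (t W)\<close> by a factor of at most
  \<open>1 / prob G\<close>, while by independence and Hoeffding's lemma the unconditional mean is at most \<open>exp (t\<^sup>2 b\<^sup>2 s / 2)\<close>.
  Hence \<open>t s \<le> t\<^sup>2 b\<^sup>2 s / 2 + ln (1 / prob G)\<close> for all \<open>t\<close>.\<close>

lemma (in prob_space) sum_sq_partial_mean_le:
  fixes V :: "'h \<Rightarrow> 'a \<Rightarrow> real"
  assumes fin: "finite H" and ind: "indep_vars (\<lambda>_. borel) V H"
    and rng: "\<And>h. h \<in> H \<Longrightarrow> AE \<omega> in M. V h \<omega> \<in> {l h..l h + 2 * b}"
    and mean: "\<And>h. h \<in> H \<Longrightarrow> expectation (V h) = 0"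
    and G[measurable]: "G \<in> events" and q0: "0 < prob G" and b: "0 < b"
  shows "(\<Sum>h\<in>H. (expectation (\<lambda>\<omega>. V h \<omega> * indicator G \<omega>))\<^sup>2)
           \<le> 2 * b\<^sup>2 * (prob G)\<^sup>2 * ln (1 / prob G)"
proof -
  define q where "q = prob G"
  define u where "u h = expectation (\<lambda>\<omega>. V h \<omega> * indicator G \<omega>) / q" for h
  define s where "s = (\<Sum>h\<in>H. (u h)\<^sup>2)"
  define W where "W \<omega> = (\<Sum>h\<in>H. u h * V h \<omega>)" for \<omega>
  (* the value of t that minimises t^2 b^2 s / 2 - t s *)
  define t where "t = 1 / b\<^sup>2"
  have q: "0 < q" using q0 by (simp add: q_def)
  have V[measurable]: "random_variable borel (V h)" if "h \<in> H" for h
    using ind that by (auto simp: indep_vars_def2)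
  have Vint: "integrable M (V h)" if "h \<in> H" for h
  proof (rule integrable_const_bound)
    show "AE \<omega> in M. norm (V h \<omega>) \<le> \<bar>l h\<bar> + 2 * b"
      using rng[OF that] by eventually_elim (use b in auto)
  qed (use that in measurable)
  have VG: "integrable M (\<lambda>\<omega>. V h \<omega> * indicator G \<omega>)" if "h \<in> H" for h
    using integrable_real_mult_indicator[OF G Vint[OF that]] by (simp add: mult.commute)
  have W[measurable]: "random_variable borel W" unfolding W_def by measurable
  have WG_eq: "W \<omega> * indicator G \<omega> = (\<Sum>h\<in>H. u h * (V h \<omega> * indicator G \<omega>))" for \<omega>
    by (simp add: W_def sum_distrib_right mult.assoc)
  have WG: "integrable M (\<lambda>\<omega>. W \<omega> * indicator G \<omega>)"
    unfolding WG_eq using VG by (intro Bochner_Integration.integrable_sum integrable_mult_right) auto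
  have EW: "expectation (\<lambda>\<omega>. W \<omega> * indicator G \<omega>) = q * s"
    unfolding WG_eq using VG q
    by (simp add: u_def s_def sum_distrib_left power2_eq_square)
  have mgf: "(\<integral>\<^sup>+\<omega>. ennreal (exp (t * W \<omega>)) \<partial>M) \<le> ennreal (exp (t\<^sup>2 * b\<^sup>2 / 2 * s))"
  proof -
    have "(\<integral>\<^sup>+\<omega>. ennreal (exp (t * W \<omega>)) \<partial>M)
        = (\<integral>\<^sup>+\<omega>. (\<Prod>h\<in>H. ennreal (exp (t * u h * V h \<omega>))) \<partial>M)"
      using fin by (simp add: W_def sum_distrib_left exp_sum prod_ennreal mult.assoc)
    also have "\<dots> = (\<Prod>h\<in>H. \<integral>\<^sup>+\<omega>. ennreal (exp (t * u h * V h \<omega>)) \<partial>M)"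
      using fin by (intro indep_vars_nn_integral indep_vars_compose2[OF ind]) auto
    also have "\<dots> \<le> (\<Prod>h\<in>H. ennreal (exp ((t * u h)\<^sup>2 * b\<^sup>2 / 2)))"
      using rng mean by (intro prod_mono_ennreal centered_mgf_le) auto
    also have "\<dots> = ennreal (exp (t\<^sup>2 * b\<^sup>2 / 2 * s))"
      using fin by (simp add: prod_ennreal exp_sum[symmetric] s_def sum_distrib_left
          power_mult_distrib mult_ac)
    finally show ?thesis .
  qed
  then have eint: "integrable M (\<lambda>\<omega>. exp (t * W \<omega>))"
    by (intro integrableI_nonneg) (auto intro: order.strict_trans1)
  have Ele: "expectation (\<lambda>\<omega>. exp (t * W \<omega>)) \<le> exp (t\<^sup>2 * b\<^sup>2 / 2 * s)"
    using mgf nn_integral_eq_integral[OF eint] by simp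
  have G1: "integrable M (indicator G :: 'a \<Rightarrow> real)"
    by (intro integrable_real_indicator) (auto simp: less_top[symmetric])
  have "exp (t * s) * q = expectation (\<lambda>\<omega>. exp (t * s) * ((1 - t * s) * indicator G \<omega>
        + t * (W \<omega> * indicator G \<omega>)))"
  proof -
    have "expectation (\<lambda>\<omega>. (1 - t * s) * indicator G \<omega> + t * (W \<omega> * indicator G \<omega>))
        = (1 - t * s) * q + t * (q * s)"
      using WG EW G1 by (simp add: q_def)
    also have "\<dots> = q" by (simp add: algebra_simps)
    finally show ?thesis by simp
  qed
  also have "\<dots> \<le> expectation (\<lambda>\<omega>. exp (t * W \<omega>))"
  proof (rule integral_mono)
    show "exp (t * s) * ((1 - t * s) * indicator G \<omega> + t * (W \<omega> * indicator G \<omega>)) \<le> exp (t * W \<omega>)" for \<omega>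
    proof (cases "\<omega> \<in> G")
      case True
      (* tangent of the exponential at t s, the conditional mean of t W: it replaces Jensen's inequality *)
      have "exp (t * s) * (1 + (t * W \<omega> - t * s)) \<le> exp (t * s) * exp (t * W \<omega> - t * s)"
        by (intro mult_left_mono exp_ge_add_one_self) auto
      also have "\<dots> = exp (t * W \<omega>)" by (simp flip: exp_add)
      finally show ?thesis using True by (simp add: algebra_simps)
    qed simp
  qed (use WG eint G1 in auto)
  finally have "exp (t * s) * q \<le> exp (t\<^sup>2 * b\<^sup>2 / 2 * s)" using Ele by linarith
  then have "ln (exp (t * s) * q) \<le> ln (exp (t\<^sup>2 * b\<^sup>2 / 2 * s))"
    using q by (subst ln_le_cancel_iff) auto
  then have "t * s + ln q \<le> t\<^sup>2 * b\<^sup>2 / 2 * s" using q by (simp add: ln_mult)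
  also have "\<dots> = t * s / 2" using b by (simp add: t_def power2_eq_square)
  finally have "s / b\<^sup>2 \<le> 2 * ln (1 / q)" using q by (simp add: t_def ln_div)
  then have s: "s \<le> 2 * b\<^sup>2 * ln (1 / q)" using b by (simp add: field_simps)
  have "(\<Sum>h\<in>H. (expectation (\<lambda>\<omega>. V h \<omega> * indicator G \<omega>))\<^sup>2) = q\<^sup>2 * s"
    using q by (simp add: s_def u_def sum_distrib_left power_divide)
  also have "\<dots> \<le> q\<^sup>2 * (2 * b\<^sup>2 * ln (1 / q))" using s by (intro mult_left_mono) auto
  finally show ?thesis by (simp add: q_def mult_ac)
qed

section \<open>Strong data processing for the Hellinger affinity\<close>

lemma (in prob_space) sum_expectation_fibres:
  fixes f :: "'a \<Rightarrow> real"
  assumes [measurable]: "Y \<in> measurable M (count_space UNIV)" 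
    and fin: "finite R" and Y: "AE \<omega> in M. Y \<omega> \<in> R" and f: "integrable M f"
  shows "(\<Sum>y\<in>R. expectation (\<lambda>\<omega>. f \<omega> * indicator (Y -` {y} \<inter> space M) \<omega>)) = expectation f"
proof -
  have fy: "integrable M (\<lambda>\<omega>. f \<omega> * indicator (Y -` {y} \<inter> space M) \<omega>)" for y
    using integrable_real_mult_indicator[OF _ f, of "Y -` {y} \<inter> space M"] by (simp add: mult.commute)
  have "(\<Sum>y\<in>R. expectation (\<lambda>\<omega>. f \<omega> * indicator (Y -` {y} \<inter> space M) \<omega>))
      = expectation (\<lambda>\<omega>. \<Sum>y\<in>R. f \<omega> * indicator (Y -` {y} \<inter> space M) \<omega>)"
    using fy by (simp add: Bochner_Integration.integral_sum)
  also have "\<dots> = expectation f"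
  proof (rule integral_cong_AE)
    show "AE \<omega> in M. (\<Sum>y\<in>R. f \<omega> * indicator (Y -` {y} \<inter> space M) \<omega>) = f \<omega>"
      using Y AE_space
    proof eventually_elim
      case (elim \<omega>)
      then have "(\<Sum>y\<in>R. f \<omega> * indicator (Y -` {y} \<inter> space M) \<omega>)
          = (\<Sum>y\<in>R. if y = Y \<omega> then f \<omega> else 0)"
        by (intro sum.cong) (auto simp: indicator_def)
      with elim fin show ?case by simp
    qed
  qed (use f fy in \<open>auto intro!: borel_measurable_sum dest: borel_measurable_integrable\<close>)
  finally show ?thesis .
qed

text \<open>\<open>Z h\<close> is the density of the \<open>h\<close>-th alternative, so the square root compares the probability of the message
  \<open>y\<close> under the null and under the alternative. Truncating \<open>Z h - 1\<close> at level \<open>b\<close> and centring leaves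
  bounded independent variables \<open>V h\<close>, which contribute at most \<open>4 b\<^sup>2 q\<^sub>y ln (1/q\<^sub>y)\<close> per message, in total
  \<open>4 b\<^sup>2\<close> times the entropy of the message; the remainder \<open>Q h\<close> is small in \<open>L\<^sub>1\<close>.\<close>

lemma (in prob_space) hellinger_strong_data_processing:
  fixes Z :: "'h \<Rightarrow> 'a \<Rightarrow> real" and Y :: "'a \<Rightarrow> 'y"
  assumes fin: "finite H" and ind: "indep_vars (\<lambda>_. borel) Z H"
    and nn: "\<And>h \<omega>. h \<in> H \<Longrightarrow> \<omega> \<in> space M \<Longrightarrow> 0 \<le> Z h \<omega>"
    and Zint: "\<And>h. h \<in> H \<Longrightarrow> integrable M (Z h)" and EZ: "\<And>h. h \<in> H \<Longrightarrow> expectation (Z h) = 1"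
    and Y[measurable]: "Y \<in> measurable M (count_space UNIV)"
    and R: "finite R" "AE \<omega> in M. Y \<omega> \<in> R" and b: "0 < b"
  shows "(\<Sum>h\<in>H. 1 - (\<Sum>y\<in>R. sqrt (prob (Y -` {y} \<inter> space M) *
            expectation (\<lambda>\<omega>. Z h \<omega> * indicator (Y -` {y} \<inter> space M) \<omega>))))
     \<le> 4 * b\<^sup>2 * ln (real (card R)) +
        2 * (\<Sum>h\<in>H. expectation (\<lambda>\<omega>. (Z h \<omega> + 1) * indicator {\<omega>\<in>space M. b < \<bar>Z h \<omega> - 1\<bar>} \<omega>))"
proof -
  define G where "G y = Y -` {y} \<inter> space M" for y
  define q where "q y = prob (G y)" for y
  define P where "P h y = expectation (\<lambda>\<omega>. Z h \<omega> * indicator (G y) \<omega>)" for h y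
  define bad where "bad h = {\<omega>\<in>space M. b < \<bar>Z h \<omega> - 1\<bar>}" for h
  define D where "D h \<omega> = (if \<bar>Z h \<omega> - 1\<bar> \<le> b then Z h \<omega> - 1 else 0)" for h \<omega>
  define V where "V h \<omega> = D h \<omega> - expectation (D h)" for h \<omega>
  define Q where "Q h \<omega> = Z h \<omega> - 1 - V h \<omega>" for h \<omega>
  define U where "U h y = expectation (\<lambda>\<omega>. V h \<omega> * indicator (G y) \<omega>)" for h y
  define T where "T h y = expectation (\<lambda>\<omega>. Q h \<omega> * indicator (G y) \<omega>)" for h y
  have Z[measurable]: "random_variable borel (Z h)" if "h \<in> H" for h
    using ind that by (auto simp: indep_vars_def2)
  have G[measurable]: "G y \<in> events" for y unfolding G_def by measurable
  have bad[measurable]: "bad h \<in> events" if "h \<in> H" for h unfolding bad_def using that by measurable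
  have Dm[measurable]: "random_variable borel (D h)" if "h \<in> H" for h
    unfolding D_def using that by measurable
  have Dint: "integrable M (D h)" if "h \<in> H" for h
    by (rule integrable_const_bound[where B=b]) (use that b in \<open>auto simp: D_def\<close>)
  have Vint: "integrable M (V h)" if "h \<in> H" for h unfolding V_def using Dint[OF that] by auto
  have Qint: "integrable M (Q h)" if "h \<in> H" for h
    unfolding Q_def using Vint[OF that] Zint[OF that] by auto
  have int_ind: "integrable M (\<lambda>\<omega>. f \<omega> * indicator A \<omega>)" if "integrable M f" "A \<in> events" for f :: "'a \<Rightarrow> real" and A
    using integrable_real_mult_indicator[OF that(2,1)] by (simp add: mult.commute)
  have ind_int: "integrable M (indicator A :: 'a \<Rightarrow> real)" if "A \<in> events" for A
    using that by (intro integrable_real_indicator) (auto simp: less_top[symmetric])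
  have sumq: "(\<Sum>y\<in>R. q y) = 1"
    using sum_expectation_fibres[OF Y R, of "\<lambda>_. 1"] by (simp add: q_def G_def prob_space)
  have sumP: "(\<Sum>y\<in>R. P h y) = 1" if "h \<in> H" for h
    using sum_expectation_fibres[OF Y R Zint[OF that]] EZ[OF that] by (simp add: P_def G_def)
  have q: "0 \<le> q y" for y by (simp add: q_def)
  have P: "0 \<le> P h y" if "h \<in> H" for h y
    unfolding P_def using nn[OF that] by (intro integral_nonneg_AE) auto
  have decomp: "P h y = q y + U h y + T h y" if h: "h \<in> H" for h y
  proof -
    have "Z h \<omega> * indicator (G y) \<omega>
        = indicator (G y) \<omega> + V h \<omega> * indicator (G y) \<omega> + Q h \<omega> * indicator (G y) \<omega>" for \<omega>
      by (simp add: Q_def algebra_simps)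
    then have "P h y = expectation (\<lambda>\<omega>. indicator (G y) \<omega> + V h \<omega> * indicator (G y) \<omega>
        + Q h \<omega> * indicator (G y) \<omega>)" by (simp add: P_def)
    also have "\<dots> = q y + U h y + T h y"
      using int_ind[OF Vint[OF h] G] int_ind[OF Qint[OF h] G] ind_int[OF G]
      by (simp add: q_def U_def T_def)
    finally show ?thesis .
  qed
  have term_le: "(sqrt (q y) - sqrt (P h y))\<^sup>2 \<le> 4 * (U h y)\<^sup>2 / q y + 2 * \<bar>T h y\<bar>" if h: "h \<in> H" for h y
  proof (cases "q y = 0")
    case True
    then have "AE \<omega> in M. \<omega> \<notin> G y"
      by (intro AE_not_in) (simp add: q_def emeasure_eq_measure null_sets_def)
    then have "P h y = expectation (\<lambda>_. 0)" unfolding P_def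
      by (intro integral_cong_AE) (use h in auto)
    then show ?thesis using True by simp
  next
    case False
    then show ?thesis using q[of y] P[OF h] decomp[OF h] by (intro sq_diff_sqrt_le) auto
  qed
  have BC: "1 - (\<Sum>y\<in>R. sqrt (q y * P h y)) \<le> (\<Sum>y\<in>R. 2 * (U h y)\<^sup>2 / q y) + (\<Sum>y\<in>R. \<bar>T h y\<bar>)"
    if h: "h \<in> H" for h
  proof -
    have "sqrt (q y * P h y) = (q y + P h y) / 2 - (sqrt (q y) - sqrt (P h y))\<^sup>2 / 2" for y
      using q[of y] P[OF h, of y] by (simp add: power2_diff real_sqrt_mult field_simps)
    then have "1 - (\<Sum>y\<in>R. sqrt (q y * P h y)) = (\<Sum>y\<in>R. (sqrt (q y) - sqrt (P h y))\<^sup>2) / 2"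
      using sumq sumP[OF h] by (simp add: sum_subtractf sum.distrib add_divide_distrib flip: sum_divide_distrib)
    also have "\<dots> \<le> (\<Sum>y\<in>R. 4 * (U h y)\<^sup>2 / q y + 2 * \<bar>T h y\<bar>) / 2"
      using term_le[OF h] by (intro divide_right_mono sum_mono) auto
    also have "\<dots> = (\<Sum>y\<in>R. 2 * (U h y)\<^sup>2 / q y) + (\<Sum>y\<in>R. \<bar>T h y\<bar>)"
      by (simp add: sum.distrib add_divide_distrib sum_divide_distrib)
    finally show ?thesis .
  qed
  have main: "(\<Sum>h\<in>H. \<Sum>y\<in>R. 2 * (U h y)\<^sup>2 / q y) \<le> 4 * b\<^sup>2 * ln (real (card R))"
  proof -
    have indV: "indep_vars (\<lambda>_. borel) V H"
    proof -
      have "indep_vars (\<lambda>_. borel) (\<lambda>h \<omega>. (\<lambda>z. (if \<bar>z - 1\<bar> \<le> b then z - 1 else 0) - expectation (D h)) (Z h \<omega>)) H"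
        by (rule indep_vars_compose2[OF ind]) measurable
      then show ?thesis by (simp add: V_def[abs_def] D_def[abs_def])
    qed
    have le: "(\<Sum>h\<in>H. 2 * (U h y)\<^sup>2 / q y) \<le> 4 * b\<^sup>2 * (q y * ln (1 / q y))" for y
    proof (cases "q y = 0")
      case False
      then have q0: "0 < q y" using q[of y] by simp
      have "(\<Sum>h\<in>H. (U h y)\<^sup>2) \<le> 2 * b\<^sup>2 * (prob (G y))\<^sup>2 * ln (1 / prob (G y))"
        unfolding U_def
      proof (rule sum_sq_partial_mean_le[OF fin indV])
        show "AE \<omega> in M. V h \<omega> \<in> {- b - expectation (D h)..(- b - expectation (D h)) + 2 * b}" for h
          using b by (auto simp: V_def D_def)
        show "expectation (V h) = 0" if "h \<in> H" for h
          unfolding V_def using Dint[OF that] by (simp add: prob_space)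
      qed (use q0 b in \<open>auto simp: q_def\<close>)
      then have "(\<Sum>h\<in>H. (U h y)\<^sup>2) / q y \<le> 2 * b\<^sup>2 * (q y)\<^sup>2 * ln (1 / q y) / q y"
        using q0 unfolding q_def by (intro divide_right_mono) auto
      also have "\<dots> = 2 * b\<^sup>2 * (q y * ln (1 / q y))"
        using q0 by (simp add: power2_eq_square)
      finally show ?thesis by (simp add: sum_divide_distrib sum_distrib_left flip: mult.assoc)
         (simp add: sum_divide_distrib[symmetric] sum_distrib_left[symmetric] mult.assoc)
    qed simp
    have "(\<Sum>h\<in>H. \<Sum>y\<in>R. 2 * (U h y)\<^sup>2 / q y) = (\<Sum>y\<in>R. \<Sum>h\<in>H. 2 * (U h y)\<^sup>2 / q y)"
      by (rule sum.swap)
    also have "\<dots> \<le> (\<Sum>y\<in>R. 4 * b\<^sup>2 * (q y * ln (1 / q y)))" by (intro sum_mono le)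
    also have "\<dots> = 4 * b\<^sup>2 * (\<Sum>y\<in>R. q y * ln (1 / q y))" by (simp add: sum_distrib_left)
    also have "\<dots> \<le> 4 * b\<^sup>2 * ln (real (card R))"
      using R q sumq by (intro mult_left_mono sum_entropy_le_ln_card) auto
    finally show ?thesis .
  qed
  have rest: "(\<Sum>y\<in>R. \<bar>T h y\<bar>) \<le> 2 * expectation (\<lambda>\<omega>. (Z h \<omega> + 1) * indicator (bad h) \<omega>)"
    if h: "h \<in> H" for h
  proof -
    note [measurable] = Z[OF h] bad[OF h]
    define W where "W \<omega> = (Z h \<omega> - 1) * indicator (bad h) \<omega>" for \<omega>
    have Wint: "integrable M W" unfolding W_def using Zint[OF h] bad[OF h] by (intro int_ind) auto
    have D_eq: "D h \<omega> = Z h \<omega> - 1 - W \<omega>" if "\<omega> \<in> space M" for \<omega>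
      using that by (auto simp: D_def W_def bad_def indicator_def)
    have ED: "expectation (D h) = - expectation W"
    proof -
      have "expectation (D h) = expectation (\<lambda>\<omega>. Z h \<omega> - 1 - W \<omega>)"
        by (intro Bochner_Integration.integral_cong D_eq) auto
      also have "\<dots> = - expectation W" using Zint[OF h] Wint EZ[OF h] by (simp add: prob_space)
      finally show ?thesis .
    qed
    (* the truncation moves the mean of Z h - 1 from 0 to minus the mean of the part cut off *)
    have Q_eq: "Q h \<omega> = W \<omega> - expectation W" if "\<omega> \<in> space M" for \<omega>
      using D_eq[OF that] by (simp add: Q_def V_def ED)
    have "(\<Sum>y\<in>R. \<bar>T h y\<bar>) \<le> (\<Sum>y\<in>R. expectation (\<lambda>\<omega>. \<bar>Q h \<omega>\<bar> * indicator (G y) \<omega>))"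
    proof (intro sum_mono)
      fix y
      have "\<bar>T h y\<bar> \<le> expectation (\<lambda>\<omega>. \<bar>Q h \<omega> * indicator (G y) \<omega>\<bar>)"
        unfolding T_def by (rule integral_abs_bound)
      then show "\<bar>T h y\<bar> \<le> expectation (\<lambda>\<omega>. \<bar>Q h \<omega>\<bar> * indicator (G y) \<omega>)"
        by (simp add: abs_mult)
    qed
    also have "\<dots> = expectation (\<lambda>\<omega>. \<bar>Q h \<omega>\<bar>)"
      unfolding G_def using Qint[OF h] by (intro sum_expectation_fibres[OF Y R]) auto
    also have "\<dots> \<le> expectation (\<lambda>\<omega>. \<bar>W \<omega>\<bar> + \<bar>expectation W\<bar>)"
      using Qint[OF h] Wint by (intro integral_mono) (auto simp: Q_eq)
    also have "\<dots> = expectation (\<lambda>\<omega>. \<bar>W \<omega>\<bar>) + \<bar>expectation W\<bar>"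
      using Wint by (simp add: prob_space)
    also have "\<dots> \<le> 2 * expectation (\<lambda>\<omega>. \<bar>W \<omega>\<bar>)" using integral_abs_bound[of M W] by simp
    also have "expectation (\<lambda>\<omega>. \<bar>W \<omega>\<bar>) \<le> expectation (\<lambda>\<omega>. (Z h \<omega> + 1) * indicator (bad h) \<omega>)"
    proof (intro integral_mono)
      show "\<bar>W \<omega>\<bar> \<le> (Z h \<omega> + 1) * indicator (bad h) \<omega>" if "\<omega> \<in> space M" for \<omega>
        using nn[OF h that] by (auto simp: W_def indicator_def)
    qed (use Wint Zint[OF h] bad[OF h] in \<open>auto intro!: int_ind\<close>)
    finally show ?thesis by simp
  qed
  have "(\<Sum>h\<in>H. 1 - (\<Sum>y\<in>R. sqrt (q y * P h y)))
      \<le> (\<Sum>h\<in>H. (\<Sum>y\<in>R. 2 * (U h y)\<^sup>2 / q y)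
            + 2 * expectation (\<lambda>\<omega>. (Z h \<omega> + 1) * indicator (bad h) \<omega>))"
    by (intro sum_mono) (use BC rest in fastforce)
  also have "\<dots> \<le> 4 * b\<^sup>2 * ln (real (card R))
      + 2 * (\<Sum>h\<in>H. expectation (\<lambda>\<omega>. (Z h \<omega> + 1) * indicator (bad h) \<omega>))"
    using main by (simp add: sum.distrib sum_distrib_left)
  finally show ?thesis unfolding q_def P_def G_def bad_def .
qed

section \<open>Conditioning product measures on boxes\<close>

lemma (in prob_space) uniform_measure_eq_density:
  assumes [measurable]: "A \<in> events" and A: "0 < prob A"
  shows "uniform_measure M A = density M (\<lambda>x. ennreal (indicator A x / prob A))"
  unfolding uniform_measure_def
proof (intro density_cong AE_I2)
  fix x show "indicator A x / emeasure M A = ennreal (indicator A x / prob A)"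
    using A divide_ennreal[of 1 "prob A"] by (auto simp: emeasure_eq_measure indicator_def)
qed auto

lemma (in prob_space) integral_uniform_measure:
  fixes f :: "'a \<Rightarrow> real"
  assumes [measurable]: "A \<in> events" "f \<in> borel_measurable M" and A: "0 < prob A"
  shows "integral\<^sup>L (uniform_measure M A) f = expectation (\<lambda>\<omega>. f \<omega> * indicator A \<omega>) / prob A"
proof -
  note uniform_measure_eq_density[OF assms(1) A]
  then have "integral\<^sup>L (uniform_measure M A) f = expectation (\<lambda>\<omega>. (indicator A \<omega> / prob A) *\<^sub>R f \<omega>)"
    by (simp add: integral_density)
  also have "\<dots> = expectation (\<lambda>\<omega>. f \<omega> * indicator A \<omega> / prob A)"
    by (simp add: mult.commute)
  finally show ?thesis by simp
qed

lemma (in prob_space) integrable_uniform_measure: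
  fixes f :: "'a \<Rightarrow> real"
  assumes [measurable]: "A \<in> events" and f: "integrable M f" and A: "0 < prob A"
  shows "integrable (uniform_measure M A) f"
proof -
  have [measurable]: "f \<in> borel_measurable M" using f by auto
  note uniform_measure_eq_density[OF assms(1) A]
  then show ?thesis
    using integrable_real_mult_indicator[OF assms(1) f]
    by (simp add: integrable_density mult.commute)
qed

text \<open>Conditioning a product measure on a box conditions each coordinate separately. With the box given by
  the bins of the individual observations, this is the law of the data once these bins are known.\<close>

lemma uniform_measure_PiM:
  assumes M: "\<And>i. prob_space (M i)" and I: "finite I" and A: "\<And>i. i \<in> I \<Longrightarrow> A i \<in> sets (M i)"
    and pos: "\<And>i. i \<in> I \<Longrightarrow> 0 < measure (M i) (A i)"
  shows "uniform_measure (PiM I M) (PiE I A)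
       = PiM I (\<lambda>i. if i \<in> I then uniform_measure (M i) (A i) else M i)"
    (is "?L = PiM I ?Q")
proof -
  interpret M: product_prob_space M
    using M by (intro product_prob_spaceI)
  have Q: "prob_space (?Q i)" for i
    using pos[of i] M[of i] prob_space_uniform_measure[of "M i" "A i"]
    by (auto simp: M.M.emeasure_eq_measure)
  interpret Q: product_prob_space ?Q
    using Q by (intro product_prob_spaceI)
  show ?thesis
  proof (rule Q.PiM_eqI[OF I])
    show "sets ?L = sets (PiM I ?Q)" by (simp cong: sets_PiM_cong)
    fix B assume "\<And>i. i \<in> I \<Longrightarrow> B i \<in> sets (?Q i)"
    then have B: "\<And>i. i \<in> I \<Longrightarrow> B i \<in> sets (M i)" by simp
    have pr: "(\<Prod>i\<in>I. measure (M i) (A i)) > 0" using pos by (intro prod_pos) auto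
    have "emeasure ?L (PiE I B) = emeasure (PiM I M) (PiE I (\<lambda>i. A i \<inter> B i)) / emeasure (PiM I M) (PiE I A)"
      using I A B by (simp add: PiE_Int)
    also have "\<dots> = (\<Prod>i\<in>I. emeasure (M i) (A i \<inter> B i)) / (\<Prod>i\<in>I. emeasure (M i) (A i))"
      using I A B by (simp add: M.emeasure_PiM)
    also have "\<dots> = (\<Prod>i\<in>I. emeasure (M i) (A i \<inter> B i) / emeasure (M i) (A i))"
      using pos pr
      by (simp add: M.M.emeasure_eq_measure prod_ennreal divide_ennreal prod_nonneg
          prod_dividef cong: prod.cong)
    also have "\<dots> = (\<Prod>i\<in>I. emeasure (?Q i) (B i))" using A B by simp
    finally show "emeasure ?L (PiE I B) = (\<Prod>i\<in>I. emeasure (?Q i) (B i))" .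
  qed
qed

lemma indep_vars_PiM_blocks:
  assumes M: "\<And>i. prob_space (M i)" and I: "I \<noteq> {}" and K: "\<And>h. h \<in> H \<Longrightarrow> K h \<subseteq> I" "disjoint_family_on K H"
    and g: "\<And>h. h \<in> H \<Longrightarrow> g h \<in> measurable (PiM (K h) M) (N h)"
  shows "prob_space.indep_vars (PiM I M) N (\<lambda>h x. g h (restrict x (K h))) H"
proof -
  interpret prob_space "PiM I M" using M by (intro prob_space_PiM)
  have "indep_vars M (\<lambda>i x. x i) I"
  proof (subst indep_vars_iff_distr_eq_PiM'[OF I])
    have "distr (PiM I M) (PiM I M) (\<lambda>x. \<lambda>i\<in>I. x i) = distr (PiM I M) (PiM I M) (\<lambda>x. x)"
      by (intro distr_cong) (auto simp: space_PiM)
    also have "\<dots> = PiM I M" by simp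
    also have "\<dots> = PiM I (\<lambda>i. distr (PiM I M) (M i) (\<lambda>x. x i))"
      using M by (intro PiM_cong) (auto simp: distr_PiM_component)
    finally show "distr (PiM I M) (PiM I M) (\<lambda>x. \<lambda>i\<in>I. x i) = PiM I (\<lambda>i. distr (PiM I M) (M i) (\<lambda>x. x i))" .
  qed auto
  from indep_vars_restrict[OF this K]
  have "indep_vars (\<lambda>h. PiM (K h) M) (\<lambda>h x. restrict (\<lambda>i. x i) (K h)) H" .
  from indep_vars_compose2[OF this g] show ?thesis by simp
qed

lemma PiM_density:
  fixes f :: "'x \<Rightarrow> real"
  assumes I: "finite I" and P: "prob_space P" and D: "prob_space (density P (\<lambda>x. ennreal (f x)))"
    and f[measurable]: "f \<in> borel_measurable P" and nn: "\<And>x. 0 \<le> f x"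
  shows "PiM I (\<lambda>_. density P (\<lambda>x. ennreal (f x))) = density (PiM I (\<lambda>_. P)) (\<lambda>x. ennreal (\<Prod>i\<in>I. f (x i)))"
    (is "PiM I (\<lambda>_. ?D) = ?R")
proof -
  interpret P: product_prob_space "\<lambda>_. P" I using P by (rule product_prob_spaceI)
  interpret D: product_prob_space "\<lambda>_. ?D" I using D by (rule product_prob_spaceI)
  show ?thesis
  proof (rule D.PiM_eqI[OF I, symmetric])
    show "sets ?R = sets (PiM I (\<lambda>_. ?D))" by (simp cong: sets_PiM_cong)
    fix B assume "\<And>i. i \<in> I \<Longrightarrow> B i \<in> sets ?D"
    then have B[measurable]: "\<And>i. i \<in> I \<Longrightarrow> B i \<in> sets P" by simp
    have PB: "PiE I B \<in> sets (PiM I (\<lambda>_. P))" using I B by (intro sets_PiM_I_finite) auto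
    have "emeasure ?R (PiE I B) = (\<integral>\<^sup>+x. ennreal (\<Prod>i\<in>I. f (x i)) * indicator (PiE I B) x \<partial>PiM I (\<lambda>_. P))"
      using PB I by (intro emeasure_density) measurable
    also have "\<dots> = (\<integral>\<^sup>+x. (\<Prod>i\<in>I. ennreal (f (x i)) * indicator (B i) (x i)) \<partial>PiM I (\<lambda>_. P))"
    proof (rule nn_integral_cong)
      fix x assume "x \<in> space (PiM I (\<lambda>_. P))"
      then have "x \<in> extensional I" by (simp add: space_PiM PiE_iff)
      then have "indicator (PiE I B) x = (\<Prod>i\<in>I. indicator (B i) (x i) :: ennreal)"
        using I by (auto simp: indicator_def PiE_iff prod_zero)
      then show "ennreal (\<Prod>i\<in>I. f (x i)) * indicator (PiE I B) x
          = (\<Prod>i\<in>I. ennreal (f (x i)) * indicator (B i) (x i))"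
        using nn I by (simp add: prod.distrib prod_ennreal)
    qed
    also have "\<dots> = (\<Prod>i\<in>I. \<integral>\<^sup>+x. ennreal (f x) * indicator (B i) x \<partial>P)"
      using I by (intro P.product_nn_integral_prod[where f="\<lambda>i x. ennreal (f x) * indicator (B i) x"]) auto
    also have "\<dots> = (\<Prod>i\<in>I. emeasure ?D (B i))"
      by (intro prod.cong) (auto simp: emeasure_density)
    finally show "emeasure ?R (PiE I B) = (\<Prod>i\<in>I. emeasure ?D (B i))" .
  qed
qed

section \<open>Strong data processing when the observations fall at random into the bins\<close>

lemma sum_sqrt_mult_le:
  fixes a b :: "'i \<Rightarrow> real"
  assumes "\<And>i. i \<in> I \<Longrightarrow> 0 \<le> a i" "\<And>i. i \<in> I \<Longrightarrow> 0 \<le> b i"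
  shows "(\<Sum>i\<in>I. sqrt (a i * b i)) \<le> sqrt ((\<Sum>i\<in>I. a i) * (\<Sum>i\<in>I. b i))"
proof (rule real_le_rsqrt)
  have "(\<Sum>i\<in>I. sqrt (a i * b i))\<^sup>2 = (\<Sum>i\<in>I. sqrt (a i) * sqrt (b i))\<^sup>2"
    by (simp add: real_sqrt_mult)
  also have "\<dots> \<le> (\<Sum>i\<in>I. (sqrt (a i))\<^sup>2) * (\<Sum>i\<in>I. (sqrt (b i))\<^sup>2)"
    by (rule Cauchy_Schwarz_ineq_sum)
  also have "\<dots> = (\<Sum>i\<in>I. a i) * (\<Sum>i\<in>I. b i)" using assms by simp
  finally show "(\<Sum>i\<in>I. sqrt (a i * b i))\<^sup>2 \<le> (\<Sum>i\<in>I. a i) * (\<Sum>i\<in>I. b i)" .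
qed

text \<open>One machine draws \<open>n\<close> observations from \<open>P\<close>; the \<open>h\<close>-th alternative changes the law of an observation by
  the density \<open>\<zeta> h\<close>, which acts inside the bin \<open>bin h\<close> only. The likelihood ratios of different alternatives
  are not independent, because the numbers of observations in the bins are dependent; they
  become independent after conditioning on the assignment of the observations to the bins.\<close>

locale binned_alternatives = P: prob_space P for P :: "'x measure" +
  fixes d n :: nat and bin :: "nat \<Rightarrow> 'x set" and \<zeta> :: "nat \<Rightarrow> 'x \<Rightarrow> real"
  assumes d_pos: "0 < d" and n_pos: "0 < n"
    and bin_sets[measurable]: "h < d \<Longrightarrow> bin h \<in> sets P"
    and bins_disjoint: "disjoint_family_on bin {..<d}"
    and bins_cover: "(\<Union>h<d. bin h) = space P"
    and bin_prob: "h < d \<Longrightarrow> measure P (bin h) = 1 / real d"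
    and ratio_measurable[measurable]: "h < d \<Longrightarrow> \<zeta> h \<in> borel_measurable P"
    and ratio_nonneg: "h < d \<Longrightarrow> 0 \<le> \<zeta> h x"
    and ratio_off_bin: "h < d \<Longrightarrow> x \<notin> bin h \<Longrightarrow> \<zeta> h x = 1"
    and ratio_nn_integral: "h < d \<Longrightarrow> (\<integral>\<^sup>+x. ennreal (\<zeta> h x) \<partial>P) = 1"
begin

definition Pn :: "(nat \<Rightarrow> 'x) measure" where
  "Pn = PiM {..<n} (\<lambda>_. P)"

definition LR :: "nat \<Rightarrow> (nat \<Rightarrow> 'x) \<Rightarrow> real" where
  "LR h x = (\<Prod>i<n. \<zeta> h (x i))"

definition cell :: "(nat \<Rightarrow> nat) \<Rightarrow> (nat \<Rightarrow> 'x) set" where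
  "cell A = PiE {..<n} (\<lambda>i. bin (A i))"

definition assignments :: "(nat \<Rightarrow> nat) set" where
  "assignments = {..<n} \<rightarrow>\<^sub>E {..<d}"

sublocale PP: product_prob_space "\<lambda>_::nat. P" "{..<n}"
  by (rule product_prob_spaceI) (rule P.prob_space_axioms)

sublocale Pn: prob_space Pn
  unfolding Pn_def by (intro prob_space_PiM P.prob_space_axioms)

lemma finite_assignments: "finite assignments"
  unfolding assignments_def by (intro finite_PiE) auto

lemma cell_sets[measurable]: "A \<in> assignments \<Longrightarrow> cell A \<in> sets Pn"
  unfolding cell_def Pn_def assignments_def
  by (intro sets_PiM_I_finite bin_sets finite_lessThan) (drule (1) PiE_mem, simp only: lessThan_iff)

lemma LR_measurable[measurable]: "h < d \<Longrightarrow> LR h \<in> borel_measurable Pn"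
  unfolding LR_def Pn_def by measurable

lemma LR_nonneg: "h < d \<Longrightarrow> 0 \<le> LR h x"
  unfolding LR_def by (intro prod_nonneg) (auto simp: ratio_nonneg)

lemma LR_nn_integral:
  assumes "h < d" shows "(\<integral>\<^sup>+x. ennreal (LR h x) \<partial>Pn) = 1"
proof -
  have "(\<integral>\<^sup>+x. ennreal (LR h x) \<partial>Pn) = (\<integral>\<^sup>+x. (\<Prod>i<n. ennreal (\<zeta> h (x i))) \<partial>PiM {..<n} (\<lambda>_. P))"
    unfolding LR_def Pn_def using assms by (simp add: prod_ennreal ratio_nonneg)
  also have "\<dots> = 1" using assms by (subst PP.product_nn_integral_prod) (auto simp: ratio_nn_integral)
  finally show ?thesis .
qed

lemma LR_integrable: assumes "h < d" shows "integrable Pn (LR h)"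
  using LR_nn_integral[OF assms] LR_nonneg[OF assms] assms by (intro integrableI_nonneg) auto

lemma cell_prob:
  assumes "A \<in> assignments" shows "Pn.prob (cell A) = 1 / real d ^ n"
proof -
  have A: "A i < d" if "i < n" for i using assms that by (auto simp: assignments_def)
  have "emeasure Pn (cell A) = (\<Prod>i<n. emeasure P (bin (A i)))"
    unfolding Pn_def cell_def using A by (intro PP.emeasure_PiM) (auto intro: bin_sets)
  then have "Pn.prob (cell A) = (\<Prod>i<n. P.prob (bin (A i)))"
    by (simp add: Pn.emeasure_eq_measure P.emeasure_eq_measure prod_ennreal prod_nonneg)
  also have "\<dots> = (\<Prod>i<n. 1 / real d)"
    using A by (intro prod.cong bin_prob) auto
  finally show ?thesis by (simp add: power_divide)
qed

lemma sum_indicator_cell: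
  assumes "x \<in> space Pn" shows "(\<Sum>A\<in>assignments. indicator (cell A) x) = (1::real)"
proof -
  have "\<exists>h<d. x i \<in> bin h" if "i < n" for i
    using assms that bins_cover by (auto simp: Pn_def space_PiM PiE_iff)
  then obtain a where a: "\<And>i. i < n \<Longrightarrow> a i < d \<and> x i \<in> bin (a i)" by metis
  define A where "A = restrict a {..<n}"
  have "indicator (cell A') x = (if A' = A then 1 else (0::real))" if A': "A' \<in> assignments" for A'
  proof -
    have "A' = A" if x: "x \<in> cell A'"
    proof
      fix i show "A' i = A i"
      proof (cases "i < n")
        case True
        then have "x i \<in> bin (A' i)" "x i \<in> bin (a i)" "A' i < d" "a i < d"
          using x A' a[OF True] by (auto simp: cell_def assignments_def)
        then have "A' i = a i" using bins_disjoint by (auto simp: disjoint_family_on_def)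
        then show ?thesis using True by (simp add: A_def)
      qed (use A' in \<open>auto simp: A_def assignments_def\<close>)
    qed
    moreover have "x \<in> cell A"
      using assms a by (auto simp: cell_def A_def Pn_def space_PiM PiE_iff)
    ultimately have "x \<in> cell A' \<longleftrightarrow> A' = A" by metis
    then show ?thesis by (simp add: indicator_def)
  qed
  moreover have "A \<in> assignments" unfolding A_def assignments_def restrict_PiE_iff using a by blast
  ultimately show ?thesis using finite_assignments by (simp cong: sum.cong)
qed

lemma expectation_split_cells:
  assumes f: "integrable Pn f"
  shows "(\<Sum>A\<in>assignments. Pn.expectation (\<lambda>x. f x * indicator (cell A) x)) = (Pn.expectation f :: real)"
proof -
  have i: "integrable Pn (\<lambda>x. f x * indicator (cell A) x)" if "A \<in> assignments" for A
    using integrable_real_mult_indicator[OF cell_sets[OF that] f] by (simp add: mult.commute)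
  have "(\<Sum>A\<in>assignments. Pn.expectation (\<lambda>x. f x * indicator (cell A) x))
      = Pn.expectation (\<lambda>x. \<Sum>A\<in>assignments. f x * indicator (cell A) x)"
    using i by (simp add: Bochner_Integration.integral_sum)
  also have "\<dots> = Pn.expectation f"
    by (intro Bochner_Integration.integral_cong)
      (auto simp: sum_indicator_cell simp flip: sum_distrib_left)
  finally show ?thesis .
qed

text \<open>Outside its bin the ratio is one, so the mass that the alternative gives to the bin is that of \<open>P\<close>:
  knowing the bin of an observation tells nothing about the alternative.\<close>

lemma ratio_nn_integral_bin:
  assumes h: "h < d" shows "(\<integral>\<^sup>+x. ennreal (\<zeta> h x) \<partial>uniform_measure P (bin h)) = 1"
proof -
  note [measurable] = bin_sets[OF h] ratio_measurable[OF h]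
  have int: "integrable P (\<zeta> h)"
    using ratio_nn_integral[OF h] ratio_nonneg[OF h] by (intro integrableI_nonneg) auto
  have E: "P.expectation (\<zeta> h) = 1"
    using ratio_nn_integral[OF h] ratio_nonneg[OF h] nn_integral_eq_integral[OF int]
    by (simp add: ennreal_eq_1)
  have ind: "integrable P (indicator (space P - bin h) :: 'x \<Rightarrow> real)"
    by (intro integrable_real_indicator) (auto simp: less_top[symmetric])
  have "P.expectation (\<lambda>x. \<zeta> h x * indicator (bin h) x)
      = P.expectation (\<lambda>x. \<zeta> h x - indicator (space P - bin h) x)"
    by (intro Bochner_Integration.integral_cong) (auto simp: indicator_def ratio_off_bin[OF h])
  also have "\<dots> = 1 - P.prob (space P - bin h)"
    using int ind E by simp
  also have "\<dots> = P.prob (bin h)" by (simp add: P.prob_compl)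
  finally have eq: "P.expectation (\<lambda>x. \<zeta> h x * indicator (bin h) x) = P.prob (bin h)" .
  have pos: "0 < P.prob (bin h)" using bin_prob[OF h] d_pos by simp
  have "integral\<^sup>L (uniform_measure P (bin h)) (\<zeta> h) = 1"
    using P.integral_uniform_measure[OF _ _ pos] eq pos by simp
  moreover have "integrable (uniform_measure P (bin h)) (\<zeta> h)"
    using int pos by (intro P.integrable_uniform_measure) auto
  ultimately show ?thesis using ratio_nonneg[OF h] by (subst nn_integral_eq_integral) auto
qed

text \<open>The affinity of the message laws is at least the affinity of the joint laws of message and bin assignment:
  this is the Cauchy-Schwarz inequality over the cells. On each cell the product structure makes the
  likelihood ratios independent with mean one, and the strong data processing inequality applies.
  The probabilities are kept unnormalised, as integrals over the cell, so that summing over cells restores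
  integrals under \<open>Pn\<close>.\<close>

lemma bounded_budget_affinity:
  fixes Y :: "(nat \<Rightarrow> 'x) \<Rightarrow> 'y"
  assumes Y[measurable]: "Y \<in> measurable Pn (count_space UNIV)"
    and R: "finite R" "AE x in Pn. Y x \<in> R" and b: "0 < b"
  shows "(\<Sum>h<d. 1 - (\<Sum>y\<in>R. sqrt (Pn.prob (Y -` {y} \<inter> space Pn) *
            Pn.expectation (\<lambda>x. LR h x * indicator (Y -` {y} \<inter> space Pn) x))))
     \<le> 4 * b\<^sup>2 * ln (real (card R)) +
        2 * (\<Sum>h<d. Pn.expectation (\<lambda>x. (LR h x + 1) * indicator {x\<in>space Pn. b < \<bar>LR h x - 1\<bar>} x))"
proof -
  define G where "G y = Y -` {y} \<inter> space Pn" for y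
  define bad where "bad h = {x\<in>space Pn. b < \<bar>LR h x - 1\<bar>}" for h
  define \<kappa> where "\<kappa> = 1 / real d ^ n"
  define \<alpha> :: "(nat \<Rightarrow> nat) \<Rightarrow> 'y \<Rightarrow> real"
    where "\<alpha> A y = Pn.expectation (\<lambda>x. indicator (G y) x * indicator (cell A) x)" for A y
  define \<beta> where "\<beta> h A y = Pn.expectation (\<lambda>x. LR h x * indicator (G y) x * indicator (cell A) x)" for h A y
  define \<tau> where "\<tau> h A = Pn.expectation (\<lambda>x. (LR h x + 1) * indicator (bad h) x * indicator (cell A) x)" for h A
  have \<kappa>: "0 < \<kappa>" using d_pos by (simp add: \<kappa>_def)
  have G[measurable]: "G y \<in> sets Pn" for y unfolding G_def by measurable
  have bad[measurable]: "bad h \<in> sets Pn" if "h < d" for h unfolding bad_def using that by measurable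
  have int_ind: "integrable Pn (\<lambda>x. f x * indicator S x)" if "integrable Pn f" "S \<in> sets Pn"
    for f :: "(nat \<Rightarrow> 'x) \<Rightarrow> real" and S
    using integrable_real_mult_indicator[OF that(2,1)] by (simp add: mult.commute)
  have iG: "integrable Pn (indicator S :: _ \<Rightarrow> real)" if "S \<in> sets Pn" for S
    using that by (intro integrable_real_indicator) (auto simp: less_top[symmetric])
  have iLR: "integrable Pn (\<lambda>x. LR h x + 1)" if "h < d" for h using LR_integrable[OF that] by simp
  have one_cell: "(\<Sum>h<d. \<kappa> - (\<Sum>y\<in>R. sqrt (\<alpha> A y * \<beta> h A y)))
      \<le> \<kappa> * (4 * b\<^sup>2 * ln (real (card R))) + 2 * (\<Sum>h<d. \<tau> h A)" if A: "A \<in> assignments" for A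
  proof -
    define MA where "MA = uniform_measure Pn (cell A)"
    define M where "M i = (if i \<in> {..<n} then uniform_measure P (bin (A i)) else P)" for i
    define Z where "Z h x = (\<Prod>i\<in>{i. i < n \<and> A i = h}. \<zeta> h (x i))" for h and x :: "nat \<Rightarrow> 'x"
    have Ad: "A i < d" if "i < n" for i using A that by (auto simp: assignments_def)
    have pcell: "Pn.prob (cell A) = \<kappa>" using cell_prob[OF A] by (simp add: \<kappa>_def)
    note [measurable] = cell_sets[OF A]
    have MA_eq: "MA = PiM {..<n} M"
      unfolding MA_def Pn_def cell_def M_def[abs_def]
      by (intro uniform_measure_PiM P.prob_space_axioms)
        (use Ad d_pos in \<open>auto simp: bin_prob\<close>)
    have Mprob: "prob_space (M i)" for i
      unfolding M_def using Ad[of i] d_pos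
      by (auto intro!: prob_space_uniform_measure P.prob_space_axioms simp: P.emeasure_eq_measure bin_prob)
    have setsM: "sets (M i) = sets P" for i by (simp add: M_def)
    interpret MA: prob_space MA unfolding MA_eq by (intro prob_space_PiM Mprob)
    interpret M: product_prob_space M "{..<n}"
      using Mprob by (intro product_prob_spaceI)
    have setsMA: "sets MA = sets Pn" and spaceMA: "space MA = space Pn" by (auto simp: MA_def)
    have \<zeta>M[measurable]: "\<zeta> h \<in> borel_measurable (M i)" if "h < d" for h i
      using ratio_measurable[OF that] by (simp add: measurable_cong_sets[OF setsM refl])
    (* on the cell only the observations assigned to bin h contribute to the likelihood ratio *)
    have Z_eq: "Z h x = LR h x" if "h < d" "x \<in> cell A" for h x
    proof -
      have "\<zeta> h (x i) = 1" if i: "i < n" "A i \<noteq> h" for i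
      proof (rule ratio_off_bin[OF \<open>h < d\<close>])
        have "x i \<in> bin (A i)" using \<open>x \<in> cell A\<close> i by (auto simp: cell_def)
        then show "x i \<notin> bin h" using bins_disjoint Ad[OF i(1)] i(2) \<open>h < d\<close>
          by (auto simp: disjoint_family_on_def)
      qed
      then show ?thesis unfolding Z_def LR_def by (intro prod.mono_neutral_left) auto
    qed
    have Zm[measurable]: "Z h \<in> borel_measurable MA" if "h < d" for h
      unfolding Z_def MA_eq using that by measurable
    have Zm'[measurable]: "Z h \<in> borel_measurable Pn" if "h < d" for h
      using Zm[OF that] by (simp add: measurable_cong_sets[OF setsMA refl])
    have Znn: "0 \<le> Z h x" if "h < d" for h x
      unfolding Z_def using that by (intro prod_nonneg) (auto simp: ratio_nonneg)
    have "(\<integral>\<^sup>+x. ennreal (Z h x) \<partial>MA) = 1" if h: "h < d" for h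
    proof -
      have "(\<integral>\<^sup>+x. ennreal (Z h x) \<partial>MA)
          = (\<integral>\<^sup>+x. (\<Prod>i<n. (if A i = h then ennreal (\<zeta> h (x i)) else 1)) \<partial>PiM {..<n} M)"
        unfolding MA_eq
      proof (intro nn_integral_cong)
        fix x
        have "ennreal (Z h x) = (\<Prod>i\<in>{i. i < n \<and> A i = h}. ennreal (\<zeta> h (x i)))"
          unfolding Z_def using h by (intro prod_ennreal[symmetric]) (auto simp: ratio_nonneg)
        also have "\<dots> = (\<Prod>i<n. (if A i = h then ennreal (\<zeta> h (x i)) else 1))"
          by (intro prod.mono_neutral_cong_left) auto
        finally show "ennreal (Z h x) = \<dots>" .
      qed
      also have "\<dots> = (\<Prod>i<n. \<integral>\<^sup>+x. (if A i = h then ennreal (\<zeta> h x) else 1) \<partial>M i)"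
        using h by (intro M.product_nn_integral_prod[where f="\<lambda>i x. if A i = h then ennreal (\<zeta> h x) else 1"]) auto
      also have "\<dots> = (\<Prod>i<n. 1)"
      proof (intro prod.cong refl)
        fix i assume "i \<in> {..<n}"
        then show "(\<integral>\<^sup>+x. (if A i = h then ennreal (\<zeta> h x) else 1) \<partial>M i) = 1"
          using prob_space.emeasure_space_1[OF Mprob[of i]] ratio_nn_integral_bin[OF h]
          by (cases "A i = h") (auto simp: M_def)
      qed
      finally show ?thesis by simp
    qed
    note Z1 = this
    have Zint: "integrable MA (Z h)" if "h < d" for h
      using Z1[OF that] Znn[OF that] that by (intro integrableI_nonneg) auto
    have EZ: "MA.expectation (Z h) = 1" if "h < d" for h
      using Z1[OF that] Znn[OF that] nn_integral_eq_integral[OF Zint[OF that]]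
      by (simp add: ennreal_eq_1)
    have ind: "MA.indep_vars (\<lambda>_. borel) Z {..<d}"
    proof -
      have "MA.indep_vars (\<lambda>_. borel) (\<lambda>h x. (\<lambda>y. \<Prod>i\<in>{i. i < n \<and> A i = h}. \<zeta> h (y i))
          (restrict x {i. i < n \<and> A i = h})) {..<d}"
        unfolding MA_eq using n_pos
        by (intro indep_vars_PiM_blocks Mprob) (auto simp: disjoint_family_on_def)
      then show ?thesis by (simp add: Z_def[abs_def])
    qed
    have Y': "Y \<in> measurable MA (count_space UNIV)"
      using Y by (simp add: measurable_cong_sets[OF setsMA refl])
    have YR: "AE x in MA. Y x \<in> R"
      unfolding MA_def by (rule AE_uniform_measureI) (use R in auto)
    have transfer: "MA.expectation f = Pn.expectation (\<lambda>x. g x * indicator (cell A) x) / \<kappa>"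
      if "f \<in> borel_measurable Pn" "\<And>x. x \<in> cell A \<Longrightarrow> f x = g x" for f g :: "(nat \<Rightarrow> 'x) \<Rightarrow> real"
    proof -
      have "MA.expectation f = Pn.expectation (\<lambda>x. f x * indicator (cell A) x) / \<kappa>"
        unfolding MA_def using \<kappa> that pcell by (subst Pn.integral_uniform_measure) auto
      also have "(\<lambda>x. f x * indicator (cell A) x) = (\<lambda>x. g x * indicator (cell A) x)"
        using that by (auto simp: indicator_def)
      finally show ?thesis .
    qed
    have a: "MA.prob (G y) = \<alpha> A y / \<kappa>" for y
    proof -
      have "MA.prob (G y) = MA.expectation (indicator (G y))" using G[of y] by (simp add: setsMA)
      then show ?thesis unfolding \<alpha>_def using transfer[of "indicator (G y)" "indicator (G y)"] by simp
    qed
    have b': "MA.expectation (\<lambda>x. Z h x * indicator (G y) x) = \<beta> h A y / \<kappa>" if h: "h < d" for h y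
      unfolding \<beta>_def using h Z_eq[OF h] by (intro transfer) auto
    have t: "MA.expectation (\<lambda>x. (Z h x + 1) * indicator {x\<in>space MA. b < \<bar>Z h x - 1\<bar>} x) = \<tau> h A / \<kappa>"
      if h: "h < d" for h
      unfolding \<tau>_def spaceMA
      by (intro transfer) (use h Z_eq[OF h] in \<open>auto simp: bad_def indicator_def\<close>)
    have "(\<Sum>h<d. 1 - (\<Sum>y\<in>R. sqrt (\<alpha> A y / \<kappa> * (\<beta> h A y / \<kappa>))))
        \<le> 4 * b\<^sup>2 * ln (real (card R)) + 2 * (\<Sum>h<d. \<tau> h A / \<kappa>)"
      using MA.hellinger_strong_data_processing[OF _ ind _ _ _ Y' R(1) YR b] Znn Zint EZ
      by (simp add: spaceMA a b' t[unfolded spaceMA] G_def[symmetric])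
    then have "\<kappa> * (\<Sum>h<d. 1 - (\<Sum>y\<in>R. sqrt (\<alpha> A y / \<kappa> * (\<beta> h A y / \<kappa>))))
        \<le> \<kappa> * (4 * b\<^sup>2 * ln (real (card R)) + 2 * (\<Sum>h<d. \<tau> h A / \<kappa>))"
      using \<kappa> by (intro mult_left_mono) auto
    also have "\<dots> = \<kappa> * (4 * b\<^sup>2 * ln (real (card R))) + 2 * (\<Sum>h<d. \<tau> h A)"
      using \<kappa> by (simp add: distrib_left flip: sum_divide_distrib)
    also have "\<kappa> * (\<Sum>h<d. 1 - (\<Sum>y\<in>R. sqrt (\<alpha> A y / \<kappa> * (\<beta> h A y / \<kappa>))))
        = (\<Sum>h<d. \<kappa> - (\<Sum>y\<in>R. sqrt (\<alpha> A y * \<beta> h A y)))"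
    proof -
      have "sqrt (\<alpha> A y / \<kappa> * (\<beta> h A y / \<kappa>)) = sqrt (\<alpha> A y * \<beta> h A y) / \<kappa>" for h y
        using \<kappa> by (simp add: real_sqrt_divide)
      then show ?thesis using \<kappa> by (simp add: sum_distrib_left right_diff_distrib)
    qed
    finally show ?thesis .
  qed
  have sum\<kappa>: "(\<Sum>A\<in>assignments. \<kappa>) = 1"
  proof -
    have "\<kappa> = Pn.expectation (\<lambda>x. 1 * indicator (cell A) x)" if "A \<in> assignments" for A
      using cell_prob[OF that] cell_sets[OF that] by (simp add: \<kappa>_def)
    then have "(\<Sum>A\<in>assignments. \<kappa>) = (\<Sum>A\<in>assignments. Pn.expectation (\<lambda>x. 1 * indicator (cell A) x))"
      by (intro sum.cong) auto
    also have "\<dots> = 1" by (subst expectation_split_cells) (auto simp: Pn.prob_space)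
    finally show ?thesis .
  qed
  have sum\<alpha>: "(\<Sum>A\<in>assignments. \<alpha> A y) = Pn.prob (G y)" for y
    unfolding \<alpha>_def using iG[OF G] by (subst expectation_split_cells) auto
  have sum\<beta>: "(\<Sum>A\<in>assignments. \<beta> h A y) = Pn.expectation (\<lambda>x. LR h x * indicator (G y) x)"
    if "h < d" for h y
    unfolding \<beta>_def using int_ind[OF LR_integrable[OF that] G] by (subst expectation_split_cells) auto
  have sum\<tau>: "(\<Sum>A\<in>assignments. \<tau> h A) = Pn.expectation (\<lambda>x. (LR h x + 1) * indicator (bad h) x)"
    if "h < d" for h
    unfolding \<tau>_def using int_ind[OF iLR[OF that] bad[OF that]] by (subst expectation_split_cells) auto
  have \<alpha>0: "0 \<le> \<alpha> A y" for A y unfolding \<alpha>_def by (intro integral_nonneg_AE) auto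
  have \<beta>0: "0 \<le> \<beta> h A y" if "h < d" for h A y
    unfolding \<beta>_def using LR_nonneg[OF that] by (intro integral_nonneg_AE) auto
  have "(\<Sum>h<d. 1 - (\<Sum>y\<in>R. sqrt (Pn.prob (G y) * Pn.expectation (\<lambda>x. LR h x * indicator (G y) x))))
      \<le> (\<Sum>h<d. \<Sum>A\<in>assignments. \<kappa> - (\<Sum>y\<in>R. sqrt (\<alpha> A y * \<beta> h A y)))"
  proof (rule sum_mono)
    fix h assume "h \<in> {..<d}"
    then have h: "h < d" by simp
    have "(\<Sum>A\<in>assignments. \<Sum>y\<in>R. sqrt (\<alpha> A y * \<beta> h A y)) = (\<Sum>y\<in>R. \<Sum>A\<in>assignments. sqrt (\<alpha> A y * \<beta> h A y))"
      by (rule sum.swap)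
    also have "\<dots> \<le> (\<Sum>y\<in>R. sqrt ((\<Sum>A\<in>assignments. \<alpha> A y) * (\<Sum>A\<in>assignments. \<beta> h A y)))"
      using \<alpha>0 \<beta>0[OF h] by (intro sum_mono sum_sqrt_mult_le) auto
    finally show "1 - (\<Sum>y\<in>R. sqrt (Pn.prob (G y) * Pn.expectation (\<lambda>x. LR h x * indicator (G y) x)))
        \<le> (\<Sum>A\<in>assignments. \<kappa> - (\<Sum>y\<in>R. sqrt (\<alpha> A y * \<beta> h A y)))"
      using sum\<kappa> by (simp only: sum_subtractf sum\<alpha> sum\<beta>[OF h])
  qed
  also have "\<dots> = (\<Sum>A\<in>assignments. \<Sum>h<d. \<kappa> - (\<Sum>y\<in>R. sqrt (\<alpha> A y * \<beta> h A y)))"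
    by (rule sum.swap)
  also have "\<dots> \<le> (\<Sum>A\<in>assignments. \<kappa> * (4 * b\<^sup>2 * ln (real (card R))) + 2 * (\<Sum>h<d. \<tau> h A))"
    by (intro sum_mono one_cell)
  also have "\<dots> = 4 * b\<^sup>2 * ln (real (card R)) + 2 * (\<Sum>A\<in>assignments. \<Sum>h<d. \<tau> h A)"
    by (simp only: sum.distrib sum\<kappa> mult_1 flip: sum_distrib_right sum_distrib_left)
  also have "(\<Sum>A\<in>assignments. \<Sum>h<d. \<tau> h A) = (\<Sum>h<d. \<Sum>A\<in>assignments. \<tau> h A)" by (rule sum.swap)
  also have "\<dots> = (\<Sum>h<d. Pn.expectation (\<lambda>x. (LR h x + 1) * indicator (bad h) x))"
    by (intro sum.cong sum\<tau>) auto
  finally show ?thesis unfolding G_def bad_def .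
qed

end

section \<open>Messages of a machine under the alternatives\<close>

text \<open>The Cauchy-Schwarz inequality for \<open>sqrt Z\<close> and the indicator of \<open>G\<close>, from the quadratic
  \<open>c \<mapsto> \<integral>\<^sub>G (sqrt Z - c)\<^sup>2\<close>.\<close>

lemma (in prob_space) expectation_sqrt_indicator_le:
  fixes Z :: "'a \<Rightarrow> real"
  assumes Z: "integrable M Z" "\<And>\<omega>. 0 \<le> Z \<omega>" and G[measurable]: "G \<in> events"
  shows "expectation (\<lambda>\<omega>. sqrt (Z \<omega>) * indicator G \<omega>)
       \<le> sqrt (prob G * expectation (\<lambda>\<omega>. Z \<omega> * indicator G \<omega>))"
proof -
  have [measurable]: "random_variable borel Z" using Z by auto
  have int_ind: "integrable M (\<lambda>\<omega>. f \<omega> * indicator G \<omega>)" if "integrable M f" for f :: "'a \<Rightarrow> real"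
    using integrable_real_mult_indicator[OF G that] by (simp add: mult.commute)
  have sZ: "integrable M (\<lambda>\<omega>. sqrt (Z \<omega>))"
  proof (rule Bochner_Integration.integrable_bound)
    show "integrable M (\<lambda>\<omega>. 1 + Z \<omega>)" using Z by simp
    show "AE \<omega> in M. norm (sqrt (Z \<omega>)) \<le> norm (1 + Z \<omega>)"
    proof (rule AE_I2)
      fix \<omega> have "sqrt (Z \<omega>) \<le> 1 + Z \<omega>"
        using Z(2)[of \<omega>] by (intro real_le_lsqrt) (auto simp: power2_eq_square algebra_simps)
      then show "norm (sqrt (Z \<omega>)) \<le> norm (1 + Z \<omega>)" using Z(2)[of \<omega>] by simp
    qed
  qed measurable
  have one: "integrable M (\<lambda>\<omega>. indicator G \<omega> :: real)"
    by (intro integrable_real_indicator) (auto simp: less_top[symmetric])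
  define x where "x = expectation (\<lambda>\<omega>. sqrt (Z \<omega>) * indicator G \<omega>)"
  define q where "q = prob G"
  define Q where "Q = expectation (\<lambda>\<omega>. Z \<omega> * indicator G \<omega>)"
  have quad: "0 \<le> Q - 2 * c * x + c\<^sup>2 * q" for c
  proof -
    have "(sqrt (Z \<omega>) - c)\<^sup>2 * indicator G \<omega>
        = Z \<omega> * indicator G \<omega> - 2 * c * (sqrt (Z \<omega>) * indicator G \<omega>) + c\<^sup>2 * indicator G \<omega>" for \<omega>
      using Z(2)[of \<omega>] by (simp add: power2_diff algebra_simps)
    then have "expectation (\<lambda>\<omega>. (sqrt (Z \<omega>) - c)\<^sup>2 * indicator G \<omega>) = Q - 2 * c * x + c\<^sup>2 * q"
      using int_ind[OF Z(1)] int_ind[OF sZ] one by (simp add: Q_def x_def q_def)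
    moreover have "0 \<le> expectation (\<lambda>\<omega>. (sqrt (Z \<omega>) - c)\<^sup>2 * indicator G \<omega>)"
      by (intro integral_nonneg_AE) auto
    ultimately show ?thesis by simp
  qed
  have "x\<^sup>2 \<le> q * Q"
  proof (cases "q = 0")
    case True
    then have "AE \<omega> in M. \<omega> \<notin> G"
      by (intro AE_not_in) (simp add: q_def emeasure_eq_measure null_sets_def)
    then have "x = expectation (\<lambda>_. 0)" unfolding x_def
      by (intro integral_cong_AE) auto
    then show ?thesis using True by simp
  next
    case False
    then have q: "0 < q" by (simp add: q_def less_le)
    have "0 \<le> q * (Q - 2 * (x / q) * x + (x / q)\<^sup>2 * q)"
      using quad[of "x / q"] q by (intro mult_nonneg_nonneg) auto
    also have "\<dots> = q * Q - x\<^sup>2" using q by (simp add: field_simps power2_eq_square)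
    finally show ?thesis by simp
  qed
  then show ?thesis unfolding x_def q_def Q_def by (rule real_le_rsqrt)
qed

context binned_alternatives
begin

lemma alternative_prob_space: "h < d \<Longrightarrow> prob_space (density P (\<lambda>x. ennreal (\<zeta> h x)))"
  by (intro prob_spaceI) (simp add: emeasure_density ratio_nn_integral cong: nn_integral_cong)

definition Qn :: "nat \<Rightarrow> (nat \<Rightarrow> 'x) measure" where
  "Qn h = PiM {..<n} (\<lambda>_. density P (\<lambda>x. ennreal (\<zeta> h x)))"

lemma measure_Qn:
  assumes h: "h < d" and G[measurable]: "G \<in> sets Pn"
  shows "measure (Qn h) G = Pn.expectation (\<lambda>x. LR h x * indicator G x)"
proof -
  have "Qn h = density Pn (\<lambda>x. ennreal (LR h x))"
    unfolding Qn_def Pn_def LR_def using h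
    by (intro PiM_density P.prob_space_axioms alternative_prob_space) (auto simp: ratio_nonneg)
  then have "emeasure (Qn h) G = (\<integral>\<^sup>+x. ennreal (LR h x * indicator G x) \<partial>Pn)"
    using h by (auto simp: emeasure_density indicator_def intro!: nn_integral_cong)
  also have "\<dots> = ennreal (Pn.expectation (\<lambda>x. LR h x * indicator G x))"
    using integrable_real_mult_indicator[OF G LR_integrable[OF h]] LR_nonneg[OF h]
    by (intro nn_integral_eq_integral) (auto simp: mult.commute)
  finally show ?thesis
    using LR_nonneg[OF h] by (simp add: measure_def integral_nonneg_AE)
qed

lemma affinity_le_of_budget:
  fixes Y :: "(nat \<Rightarrow> 'x) \<Rightarrow> 'y"
  assumes Y: "Y \<in> measurable Pn (count_space UNIV)"
    and R: "finite R" "AE x in Pn. Y x \<in> R" and b: "0 < b"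
  shows "(\<Sum>h<d. 1 - (\<Sum>y\<in>R. sqrt (measure Pn (Y -` {y} \<inter> space Pn) * measure (Qn h) (Y -` {y} \<inter> space Pn))))
     \<le> 4 * b\<^sup>2 * ln (real (card R)) +
        2 * (\<Sum>h<d. measure Pn {x\<in>space Pn. b < \<bar>LR h x - 1\<bar>} + measure (Qn h) {x\<in>space Pn. b < \<bar>LR h x - 1\<bar>})"
proof -
  have G: "Y -` {y} \<inter> space Pn \<in> sets Pn" for y using Y by measurable
  have bad: "Pn.expectation (\<lambda>x. (LR h x + 1) * indicator B x) = measure Pn B + measure (Qn h) B"
    if h: "h < d" and B: "B \<in> sets Pn" for h B
  proof -
    have 1: "integrable Pn (\<lambda>x. LR h x * indicator B x)"
      using integrable_real_mult_indicator[OF B LR_integrable[OF h]] by (simp add: mult.commute)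
    have 2: "integrable Pn (indicator B :: _ \<Rightarrow> real)"
      using B by (intro integrable_real_indicator) (auto simp: less_top[symmetric])
    have "Pn.expectation (\<lambda>x. (LR h x + 1) * indicator B x)
        = Pn.expectation (\<lambda>x. LR h x * indicator B x + indicator B x)"
      by (simp add: distrib_right)
    also have "\<dots> = measure Pn B + measure (Qn h) B"
      using 1 2 B by (simp add: measure_Qn[OF h B])
    finally show ?thesis .
  qed
  have "{x\<in>space Pn. b < \<bar>LR h x - 1\<bar>} \<in> sets Pn" if "h < d" for h
    using LR_measurable[OF that] by measurable
  then show ?thesis
    using bounded_budget_affinity[OF Y R b] G by (simp add: measure_Qn bad)
qed

text \<open>Merging data into messages can only increase the affinity (Cauchy-Schwarz on each fibre), and the
  affinity of the data laws is the mean of \<open>sqrt (LR h)\<close>, which is at least \<open>1 + ln (LR h) / 2\<close>.\<close>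

lemma affinity_le_of_KL:
  fixes Y :: "(nat \<Rightarrow> 'x) \<Rightarrow> 'y"
  assumes Y: "Y \<in> measurable Pn (count_space UNIV)"
    and R: "finite R" "AE x in Pn. Y x \<in> R" and h: "h < d"
    and pos: "AE x in P. 0 < \<zeta> h x" and int: "integrable P (\<lambda>x. ln (\<zeta> h x))"
  shows "1 - (\<Sum>y\<in>R. sqrt (measure Pn (Y -` {y} \<inter> space Pn) * measure (Qn h) (Y -` {y} \<inter> space Pn)))
     \<le> - real n / 2 * P.expectation (\<lambda>x. ln (\<zeta> h x))"
proof -
  note [measurable] = Y LR_measurable[OF h]
  define G where "G y = Y -` {y} \<inter> space Pn" for y
  have G[measurable]: "G y \<in> sets Pn" for y unfolding G_def by measurable
  have comp: "distr Pn P (\<lambda>x. x i) = P" if "i < n" for i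
    unfolding Pn_def using that by (intro distr_PiM_component P.prob_space_axioms) auto
  have meas: "(\<lambda>x. x i) \<in> measurable Pn P" if "i < n" for i
    unfolding Pn_def using that by (intro measurable_component_singleton) auto
  have lnint: "integrable Pn (\<lambda>x. ln (\<zeta> h (x i)))" if "i < n" for i
    using integrable_distr_eq[OF meas[OF that], of "\<lambda>x. ln (\<zeta> h x)"] int comp[OF that] by auto
  have lnE: "Pn.expectation (\<lambda>x. ln (\<zeta> h (x i))) = P.expectation (\<lambda>x. ln (\<zeta> h x))" if "i < n" for i
    using integral_distr[OF meas[OF that], of "\<lambda>x. ln (\<zeta> h x)"] int comp[OF that] by auto
  have allpos: "AE x in Pn. \<forall>i\<in>{..<n}. 0 < \<zeta> h (x i)"
  proof (rule AE_finite_allI)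
    fix i assume "i \<in> {..<n}"
    then show "AE x in Pn. 0 < \<zeta> h (x i)"
      unfolding Pn_def using pos by (intro AE_PiM_component P.prob_space_axioms) auto
  qed simp
  have sZ: "integrable Pn (\<lambda>x. sqrt (LR h x))"
  proof (rule Bochner_Integration.integrable_bound)
    show "integrable Pn (\<lambda>x. 1 + LR h x)" using LR_integrable[OF h] by simp
    show "AE x in Pn. norm (sqrt (LR h x)) \<le> norm (1 + LR h x)"
    proof (rule AE_I2)
      fix x have "sqrt (LR h x) \<le> 1 + LR h x"
        using LR_nonneg[OF h, of x] by (intro real_le_lsqrt) (auto simp: power2_eq_square algebra_simps)
      then show "norm (sqrt (LR h x)) \<le> norm (1 + LR h x)" using LR_nonneg[OF h, of x] by simp
    qed
  qed measurable
  have iln: "integrable Pn (\<lambda>x. \<Sum>i<n. ln (\<zeta> h (x i)))"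
    using lnint by (intro Bochner_Integration.integrable_sum) auto
  have "1 + real n / 2 * P.expectation (\<lambda>x. ln (\<zeta> h x))
      = Pn.expectation (\<lambda>x. 1 + (\<Sum>i<n. ln (\<zeta> h (x i))) / 2)"
    using lnint lnE iln by (simp add: Pn.prob_space Bochner_Integration.integral_sum)
  also have "\<dots> \<le> Pn.expectation (\<lambda>x. sqrt (LR h x))"
  proof (rule integral_mono_AE)
    show "AE x in Pn. 1 + (\<Sum>i<n. ln (\<zeta> h (x i))) / 2 \<le> sqrt (LR h x)"
      using allpos
    proof eventually_elim
      case (elim x)
      have pr: "0 < LR h x" unfolding LR_def using elim by (intro prod_pos) auto
      have "(\<Sum>i<n. ln (\<zeta> h (x i))) = ln (LR h x)"
        unfolding LR_def using elim by (subst ln_prod) (auto simp: less_imp_neq[symmetric])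
      moreover have "1 + ln (LR h x) / 2 \<le> exp (ln (LR h x) / 2)" by (rule exp_ge_add_one_self)
      moreover have "exp (ln (LR h x) / 2) = sqrt (LR h x)"
        using pr by (simp add: powr_half_sqrt[symmetric] powr_def)
      ultimately show ?case by simp
    qed
  qed (use sZ iln in auto)
  also have "\<dots> = (\<Sum>y\<in>R. Pn.expectation (\<lambda>x. sqrt (LR h x) * indicator (G y) x))"
    unfolding G_def by (rule Pn.sum_expectation_fibres[OF Y R sZ, symmetric])
  also have "\<dots> \<le> (\<Sum>y\<in>R. sqrt (measure Pn (G y) * measure (Qn h) (G y)))"
    unfolding measure_Qn[OF h G]
    using LR_integrable[OF h] LR_nonneg[OF h] by (intro sum_mono Pn.expectation_sqrt_indicator_le) auto
  finally show ?thesis by (simp add: G_def)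
qed

end

section \<open>Machines observing a sieve\<close>

definition flip :: "(nat \<Rightarrow> real) \<Rightarrow> nat \<Rightarrow> nat \<Rightarrow> real" where
  "flip \<beta> h = \<beta>(h := - \<beta> h)"

lemma flip_signs: "\<beta> \<in> signs d \<Longrightarrow> h < d \<Longrightarrow> flip \<beta> h \<in> signs d"
  by (auto simp: flip_def signs_def PiE_iff extensional_def)

lemma flip_flip: "flip (flip \<beta> h) h = \<beta>"
  by (simp add: flip_def)

lemma finite_signs: "finite (signs d)"
  unfolding signs_def by (intro finite_PiE) auto

lemma sum_signs_flip:
  assumes "h < d" shows "(\<Sum>\<beta>\<in>signs d. F (flip \<beta> h)) = (\<Sum>\<beta>\<in>signs d. F \<beta>)"
  by (rule sum.reindex_bij_witness[where i="\<lambda>\<beta>. flip \<beta> h" and j="\<lambda>\<beta>. flip \<beta> h"])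
    (use assms in \<open>auto simp: flip_flip flip_signs\<close>)

lemma abs_diff_one_le_of_ln:
  fixes z a :: real
  assumes "0 < z" "ln z \<le> a" "- ln z \<le> a" "0 \<le> a" "a \<le> 1"
  shows "\<bar>z - 1\<bar> \<le> 2 * a"
proof -
  have "z \<le> exp a" using assms by (metis exp_le_cancel_iff exp_ln)
  also have "\<dots> \<le> 1 + a + a\<^sup>2" using assms by (intro exp_bound) auto
  also have "\<dots> \<le> 1 + 2 * a" using assms by (simp add: power2_eq_square mult_left_le)
  finally have up: "z \<le> 1 + 2 * a" .
  have "1 + ln z \<le> exp (ln z)" by (rule exp_ge_add_one_self)
  then have "1 - a \<le> z" using assms by simp
  then show ?thesis using up assms by simp
qed

text \<open>The three assumptions at a fixed sample size, for an abstract family \<open>g\<close> indexed by sign vectors: \<open>b\<close>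
  bounds the mean log-likelihood ratios, \<open>a\<close> the tail events and \<open>\<eta>\<close> the probability of leaving them.\<close>

locale sieve_experiment =
  fixes \<mu> :: "'x measure" and p :: "(real \<Rightarrow> real) \<Rightarrow> 'x \<Rightarrow> real" and \<Theta> :: "(real \<Rightarrow> real) set"
    and n m d :: nat and g :: "(nat \<Rightarrow> real) \<Rightarrow> real \<Rightarrow> real" and \<Xi> :: "nat \<Rightarrow> 'x set" and b a \<eta> :: real
  assumes model: "stat_model \<Theta> \<mu> p" and in_model: "g ` signs d \<subseteq> \<Theta>"
    and n: "0 < n" and m: "0 < m" and d: "0 < d"
    and ec: "expectation_control \<mu> p n m d g b"
    and ds: "decomposable_structure \<mu> p n m d g \<Xi>"
    and tc: "tail_control \<mu> p n m d g \<Xi> a \<eta>"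
    and a: "0 < a" "a \<le> 1"
begin

definition obs :: "(nat \<Rightarrow> real) \<Rightarrow> 'x measure" where "obs \<beta> = obs_law \<mu> p (g \<beta>)"

definition local_obs :: "(nat \<Rightarrow> real) \<Rightarrow> (nat \<Rightarrow> 'x) measure" where
  "local_obs \<beta> = local_law \<mu> p n (g \<beta>)"

definition data :: "(nat \<Rightarrow> real) \<Rightarrow> (nat \<Rightarrow> nat \<Rightarrow> 'x) measure" where
  "data \<beta> = data_law \<mu> p n m (g \<beta>)"

lemma dens_measurable: "\<beta> \<in> signs d \<Longrightarrow> p (g \<beta>) \<in> borel_measurable \<mu>"
  and dens_nonneg: "\<beta> \<in> signs d \<Longrightarrow> x \<in> space \<mu> \<Longrightarrow> 0 \<le> p (g \<beta>) x"
  and dens_int: "\<beta> \<in> signs d \<Longrightarrow> (\<integral>\<^sup>+x. ennreal (p (g \<beta>) x) \<partial>\<mu>) = 1"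
  using model in_model by (auto simp: stat_model_def image_subset_iff)

lemma sets_obs[measurable_cong]: "sets (obs \<beta>) = sets \<mu>" and space_obs: "space (obs \<beta>) = space \<mu>"
  by (auto simp: obs_def obs_law_def)

lemma prob_obs: "\<beta> \<in> signs d \<Longrightarrow> prob_space (obs \<beta>)"
  using dens_measurable[of \<beta>] dens_int[of \<beta>]
  by (intro prob_spaceI) (simp add: obs_def obs_law_def emeasure_density cong: nn_integral_cong)

lemma local_obs_eq: "local_obs \<beta> = PiM {..<n} (\<lambda>_. obs \<beta>)"
  by (simp add: local_obs_def local_law_def obs_def)

lemma data_eq: "data \<beta> = PiM {..<m} (\<lambda>_. local_obs \<beta>)"
  by (simp add: data_def data_law_def local_obs_def)

lemma sets_local: "sets (local_obs \<beta>) = sets (PiM {..<n} (\<lambda>_. \<mu>))"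
  unfolding local_obs_eq by (intro sets_PiM_cong refl) (simp add: sets_obs)

lemma space_local: "space (local_obs \<beta>) = space (PiM {..<n} (\<lambda>_. \<mu>))"
  by (rule sets_eq_imp_space_eq) (rule sets_local)

lemma prob_local: "\<beta> \<in> signs d \<Longrightarrow> prob_space (local_obs \<beta>)"
  unfolding local_obs_eq by (intro prob_space_PiM prob_obs)

lemma prob_data: "\<beta> \<in> signs d \<Longrightarrow> prob_space (data \<beta>)"
  unfolding data_eq by (intro prob_space_PiM prob_local)

lemma distr_local: "\<beta> \<in> signs d \<Longrightarrow> k < m \<Longrightarrow> distr (data \<beta>) (local_obs \<beta>) (\<lambda>X. X k) = local_obs \<beta>"
  unfolding data_eq by (intro distr_PiM_component prob_local) auto

lemma measurable_local: "k < m \<Longrightarrow> (\<lambda>X. X k) \<in> measurable (data \<beta>) (local_obs \<beta>)"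
  unfolding data_eq by (intro measurable_component_singleton) auto

lemma measurable_obs: "i < n \<Longrightarrow> (\<lambda>x. x i) \<in> measurable (local_obs \<beta>) (obs \<beta>)"
  unfolding local_obs_eq by (intro measurable_component_singleton) auto

lemma measurable_data_obs:
  assumes "k < m" "i < n" shows "(\<lambda>X. X k i) \<in> measurable (data \<beta>) (obs \<beta>)"
  using measurable_comp[OF measurable_local[OF assms(1)] measurable_obs[OF assms(2)]] by (simp add: comp_def)

lemma distr_obs:
  assumes \<beta>: "\<beta> \<in> signs d" and "k < m" "i < n"
  shows "distr (data \<beta>) (obs \<beta>) (\<lambda>X. X k i) = obs \<beta>"
proof -
  have "distr (data \<beta>) (obs \<beta>) (\<lambda>X. X k i)
      = distr (distr (data \<beta>) (local_obs \<beta>) (\<lambda>X. X k)) (obs \<beta>) (\<lambda>x. x i)"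
    using assms by (subst distr_distr) (auto simp: comp_def intro: measurable_local measurable_obs)
  also have "\<dots> = distr (local_obs \<beta>) (obs \<beta>) (\<lambda>x. x i)" using assms by (simp add: distr_local)
  also have "\<dots> = obs \<beta>"
    unfolding local_obs_eq using assms by (intro distr_PiM_component prob_obs) auto
  finally show ?thesis .
qed

lemma AE_data_obs:
  assumes \<beta>: "\<beta> \<in> signs d" and P: "{x \<in> space \<mu>. P x} \<in> sets \<mu>"
    and "AE X in data \<beta>. P (X 0 0)"
  shows "AE x in obs \<beta>. P x"
proof -
  have "AE x in distr (data \<beta>) (obs \<beta>) (\<lambda>X. X 0 0). P x"
    using assms m n by (subst AE_distr_iff) (auto simp: sets_obs space_obs intro: measurable_data_obs)
  then show ?thesis unfolding distr_obs[OF \<beta> m n] .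
qed

lemma dens_pos:
  assumes "\<beta> \<in> signs d" "\<beta>' \<in> signs d" shows "AE x in obs \<beta>. 0 < p (g \<beta>') x"
proof (rule AE_data_obs)
  show "AE X in data \<beta>. 0 < p (g \<beta>') (X 0 0)"
    unfolding data_def using ec assms n m by (auto simp: expectation_control_def)
qed (use assms dens_measurable in auto)

lemma llr_measurable: "\<beta> \<in> signs d \<Longrightarrow> \<beta>' \<in> signs d \<Longrightarrow> llr p (g \<beta>) (g \<beta>') \<in> borel_measurable \<mu>"
  unfolding llr_def using dens_measurable by measurable

lemma llr_int:
  assumes "\<beta> \<in> signs d" "\<beta>' \<in> signs d"
  shows "integrable (obs \<beta>) (llr p (g \<beta>) (g \<beta>'))" "integral\<^sup>L (obs \<beta>) (llr p (g \<beta>) (g \<beta>')) \<le> b"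
proof -
  have M: "llr p (g \<beta>) (g \<beta>') \<in> borel_measurable (obs \<beta>)"
    using llr_measurable[OF assms] by (simp add: measurable_cong_sets[OF sets_obs refl])
  have *: "integrable (data \<beta>) (\<lambda>X. llr p (g \<beta>) (g \<beta>') (X 0 0))"
    "integral\<^sup>L (data \<beta>) (\<lambda>X. llr p (g \<beta>) (g \<beta>') (X 0 0)) \<le> b"
    unfolding data_def using ec assms n m by (auto simp: expectation_control_def)
  show "integrable (obs \<beta>) (llr p (g \<beta>) (g \<beta>'))"
    using integrable_distr_eq[OF measurable_data_obs[OF m n] M] *(1) distr_obs[OF assms(1) m n] by simp
  show "integral\<^sup>L (obs \<beta>) (llr p (g \<beta>) (g \<beta>')) \<le> b"
    using integral_distr[OF measurable_data_obs[OF m n] M] *(2) distr_obs[OF assms(1) m n] by simp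
qed

lemma bins:
  shows bin_sets: "h < d \<Longrightarrow> \<Xi> h \<in> sets \<mu>" and bin_disj: "disjoint_family_on \<Xi> {..<d}"
    and bin_cover: "(\<Union>h<d. \<Xi> h) = space \<mu>"
    and bin_prob: "\<beta> \<in> signs d \<Longrightarrow> h < d \<Longrightarrow> measure (obs \<beta>) (\<Xi> h) = 1 / real d"
  using ds by (auto simp: decomposable_structure_def obs_def)

text \<open>The equality of the conditional laws on a bin, together with the equal probabilities of the bin, makes the
  restrictions of the two laws to the bin equal, and densities of finite measures are unique.\<close>

lemma dens_eq_on_bin:
  assumes \<beta>: "\<beta> \<in> signs d" "\<beta>' \<in> signs d" and h: "h < d" "\<beta> h = \<beta>' h"
  shows "AE x in \<mu>. x \<in> \<Xi> h \<longrightarrow> p (g \<beta>) x = p (g \<beta>') x"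
proof -
  note [measurable] = dens_measurable[OF \<beta>(1)] dens_measurable[OF \<beta>(2)] bin_sets[OF h(1)]
  have cd: "emeasure (cond_distr (data \<gamma>) \<mu> (\<lambda>X. X 0 0) (\<Xi> h)) F * ennreal (1 / d) = emeasure (obs \<gamma>) (\<Xi> h \<inter> F)"
    if \<gamma>: "\<gamma> \<in> signs d" and F: "F \<in> sets \<mu>" for \<gamma> F
  proof -
    interpret D: prob_space "data \<gamma>" by (rule prob_data[OF \<gamma>])
    interpret O: prob_space "obs \<gamma>" by (rule prob_obs[OF \<gamma>])
    have M: "(\<lambda>X. X 0 0) \<in> measurable (data \<gamma>) \<mu>"
      using measurable_data_obs[OF m n] by (simp add: measurable_cong_sets[OF refl sets_obs])
    have pre: "emeasure (data \<gamma>) {X \<in> space (data \<gamma>). X 0 0 \<in> S} = emeasure (obs \<gamma>) S"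
      if S: "S \<in> sets \<mu>" for S
    proof -
      have "emeasure (obs \<gamma>) S = emeasure (distr (data \<gamma>) (obs \<gamma>) (\<lambda>X. X 0 0)) S"
        by (simp add: distr_obs[OF \<gamma> m n])
      also have "\<dots> = emeasure (data \<gamma>) ((\<lambda>X. X 0 0) -` S \<inter> space (data \<gamma>))"
        using S by (intro emeasure_distr measurable_data_obs m n) (simp add: sets_obs)
      also have "(\<lambda>X. X 0 0) -` S \<inter> space (data \<gamma>) = {X \<in> space (data \<gamma>). X 0 0 \<in> S}" by auto
      finally show ?thesis by simp
    qed
    define A where "A = {X \<in> space (data \<gamma>). X 0 0 \<in> \<Xi> h}"
    have Am: "{X \<in> space (data \<gamma>). X 0 0 \<in> S} \<in> sets (data \<gamma>)" if "S \<in> sets \<mu>" for S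
      using measurable_sets[OF M that] by (simp add: vimage_def Int_def conj_commute)
    have "emeasure (cond_distr (data \<gamma>) \<mu> (\<lambda>X. X 0 0) (\<Xi> h)) F
        = emeasure (uniform_measure (data \<gamma>) A) {X \<in> space (data \<gamma>). X 0 0 \<in> F}"
      unfolding cond_distr_def A_def using M F
      by (subst emeasure_distr) (auto simp: vimage_def Int_def conj_commute)
    also have "\<dots> = emeasure (data \<gamma>) (A \<inter> {X \<in> space (data \<gamma>). X 0 0 \<in> F}) / emeasure (data \<gamma>) A"
      using Am[OF bin_sets[OF h(1)]] Am[OF F] by (simp add: A_def)
    also have "A \<inter> {X \<in> space (data \<gamma>). X 0 0 \<in> F} = {X \<in> space (data \<gamma>). X 0 0 \<in> \<Xi> h \<inter> F}"
      by (auto simp: A_def)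
    also have "emeasure (data \<gamma>) \<dots> / emeasure (data \<gamma>) A = emeasure (obs \<gamma>) (\<Xi> h \<inter> F) / emeasure (obs \<gamma>) (\<Xi> h)"
      using pre[of "\<Xi> h \<inter> F"] pre[of "\<Xi> h"] F bin_sets[OF h(1)] by (simp add: A_def)
    also have "emeasure (obs \<gamma>) (\<Xi> h) = ennreal (1 / d)"
      using bin_prob[OF \<gamma> h(1)] by (simp add: O.emeasure_eq_measure)
    finally show ?thesis using d by (simp add: ennreal_divide_times ennreal_mult_divide_eq)
  qed
  have eq: "emeasure (obs \<beta>) (\<Xi> h \<inter> F) = emeasure (obs \<beta>') (\<Xi> h \<inter> F)" if F: "F \<in> sets \<mu>" for F
  proof -
    have "cond_distr (data \<beta>) \<mu> (\<lambda>X. X 0 0) (\<Xi> h) = cond_distr (data \<beta>') \<mu> (\<lambda>X. X 0 0) (\<Xi> h)"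
      using ds \<beta> h n m unfolding decomposable_structure_def data_def by blast
    then show ?thesis using cd[OF \<beta>(1) F] cd[OF \<beta>(2) F] by simp
  qed
  have "density \<mu> (\<lambda>x. ennreal (p (g \<beta>) x) * indicator (\<Xi> h) x)
      = density \<mu> (\<lambda>x. ennreal (p (g \<beta>') x) * indicator (\<Xi> h) x)"
  proof (rule measure_eqI)
    fix F assume "F \<in> sets (density \<mu> (\<lambda>x. ennreal (p (g \<beta>) x) * indicator (\<Xi> h) x))"
    then have F[measurable]: "F \<in> sets \<mu>" by simp
    have "emeasure (density \<mu> (\<lambda>x. ennreal (p (g \<gamma>) x) * indicator (\<Xi> h) x)) F = emeasure (obs \<gamma>) (\<Xi> h \<inter> F)"
      if [measurable]: "p (g \<gamma>) \<in> borel_measurable \<mu>" for \<gamma>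
      by (simp add: obs_def obs_law_def emeasure_density indicator_inter_arith mult.assoc)
    then show "emeasure (density \<mu> (\<lambda>x. ennreal (p (g \<beta>) x) * indicator (\<Xi> h) x)) F
        = emeasure (density \<mu> (\<lambda>x. ennreal (p (g \<beta>') x) * indicator (\<Xi> h) x)) F"
      using eq[OF F] by simp
  qed simp
  moreover have "(\<integral>\<^sup>+x. ennreal (p (g \<beta>) x) * indicator (\<Xi> h) x \<partial>\<mu>) \<noteq> \<infinity>"
  proof -
    have "(\<integral>\<^sup>+x. ennreal (p (g \<beta>) x) * indicator (\<Xi> h) x \<partial>\<mu>) \<le> (\<integral>\<^sup>+x. ennreal (p (g \<beta>) x) \<partial>\<mu>)"
      by (intro nn_integral_mono) (auto simp: indicator_def)
    then show ?thesis using dens_int[OF \<beta>(1)] by (auto simp: top_unique)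
  qed
  ultimately have "AE x in \<mu>. ennreal (p (g \<beta>) x) * indicator (\<Xi> h) x = ennreal (p (g \<beta>') x) * indicator (\<Xi> h) x"
    by (subst (asm) finite_density_unique) auto
  then show ?thesis using AE_space
    by eventually_elim (use dens_nonneg \<beta> in \<open>auto simp: indicator_def split: if_splits\<close>)
qed

text \<open>The likelihood ratio of one observation for the flip of the sign \<open>h\<close>. It is set to one outside the bin, where
  it equals one almost surely, so that no exceptional sets have to be carried along.\<close>

definition ratio :: "(nat \<Rightarrow> real) \<Rightarrow> nat \<Rightarrow> 'x \<Rightarrow> real" where
  "ratio \<beta> h x = (if x \<in> \<Xi> h then p (g (flip \<beta> h)) x / p (g \<beta>) x else 1)"

lemma ratio_measurable: "\<beta> \<in> signs d \<Longrightarrow> h < d \<Longrightarrow> ratio \<beta> h \<in> borel_measurable \<mu>"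
  unfolding ratio_def using dens_measurable[of \<beta>] dens_measurable[OF flip_signs, of \<beta> h] bin_sets[of h]
  by measurable

lemma ratio_nonneg:
  assumes "\<beta> \<in> signs d" "h < d" shows "0 \<le> ratio \<beta> h x"
proof (cases "x \<in> \<Xi> h")
  case True
  then have "x \<in> space \<mu>" using sets.sets_into_space[OF bin_sets[OF assms(2)]] by auto
  then show ?thesis using assms dens_nonneg flip_signs by (auto simp: ratio_def)
qed (simp add: ratio_def)

lemma dens_zero:
  assumes "\<beta> \<in> signs d" "\<beta>' \<in> signs d"
  shows "AE x in \<mu>. p (g \<beta>) x = 0 \<longrightarrow> p (g \<beta>') x = 0"
proof -
  have "AE x in \<mu>. 0 < ennreal (p (g \<beta>') x) \<longrightarrow> 0 < p (g \<beta>) x"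
    using dens_pos[OF assms(2,1)] dens_measurable[OF assms(2)]
    unfolding obs_def obs_law_def by (subst (asm) AE_density) auto
  then show ?thesis using AE_space
    by eventually_elim (use dens_nonneg[OF assms(2)] in \<open>force simp: less_le\<close>)
qed

text \<open>Off the bin \<open>h\<close> the two densities agree, and inside it the densities of the sieve have the same zeros.\<close>

lemma density_ratio:
  assumes \<beta>: "\<beta> \<in> signs d" and h: "h < d"
  shows "density (obs \<beta>) (\<lambda>x. ennreal (ratio \<beta> h x)) = obs (flip \<beta> h)"
proof -
  note fl = flip_signs[OF \<beta> h]
  have other: "AE x in \<mu>. \<forall>h'\<in>{..<d}. h' \<noteq> h \<longrightarrow> x \<in> \<Xi> h' \<longrightarrow> p (g (flip \<beta> h)) x = p (g \<beta>) x"
  proof (rule AE_finite_allI)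
    fix h' assume "h' \<in> {..<d}"
    then show "AE x in \<mu>. h' \<noteq> h \<longrightarrow> x \<in> \<Xi> h' \<longrightarrow> p (g (flip \<beta> h)) x = p (g \<beta>) x"
      using dens_eq_on_bin[OF fl \<beta>, of h'] by (cases "h' = h") (auto simp: flip_def)
  qed simp
  have "AE x in \<mu>. ennreal (p (g \<beta>) x) * ennreal (ratio \<beta> h x) = ennreal (p (g (flip \<beta> h)) x)"
    using other dens_zero[OF \<beta> fl] AE_space
  proof eventually_elim
    case (elim x)
    then obtain h' where h': "h' < d" "x \<in> \<Xi> h'" using bin_cover by auto
    have nn: "0 \<le> p (g \<beta>) x" "0 \<le> p (g (flip \<beta> h)) x" using elim dens_nonneg \<beta> fl by auto
    show ?case
    proof (cases "x \<in> \<Xi> h")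
      case True
      then show ?thesis using nn elim by (cases "p (g \<beta>) x = 0") (auto simp: ratio_def simp flip: ennreal_mult)
    next
      case False
      then have "h' \<noteq> h" using h' by auto
      then show ?thesis using elim h' False by (auto simp: ratio_def)
    qed
  qed
  then show ?thesis
    unfolding obs_def obs_law_def using dens_measurable[OF \<beta>] ratio_measurable[OF \<beta> h] dens_measurable[OF fl]
    by (subst density_density_eq) (auto intro!: density_cong)
qed

lemma binned_alternatives:
  assumes \<beta>: "\<beta> \<in> signs d"
  shows "binned_alternatives (obs \<beta>) d n \<Xi> (ratio \<beta>)"
proof (intro binned_alternatives.intro binned_alternatives_axioms.intro prob_obs[OF \<beta>] d n bin_disj)
  fix h assume h: "h < d"
  show "\<Xi> h \<in> sets (obs \<beta>)" using bin_sets[OF h] by (simp add: sets_obs)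
  show "measure (obs \<beta>) (\<Xi> h) = 1 / real d" by (rule bin_prob[OF \<beta> h])
  show "ratio \<beta> h \<in> borel_measurable (obs \<beta>)"
    using ratio_measurable[OF \<beta> h] by (simp add: measurable_cong_sets[OF sets_obs refl])
  then have "(\<integral>\<^sup>+x. ennreal (ratio \<beta> h x) \<partial>obs \<beta>) = emeasure (density (obs \<beta>) (\<lambda>x. ennreal (ratio \<beta> h x))) (space (obs \<beta>))"
    by (simp add: emeasure_density cong: nn_integral_cong)
  also have "\<dots> = 1"
    using prob_space.emeasure_space_1[OF prob_obs[OF flip_signs[OF \<beta> h]]]
    by (simp add: density_ratio[OF \<beta> h] space_obs)
  finally show "(\<integral>\<^sup>+x. ennreal (ratio \<beta> h x) \<partial>obs \<beta>) = 1" .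
  fix x show "0 \<le> ratio \<beta> h x" by (rule ratio_nonneg[OF \<beta> h])
  assume "x \<notin> \<Xi> h" then show "ratio \<beta> h x = 1" by (simp add: ratio_def)
qed (simp add: bin_cover space_obs)

lemma ratio_pos:
  assumes \<beta>: "\<beta> \<in> signs d" and h: "h < d" shows "AE x in obs \<beta>. 0 < ratio \<beta> h x"
  using dens_pos[OF \<beta> \<beta>] dens_pos[OF \<beta> flip_signs[OF \<beta> h]]
  by eventually_elim (auto simp: ratio_def)

lemma AE_obs_of_AE: "\<beta> \<in> signs d \<Longrightarrow> AE x in \<mu>. P x \<Longrightarrow> AE x in obs \<beta>. P x"
  unfolding obs_def obs_law_def using dens_measurable[of \<beta>]
  by (subst AE_density) auto

text \<open>Let \<open>\<gamma>\<close> be the vector with all signs flipped. On the bin \<open>h\<close> the laws of \<open>\<gamma>\<close> and of the flip of the single sign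
  \<open>h\<close> agree, so the divergences of the single flips are the contributions of the bins to the one divergence
  between \<open>\<beta>\<close> and \<open>\<gamma>\<close>.\<close>

lemma sum_KL_flips_le:
  assumes \<beta>: "\<beta> \<in> signs d"
  shows "\<And>h. h < d \<Longrightarrow> integrable (obs \<beta>) (\<lambda>x. ln (ratio \<beta> h x))"
    and "(\<Sum>h<d. - integral\<^sup>L (obs \<beta>) (\<lambda>x. ln (ratio \<beta> h x))) \<le> b"
proof -
  define \<gamma> where "\<gamma> = (\<lambda>h\<in>{..<d}. - \<beta> h)"
  have \<gamma>: "\<gamma> \<in> signs d" using \<beta> by (auto simp: \<gamma>_def signs_def PiE_iff)
  have int: "integrable (obs \<beta>) (llr p (g \<beta>) (g \<gamma>))" "integral\<^sup>L (obs \<beta>) (llr p (g \<beta>) (g \<gamma>)) \<le> b"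
    using llr_int[OF \<beta> \<gamma>] by auto
  have int_h: "integrable (obs \<beta>) (\<lambda>x. indicator (\<Xi> h) x * llr p (g \<beta>) (g \<gamma>) x)" if "h < d" for h
    using integrable_real_mult_indicator[OF _ int(1), of "\<Xi> h"] bin_sets[OF that]
    by (simp add: sets_obs mult.commute)
  have eq: "AE x in obs \<beta>. ln (ratio \<beta> h x) = - (indicator (\<Xi> h) x * llr p (g \<beta>) (g \<gamma>) x)" if h: "h < d" for h
  proof -
    have "AE x in \<mu>. x \<in> \<Xi> h \<longrightarrow> p (g (flip \<beta> h)) x = p (g \<gamma>) x"
      using h by (intro dens_eq_on_bin flip_signs \<beta> \<gamma>) (auto simp: flip_def \<gamma>_def)
    from AE_obs_of_AE[OF \<beta> this] dens_pos[OF \<beta> \<beta>] dens_pos[OF \<beta> \<gamma>] show ?thesis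
      by eventually_elim (auto simp: ratio_def llr_def ln_div indicator_def)
  qed
  have meas: "(\<lambda>x. ln (ratio \<beta> h x)) \<in> borel_measurable (obs \<beta>)" if h: "h < d" for h
    using ratio_measurable[OF \<beta> h] by (simp add: measurable_cong_sets[OF sets_obs refl])
  show "integrable (obs \<beta>) (\<lambda>x. ln (ratio \<beta> h x))" if h: "h < d" for h
  proof (rule integrable_cong_AE_imp[OF _ meas[OF h]])
    show "integrable (obs \<beta>) (\<lambda>x. - (indicator (\<Xi> h) x * llr p (g \<beta>) (g \<gamma>) x))" using int_h[OF h] by simp
    show "AE x in obs \<beta>. - (indicator (\<Xi> h) x * llr p (g \<beta>) (g \<gamma>) x) = ln (ratio \<beta> h x)"
      using eq[OF h] by eventually_elim simp
  qed
  have "(\<Sum>h<d. - integral\<^sup>L (obs \<beta>) (\<lambda>x. ln (ratio \<beta> h x)))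
      = (\<Sum>h<d. integral\<^sup>L (obs \<beta>) (\<lambda>x. indicator (\<Xi> h) x * llr p (g \<beta>) (g \<gamma>) x))"
  proof (rule sum.cong[OF refl])
    fix h assume "h \<in> {..<d}" then have h: "h < d" by simp
    have "integral\<^sup>L (obs \<beta>) (\<lambda>x. ln (ratio \<beta> h x))
        = integral\<^sup>L (obs \<beta>) (\<lambda>x. - (indicator (\<Xi> h) x * llr p (g \<beta>) (g \<gamma>) x))"
      using meas[OF h] int_h[OF h] eq[OF h] by (intro integral_cong_AE) auto
    then show "- integral\<^sup>L (obs \<beta>) (\<lambda>x. ln (ratio \<beta> h x))
        = integral\<^sup>L (obs \<beta>) (\<lambda>x. indicator (\<Xi> h) x * llr p (g \<beta>) (g \<gamma>) x)" by simp
  qed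
  also have "\<dots> = integral\<^sup>L (obs \<beta>) (\<lambda>x. \<Sum>h<d. indicator (\<Xi> h) x * llr p (g \<beta>) (g \<gamma>) x)"
    using int_h by (subst Bochner_Integration.integral_sum) auto
  also have "\<dots> = integral\<^sup>L (obs \<beta>) (llr p (g \<beta>) (g \<gamma>))"
  proof (intro Bochner_Integration.integral_cong refl)
    fix x assume "x \<in> space (obs \<beta>)"
    then have "x \<in> (\<Union>h<d. \<Xi> h)" by (simp add: bin_cover space_obs)
    then have "(\<Sum>h<d. indicator (\<Xi> h) x) = (1::real)"
      using indicator_UN_disjoint[OF finite_lessThan bin_disj, of x] by simp
    then show "(\<Sum>h<d. indicator (\<Xi> h) x * llr p (g \<beta>) (g \<gamma>) x) = llr p (g \<beta>) (g \<gamma>) x"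
      by (simp flip: sum_distrib_right)
  qed
  finally show "(\<Sum>h<d. - integral\<^sup>L (obs \<beta>) (\<lambda>x. ln (ratio \<beta> h x))) \<le> b" using int(2) by simp
qed

text \<open>The tail event contains both orders of every pair, hence controls the log-likelihood ratio of a flip from
  above and from below.\<close>

lemma likelihood_ratio_tail:
  assumes \<beta>: "\<beta> \<in> signs d" and h: "h < d" and \<gamma>: "\<gamma> \<in> signs d"
  shows "measure (local_obs \<gamma>) {x \<in> space (local_obs \<beta>). 2 * a < \<bar>(\<Prod>i<n. ratio \<beta> h (x i)) - 1\<bar>} \<le> \<eta>"
proof -
  note fl = flip_signs[OF \<beta> h]
  interpret D: prob_space "data \<gamma>" by (rule prob_data[OF \<gamma>])
  define bad where "bad = {x \<in> space (local_obs \<beta>). 2 * a < \<bar>(\<Prod>i<n. ratio \<beta> h (x i)) - 1\<bar>}"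
  define T where "T = {X \<in> space (data \<gamma>). X 0 \<in> tail_event p n d g \<Xi> h a}"
  define BD where "BD = (\<lambda>X. X 0) -` bad \<inter> space (data \<gamma>)"
  have "(\<lambda>x. ratio \<beta> h (x i)) \<in> borel_measurable (local_obs \<beta>)" if "i < n" for i
    using measurable_comp[OF measurable_obs[OF that, of \<beta>], of "ratio \<beta> h" borel] ratio_measurable[OF \<beta> h]
    by (simp add: comp_def measurable_cong_sets[OF sets_obs refl])
  then have "bad \<in> sets (local_obs \<beta>)" unfolding bad_def by measurable
  then have bad: "bad \<in> sets (local_obs \<gamma>)" by (simp add: sets_local)
  have BD: "BD \<in> sets (data \<gamma>)" unfolding BD_def by (rule measurable_sets[OF measurable_local[OF m] bad])
  have tail: "\<bar>D.prob T - 1\<bar> \<le> \<eta>"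
    using tc h m \<gamma> by (auto simp: tail_control_def T_def data_def)
  have "measure (local_obs \<gamma>) bad = measure (distr (data \<gamma>) (local_obs \<gamma>) (\<lambda>X. X 0)) bad"
    by (simp add: distr_local[OF \<gamma> m])
  also have "\<dots> = D.prob BD"
    unfolding BD_def by (rule measure_distr[OF measurable_local[OF m] bad])
  also have "\<dots> \<le> \<eta>"
  (* a set that is not measurable has measure 0, which makes the claim trivial *)
  proof (cases "T \<in> sets (data \<gamma>)")
    case False
    then have "1 \<le> \<eta>" using tail by (simp add: measure_notin_sets)
    then show ?thesis using D.prob_le_1[of BD] by linarith
  next
    case True
    have pos: "AE X in data \<gamma>. \<forall>i\<in>{..<n}. 0 < p (g \<beta>) (X 0 i) \<and> 0 < p (g (flip \<beta> h)) (X 0 i)"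
    proof (rule AE_finite_allI)
      fix i assume "i \<in> {..<n}"
      then have "AE X in data \<gamma>. 0 < p (g \<beta>) (X 0 i)" "AE X in data \<gamma>. 0 < p (g (flip \<beta> h)) (X 0 i)"
        unfolding data_def using ec \<beta> \<gamma> fl m by (auto simp: expectation_control_def)
      then show "AE X in data \<gamma>. 0 < p (g \<beta>) (X 0 i) \<and> 0 < p (g (flip \<beta> h)) (X 0 i)"
        by eventually_elim auto
    qed simp
    have "AE X in data \<gamma>. X \<in> BD \<longrightarrow> X \<in> space (data \<gamma>) - T"
      using pos
    proof eventually_elim
      case (elim X)
      define x where "x = X 0"
      have px: "0 < p (g \<beta>) (x i)" "0 < p (g (flip \<beta> h)) (x i)" if "i < n" for i
        using elim that by (auto simp: x_def)
      have "\<bar>(\<Prod>i<n. ratio \<beta> h (x i)) - 1\<bar> \<le> 2 * a" if "X \<in> T"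
      proof -
        define I where "I = {i. i < n \<and> x i \<in> \<Xi> h}"
        have finI: "finite I" by (simp add: I_def)
        have "finite (signs d)" unfolding signs_def by (intro finite_PiE) auto
        then have fin: "finite (signs d \<times> signs d)" by simp
        have le: "(\<Sum>i\<in>I. llr p (g \<beta>1) (g \<beta>2) (x i)) \<le> a" if "\<beta>1 \<in> signs d" "\<beta>2 \<in> signs d" for \<beta>1 \<beta>2
        proof -
          have "(\<Sum>i\<in>I. llr p (g \<beta>1) (g \<beta>2) (x i)) \<le>
            Max ((\<lambda>(\<beta>, \<beta>'). \<Sum>i\<in>I. llr p (g \<beta>) (g \<beta>') (x i)) ` (signs d \<times> signs d))"
            using that fin by (intro Max_ge) (auto intro!: rev_image_eqI[of "(\<beta>1, \<beta>2)"])
          also have "\<dots> \<le> a" using \<open>X \<in> T\<close> by (simp add: T_def tail_event_def I_def x_def)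
          finally show ?thesis .
        qed
        have rp: "0 < ratio \<beta> h (x i)" if "i < n" for i using px[OF that] by (simp add: ratio_def)
        have "ln (\<Prod>i<n. ratio \<beta> h (x i)) = (\<Sum>i<n. ln (ratio \<beta> h (x i)))"
          using rp by (subst ln_prod) (auto simp: less_imp_neq[symmetric])
        also have "\<dots> = (\<Sum>i\<in>I. llr p (g (flip \<beta> h)) (g \<beta>) (x i))"
          by (intro sum.mono_neutral_cong_right) (auto simp: I_def ratio_def llr_def)
        finally have l1: "ln (\<Prod>i<n. ratio \<beta> h (x i)) = (\<Sum>i\<in>I. llr p (g (flip \<beta> h)) (g \<beta>) (x i))" .
        have "- (\<Sum>i\<in>I. llr p (g (flip \<beta> h)) (g \<beta>) (x i)) = (\<Sum>i\<in>I. llr p (g \<beta>) (g (flip \<beta> h)) (x i))"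
          unfolding sum_negf[symmetric] using px by (intro sum.cong) (auto simp: I_def llr_def ln_div)
        then show ?thesis
          using l1 le[OF \<beta> fl] le[OF fl \<beta>] rp a by (intro abs_diff_one_le_of_ln prod_pos) auto
      qed
      then show ?case by (force simp: BD_def bad_def x_def)
    qed
    then have "D.prob BD \<le> D.prob (space (data \<gamma>) - T)"
      using True by (intro D.finite_measure_mono_AE) auto
    also have "\<dots> = 1 - D.prob T" using True by (rule D.prob_compl)
    finally show ?thesis using tail by linarith
  qed
  finally show ?thesis unfolding bad_def .
qed

text \<open>The first bound is for machines with large budgets, the second one for small budgets. The truncation level is
  \<open>2 a\<close>, the range of the likelihood ratios around one on the tail events, whence \<open>16 a\<^sup>2 = 4 (2 a)\<^sup>2\<close>; these events are left with probability at most \<open>\<eta>\<close> under \<open>\<beta>\<close> and under each of the \<open>d\<close> flips.\<close>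

lemma machine_affinity_le:
  fixes enc :: "(nat \<Rightarrow> 'x) \<Rightarrow> 'y"
  assumes \<beta>: "\<beta> \<in> signs d" and enc: "enc \<in> measurable (PiM {..<n} (\<lambda>_. \<mu>)) (count_space UNIV)"
    and R: "finite R" "AE x in local_obs \<beta>. enc x \<in> R"
  defines "G \<equiv> (\<lambda>y. enc -` {y} \<inter> space (PiM {..<n} (\<lambda>_. \<mu>)))"
  shows "(\<Sum>h<d. 1 - (\<Sum>y\<in>R. sqrt (measure (local_obs \<beta>) (G y) * measure (local_obs (flip \<beta> h)) (G y))))
       \<le> min (real n / 2 * b) (16 * a\<^sup>2 * ln (real (card R)) + 4 * real d * \<eta>)"
proof -
  interpret E: binned_alternatives "obs \<beta>" d n \<Xi> "ratio \<beta>" by (rule binned_alternatives[OF \<beta>])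
  have Pn: "E.Pn = local_obs \<beta>" by (simp add: E.Pn_def local_obs_eq)
  have Qn: "E.Qn h = local_obs (flip \<beta> h)" if "h < d" for h
    by (simp add: E.Qn_def local_obs_eq density_ratio[OF \<beta> that])
  have Y: "enc \<in> measurable E.Pn (count_space UNIV)"
    using enc by (simp add: Pn measurable_cong_sets[OF sets_local refl])
  have R': "AE x in E.Pn. enc x \<in> R" unfolding Pn by (rule R(2))
  have G: "G y = enc -` {y} \<inter> space E.Pn" for y by (simp add: G_def Pn space_local)
  have "(\<Sum>h<d. 1 - (\<Sum>y\<in>R. sqrt (measure (local_obs \<beta>) (G y) * measure (local_obs (flip \<beta> h)) (G y))))
      \<le> (\<Sum>h<d. - real n / 2 * integral\<^sup>L (obs \<beta>) (\<lambda>x. ln (ratio \<beta> h x)))"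
    using E.affinity_le_of_KL[OF Y R(1) R' _ ratio_pos[OF \<beta>] sum_KL_flips_le(1)[OF \<beta>]]
    by (intro sum_mono) (simp add: Pn Qn G)
  also have "\<dots> = real n / 2 * (\<Sum>h<d. - integral\<^sup>L (obs \<beta>) (\<lambda>x. ln (ratio \<beta> h x)))"
    by (simp add: sum_distrib_left sum_negf)
  also have "\<dots> \<le> real n / 2 * b" by (intro mult_left_mono sum_KL_flips_le(2)[OF \<beta>]) auto
  finally have 1: "(\<Sum>h<d. 1 - (\<Sum>y\<in>R. sqrt (measure (local_obs \<beta>) (G y) * measure (local_obs (flip \<beta> h)) (G y))))
      \<le> real n / 2 * b" .
  define bad where "bad h = {x\<in>space E.Pn. 2 * a < \<bar>E.LR h x - 1\<bar>}" for h
  have "(\<Sum>h<d. 1 - (\<Sum>y\<in>R. sqrt (measure (local_obs \<beta>) (G y) * measure (local_obs (flip \<beta> h)) (G y))))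
      \<le> 4 * (2 * a)\<^sup>2 * ln (real (card R)) + 2 * (\<Sum>h<d. measure E.Pn (bad h) + measure (E.Qn h) (bad h))"
    using E.affinity_le_of_budget[OF Y R(1) R', of "2 * a"] a by (simp add: Pn Qn G bad_def)
  also have "\<dots> \<le> 16 * a\<^sup>2 * ln (real (card R)) + 2 * (\<Sum>h<d. \<eta> + \<eta>)"
  proof (intro add_mono mult_left_mono sum_mono)
    fix h assume "h \<in> {..<d}" then have h: "h < d" by simp
    show "measure E.Pn (bad h) \<le> \<eta>" "measure (E.Qn h) (bad h) \<le> \<eta>"
      using likelihood_ratio_tail[OF \<beta> h \<beta>] likelihood_ratio_tail[OF \<beta> h flip_signs[OF \<beta> h]] h
      by (simp_all add: bad_def Pn Qn E.LR_def)
  qed (auto simp: power2_eq_square)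
  also have "\<dots> = 16 * a\<^sup>2 * ln (real (card R)) + 4 * real d * \<eta>" by simp
  finally show ?thesis using 1 by simp
qed

end

section \<open>Assouad reduction for independent messages\<close>

text \<open>Since the affinity of product laws is the product of the affinities, it is at least one minus the sum of their
  defects; and \<open>\<Sum> min A B\<close> is at least half of the squared affinity, as \<open>sqrt (A B)\<close> is the geometric
  mean of minimum and maximum and the maxima sum to at most two.\<close>

lemma sum_min_prod_ge:
  fixes P Q :: "'k \<Rightarrow> 'y \<Rightarrow> real"
  assumes fin: "finite I" "\<And>k. k \<in> I \<Longrightarrow> finite (R k)"
    and nn: "\<And>k y. 0 \<le> P k y" "\<And>k y. 0 \<le> Q k y"
    and one: "\<And>k. k \<in> I \<Longrightarrow> (\<Sum>y\<in>R k. P k y) = 1" "\<And>k. k \<in> I \<Longrightarrow> (\<Sum>y\<in>R k. Q k y) = 1"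
  shows "1 / 2 - (\<Sum>k\<in>I. 1 - (\<Sum>y\<in>R k. sqrt (P k y * Q k y)))
       \<le> (\<Sum>y\<in>PiE I R. min (\<Prod>k\<in>I. P k (y k)) (\<Prod>k\<in>I. Q k (y k)))"
proof -
  define t where "t k = 1 - (\<Sum>y\<in>R k. sqrt (P k y * Q k y))" for k
  define s where "s = (\<Sum>k\<in>I. t k)"
  define A where "A y = (\<Prod>k\<in>I. P k (y k))" for y
  define B where "B y = (\<Prod>k\<in>I. Q k (y k))" for y
  define \<Lambda> where "\<Lambda> = (\<Sum>y\<in>PiE I R. min (A y) (B y))"
  have A: "0 \<le> A y" and B: "0 \<le> B y" for y by (auto simp: A_def B_def nn prod_nonneg)
  have t: "t k \<in> {0..1}" if k: "k \<in> I" for k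
  proof -
    have "0 \<le> (\<Sum>y\<in>R k. sqrt (P k y * Q k y))" by (intro sum_nonneg) (simp add: nn)
    moreover have "(\<Sum>y\<in>R k. sqrt (P k y * Q k y)) \<le> 1"
      using sum_sqrt_mult_le[of "R k" "P k" "Q k"] nn one[OF k] by simp
    ultimately show ?thesis by (simp add: t_def)
  qed
  have "1 - s \<le> (\<Prod>k\<in>I. 1 - t k)" unfolding s_def by (rule Weierstrass_prod_ineq[OF t])
  also have "\<dots> = (\<Prod>k\<in>I. \<Sum>y\<in>R k. sqrt (P k y * Q k y))" by (simp add: t_def)
  also have "\<dots> = (\<Sum>y\<in>PiE I R. \<Prod>k\<in>I. sqrt (P k (y k) * Q k (y k)))"
    using fin by (rule prod_sum_PiE)
  also have "\<dots> = (\<Sum>y\<in>PiE I R. sqrt (min (A y) (B y) * max (A y) (B y)))"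
  proof (intro sum.cong refl)
    fix y
    have "(\<Prod>k\<in>I. sqrt (P k (y k) * Q k (y k))) = sqrt (\<Prod>k\<in>I. P k (y k) * Q k (y k))"
      using fin(1) by (induction I rule: finite_induct) (auto simp: real_sqrt_mult)
    also have "(\<Prod>k\<in>I. P k (y k) * Q k (y k)) = min (A y) (B y) * max (A y) (B y)"
      by (simp add: A_def B_def prod.distrib min_def max_def)
    finally show "(\<Prod>k\<in>I. sqrt (P k (y k) * Q k (y k))) = sqrt (min (A y) (B y) * max (A y) (B y))" .
  qed
  also have "\<dots> \<le> sqrt (\<Lambda> * (\<Sum>y\<in>PiE I R. max (A y) (B y)))"
    unfolding \<Lambda>_def using A B by (intro sum_sqrt_mult_le) (auto simp: le_max_iff_disj)
  also have "\<dots> \<le> sqrt (\<Lambda> * 2)"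
  proof (intro real_sqrt_le_mono mult_left_mono)
    have "(\<Sum>y\<in>PiE I R. max (A y) (B y)) \<le> (\<Sum>y\<in>PiE I R. A y + B y)"
      using A B by (intro sum_mono) auto
    also have "\<dots> = (\<Prod>k\<in>I. \<Sum>y\<in>R k. P k y) + (\<Prod>k\<in>I. \<Sum>y\<in>R k. Q k y)"
      using fin by (simp add: A_def B_def sum.distrib prod_sum_PiE)
    also have "\<dots> = 2" using one by simp
    finally show "(\<Sum>y\<in>PiE I R. max (A y) (B y)) \<le> 2" .
    show "0 \<le> \<Lambda>" unfolding \<Lambda>_def using A B by (intro sum_nonneg) auto
  qed
  finally have main: "1 - s \<le> sqrt (\<Lambda> * 2)" .
  have \<Lambda>: "0 \<le> \<Lambda>" unfolding \<Lambda>_def using A B by (intro sum_nonneg) auto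
  have "1 / 2 - s \<le> \<Lambda>"
  proof (cases "s \<le> 1")
    case True
    then have "(1 - s)\<^sup>2 \<le> (sqrt (\<Lambda> * 2))\<^sup>2" using main by (intro power_mono) auto
    then have "(1 - s)\<^sup>2 \<le> \<Lambda> * 2" using \<Lambda> by simp
    moreover have "1 - 2 * s \<le> (1 - s)\<^sup>2" by (simp add: power2_eq_square algebra_simps)
    ultimately show ?thesis by linarith
  qed (use \<Lambda> in linarith)
  then show ?thesis by (simp add: s_def t_def \<Lambda>_def A_def B_def)
qed

lemma ln_card_short_lists_le: "ln (real (card {ys :: bool list. length ys \<le> B})) \<le> 2 * real B"
proof -
  have "card {ys :: bool list. length ys \<le> B} = (\<Sum>i\<le>B. 2 ^ i)"
    using card_lists_length_le[of "UNIV :: bool set" B] by simp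
  moreover have "(\<Sum>i\<le>B. 2 ^ i :: nat) \<le> 4 ^ B"
  proof (induction B)
    case (Suc B)
    have "(2::nat) ^ B \<le> 4 ^ B" by (intro power_mono) auto
    then show ?case using Suc by simp
  qed simp
  ultimately have "card {ys :: bool list. length ys \<le> B} \<le> 4 ^ B" by simp
  then have "real (card {ys :: bool list. length ys \<le> B}) \<le> real (4 ^ B)" by (rule of_nat_mono)
  then have le: "real (card {ys :: bool list. length ys \<le> B}) \<le> 4 ^ B" by simp
  have "[] \<in> {ys :: bool list. length ys \<le> B}" by simp
  moreover have fin: "finite {ys :: bool list. length ys \<le> B}"
    using finite_lists_length_le[of "UNIV :: bool set" B] by simp
  ultimately have pos: "0 < card {ys :: bool list. length ys \<le> B}" unfolding card_gt_0_iff by blast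
  have "ln (real (card {ys :: bool list. length ys \<le> B})) \<le> ln (4 ^ B)"
    using le pos by (subst ln_le_cancel_iff) auto
  also have "\<dots> = real B * ln 4" by (simp add: ln_realpow)
  also have "ln 4 = 2 * ln (2::real)" using ln_realpow[of "2::real" 2] by simp
  also have "ln (2::real) \<le> 1" using ln_le_minus_one[of "2::real"] by simp
  finally show ?thesis by (simp add: mult_left_mono)
qed

context sieve_experiment
begin

definition fibre :: "((nat \<Rightarrow> 'x) \<Rightarrow> bool list) \<Rightarrow> bool list \<Rightarrow> (nat \<Rightarrow> 'x) set" where
  "fibre e y = e -` {y} \<inter> space (PiM {..<n} (\<lambda>_. \<mu>))"

lemma fibre_sets: "e \<in> measurable (PiM {..<n} (\<lambda>_. \<mu>)) (count_space UNIV) \<Longrightarrow> fibre e y \<in> sets (local_obs \<beta>)"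
  unfolding fibre_def sets_local by (rule measurable_sets) auto

text \<open>As an estimator sees the messages only, its risk is a sum over message vectors, whose probabilities factorise.
  Only finitely many of them are kept.\<close>

lemma risk_ge_sum_messages:
  fixes L :: "bool list list \<Rightarrow> ennreal"
  assumes \<beta>: "\<beta> \<in> signs d"
    and enc: "\<And>k. k < m \<Longrightarrow> enc k \<in> measurable (PiM {..<n} (\<lambda>_. \<mu>)) (count_space UNIV)"
    and fin: "finite T" "T \<subseteq> extensional {..<m}"
  shows "(\<Sum>y\<in>T. L (map y [0..<m]) * ennreal (\<Prod>k<m. measure (local_obs \<beta>) (fibre (enc k) (y k))))
       \<le> (\<integral>\<^sup>+X. L (map (\<lambda>k. enc k (X k)) [0..<m]) \<partial>data \<beta>)"
proof -
  define S where "S y = PiE {..<m} (\<lambda>k. fibre (enc k) (y k))" for y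
  interpret PL: product_prob_space "\<lambda>_. local_obs \<beta>" "{..<m}"
    by (rule product_prob_spaceI) (rule prob_local[OF \<beta>])
  have Sm: "S y \<in> sets (data \<beta>)" for y
    unfolding S_def data_eq using enc by (intro sets_PiM_I_finite) (auto intro: fibre_sets)
  have Se: "emeasure (data \<beta>) (S y) = ennreal (\<Prod>k<m. measure (local_obs \<beta>) (fibre (enc k) (y k)))" for y
  proof -
    have "emeasure (data \<beta>) (S y) = (\<Prod>k<m. emeasure (local_obs \<beta>) (fibre (enc k) (y k)))"
      unfolding S_def data_eq using enc by (intro PL.emeasure_PiM) (auto intro: fibre_sets)
    then show ?thesis by (simp add: PL.M.emeasure_eq_measure prod_ennreal)
  qed
  have "(\<Sum>y\<in>T. L (map y [0..<m]) * ennreal (\<Prod>k<m. measure (local_obs \<beta>) (fibre (enc k) (y k))))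
      = (\<integral>\<^sup>+X. (\<Sum>y\<in>T. L (map y [0..<m]) * indicator (S y) X) \<partial>data \<beta>)"
    using Sm by (simp add: Se nn_integral_sum nn_integral_cmult_indicator)
  also have "\<dots> \<le> (\<integral>\<^sup>+X. L (map (\<lambda>k. enc k (X k)) [0..<m]) \<partial>data \<beta>)"
  proof (rule nn_integral_mono)
    fix X
    define y0 where "y0 = (\<lambda>k\<in>{..<m}. enc k (X k))"
    have "L (map y [0..<m]) * indicator (S y) X
        \<le> (if y = y0 then L (map (\<lambda>k. enc k (X k)) [0..<m]) else 0)" if y: "y \<in> T" for y
    proof (cases "X \<in> S y")
      case True
      have "y = y0"
      proof (rule extensionalityI[where A="{..<m}"])
        show "y \<in> extensional {..<m}" using y fin by auto
        fix k assume "k \<in> {..<m}"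
        then show "y k = y0 k" using True by (auto simp: S_def y0_def fibre_def PiE_iff)
      qed (simp add: y0_def)
      moreover have "map y0 [0..<m] = map (\<lambda>k. enc k (X k)) [0..<m]" by (simp add: y0_def)
      ultimately show ?thesis using True by (simp only: indicator_simps) simp
    qed simp
    then have "(\<Sum>y\<in>T. L (map y [0..<m]) * indicator (S y) X)
        \<le> (\<Sum>y\<in>T. if y = y0 then L (map (\<lambda>k. enc k (X k)) [0..<m]) else 0)" by (rule sum_mono)
    also have "\<dots> \<le> L (map (\<lambda>k. enc k (X k)) [0..<m])" using fin by simp
    finally show "(\<Sum>y\<in>T. L (map y [0..<m]) * indicator (S y) X) \<le> L (map (\<lambda>k. enc k (X k)) [0..<m])" .
  qed
  finally show ?thesis .
qed

text \<open>Pair every sign vector with its flip in coordinate \<open>h\<close>: the two risks add up to at least the separation \<open>s\<close> times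
  the overlap \<open>\<Sum>\<^sub>y min\<close> of the two laws of the message vector. The flip permutes the sign vectors, so averaging
  over all of them counts every risk twice, and the worst risk is at least the average.\<close>

lemma distributed_assouad:
  fixes loss :: "nat \<Rightarrow> (real \<Rightarrow> real) \<Rightarrow> (nat \<Rightarrow> real) \<Rightarrow> ennreal" and s :: real
  assumes est: "est \<in> dist_estimators \<mu> p F n m B" and F: "g ` signs d \<subseteq> F"
    and loss_le: "\<And>f \<beta>. f \<in> L2_unit \<Longrightarrow> \<beta> \<in> signs d \<Longrightarrow> (\<Sum>h<d. loss h f \<beta>) \<le> l2_dist_sq f (g \<beta>)"
    and loss_sep: "\<And>f \<beta> h. f \<in> L2_unit \<Longrightarrow> \<beta> \<in> signs d \<Longrightarrow> h < d \<Longrightarrow> ennreal s \<le> loss h f \<beta> + loss h f (flip \<beta> h)"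
    and s: "0 \<le> s"
    and info: "(\<Sum>k<m. min (real n / 2 * b) (32 * a\<^sup>2 * real (B k) + 4 * real d * \<eta>)) \<le> real d / 4"
  shows "ennreal (s * real d / 8) \<le> (SUP f\<in>F. \<integral>\<^sup>+X. l2_dist_sq (est X) f \<partial>data_law \<mu> p n m f)"
proof -
  from est obtain enc :: "nat \<Rightarrow> (nat \<Rightarrow> 'x) \<Rightarrow> bool list" and dec where
    est_eq: "est = (\<lambda>X. dec (map (\<lambda>k. enc k (X k)) [0..<m]))"
    and enc: "\<And>k. k < m \<Longrightarrow> enc k \<in> measurable (PiM {..<n} (\<lambda>_. \<mu>)) (count_space UNIV)"
    and len: "\<And>k f. k < m \<Longrightarrow> f \<in> F \<Longrightarrow> AE x in local_law \<mu> p n f. length (enc k x) \<le> B k"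
    and dec: "\<And>y. dec y \<in> L2_unit"
    unfolding dist_estimators_def by blast
  define R where "R k = {ys :: bool list. length ys \<le> B k}" for k
  have finR: "finite (R k)" for k
    using finite_lists_length_le[of "UNIV :: bool set" "B k"] by (simp add: R_def)
  define T where "T = PiE {..<m} R"
  have finT: "finite T" and extT: "T \<subseteq> extensional {..<m}"
    using finR by (auto simp: T_def PiE_iff intro!: finite_PiE)
  define q where "q \<beta> k y = measure (local_obs \<beta>) (fibre (enc k) y)" for \<beta> k y
  define A where "A \<beta> y = (\<Prod>k<m. q \<beta> k (y k))" for \<beta> y
  define f where "f y = dec (map y [0..<m])" for y :: "nat \<Rightarrow> bool list"
  have fL: "f y \<in> L2_unit" for y by (simp add: f_def dec)
  have q0: "0 \<le> q \<beta> k y" for \<beta> k y by (simp add: q_def)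
  have A0: "0 \<le> A \<beta> y" for \<beta> y by (simp add: A_def q0 prod_nonneg)
  have encR: "AE x in local_obs \<beta>. enc k x \<in> R k" if "\<beta> \<in> signs d" "k < m" for \<beta> k
    using len[OF that(2), of "g \<beta>"] F that unfolding local_obs_def R_def by auto
  have q1: "(\<Sum>y\<in>R k. q \<beta> k y) = 1" if \<beta>: "\<beta> \<in> signs d" and k: "k < m" for \<beta> k
  proof -
    interpret Lo: prob_space "local_obs \<beta>" by (rule prob_local[OF \<beta>])
    have e: "enc k \<in> measurable (local_obs \<beta>) (count_space UNIV)"
      using enc[OF k] by (simp add: measurable_cong_sets[OF sets_local refl])
    have "(\<Sum>y\<in>R k. Lo.expectation (\<lambda>\<omega>. 1 * indicator (enc k -` {y} \<inter> space (local_obs \<beta>)) \<omega>)) = (Lo.expectation (\<lambda>_. 1) :: real)"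
      by (rule Lo.sum_expectation_fibres[OF e finR encR[OF \<beta> k]]) simp
    then show ?thesis using Lo.prob_space by (simp add: q_def fibre_def space_local[of \<beta>])
  qed
  define M where "M \<beta> h = (\<Sum>y\<in>T. min (A \<beta> y) (A (flip \<beta> h) y))" for \<beta> h
  have M: "real d / 4 \<le> (\<Sum>h<d. M \<beta> h)" if \<beta>: "\<beta> \<in> signs d" for \<beta>
  proof -
    have "(\<Sum>h<d. 1 / 2 - (\<Sum>k<m. 1 - (\<Sum>y\<in>R k. sqrt (q \<beta> k y * q (flip \<beta> h) k y)))) \<le> (\<Sum>h<d. M \<beta> h)"
    proof (rule sum_mono)
      fix h assume "h \<in> {..<d}"
      then have fl: "flip \<beta> h \<in> signs d" using flip_signs[OF \<beta>] by simp
      show "1 / 2 - (\<Sum>k<m. 1 - (\<Sum>y\<in>R k. sqrt (q \<beta> k y * q (flip \<beta> h) k y))) \<le> M \<beta> h"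
        unfolding M_def A_def T_def
        by (rule sum_min_prod_ge) (auto simp: finR q0 q1[OF \<beta>] q1[OF fl])
    qed
    moreover have "(\<Sum>h<d. \<Sum>k<m. 1 - (\<Sum>y\<in>R k. sqrt (q \<beta> k y * q (flip \<beta> h) k y))) \<le> real d / 4"
    proof -
      have "(\<Sum>h<d. \<Sum>k<m. 1 - (\<Sum>y\<in>R k. sqrt (q \<beta> k y * q (flip \<beta> h) k y)))
          = (\<Sum>k<m. \<Sum>h<d. 1 - (\<Sum>y\<in>R k. sqrt (q \<beta> k y * q (flip \<beta> h) k y)))" by (rule sum.swap)
      also have "\<dots> \<le> (\<Sum>k<m. min (real n / 2 * b) (32 * a\<^sup>2 * real (B k) + 4 * real d * \<eta>))"
      proof (rule sum_mono)
        fix k assume "k \<in> {..<m}" then have k: "k < m" by simp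
        have "(\<Sum>h<d. 1 - (\<Sum>y\<in>R k. sqrt (q \<beta> k y * q (flip \<beta> h) k y)))
            \<le> min (real n / 2 * b) (16 * a\<^sup>2 * ln (real (card (R k))) + 4 * real d * \<eta>)"
          unfolding q_def fibre_def by (rule machine_affinity_le[OF \<beta> enc[OF k] finR encR[OF \<beta> k]])
        also have "\<dots> \<le> min (real n / 2 * b) (16 * a\<^sup>2 * (2 * real (B k)) + 4 * real d * \<eta>)"
          unfolding R_def by (intro min.mono add_mono mult_left_mono ln_card_short_lists_le) auto
        finally show "(\<Sum>h<d. 1 - (\<Sum>y\<in>R k. sqrt (q \<beta> k y * q (flip \<beta> h) k y)))
            \<le> min (real n / 2 * b) (32 * a\<^sup>2 * real (B k) + 4 * real d * \<eta>)" by simp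
      qed
      finally show ?thesis using info by linarith
    qed
    ultimately show ?thesis by (simp add: sum_subtractf)
  qed
  define risk where "risk \<beta> = (\<integral>\<^sup>+X. l2_dist_sq (est X) (g \<beta>) \<partial>data \<beta>)" for \<beta>
  define K where "K \<beta> h = (\<Sum>y\<in>T. loss h (f y) \<beta> * ennreal (A \<beta> y))" for \<beta> h
  have risk_ge: "(\<Sum>h<d. K \<beta> h) \<le> risk \<beta>" if \<beta>: "\<beta> \<in> signs d" for \<beta>
  proof -
    have "(\<Sum>h<d. K \<beta> h) = (\<Sum>y\<in>T. (\<Sum>h<d. loss h (f y) \<beta>) * ennreal (A \<beta> y))"
      unfolding K_def by (subst sum.swap) (simp add: sum_distrib_right)
    also have "\<dots> \<le> (\<Sum>y\<in>T. l2_dist_sq (f y) (g \<beta>) * ennreal (A \<beta> y))"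
      using loss_le[OF fL \<beta>] by (intro sum_mono mult_right_mono) auto
    also have "\<dots> \<le> risk \<beta>"
      unfolding risk_def est_eq f_def A_def q_def
      by (rule risk_ge_sum_messages[OF \<beta> enc finT extT])
    finally show ?thesis .
  qed
  have pair: "ennreal (s * M \<beta> h) \<le> K \<beta> h + K (flip \<beta> h) h" if \<beta>: "\<beta> \<in> signs d" and h: "h < d" for \<beta> h
  proof -
    have "ennreal (s * M \<beta> h) = (\<Sum>y\<in>T. ennreal s * ennreal (min (A \<beta> y) (A (flip \<beta> h) y)))"
      unfolding M_def using s A0 by (simp add: sum_distrib_left ennreal_mult flip: sum_ennreal)
    also have "\<dots> \<le> (\<Sum>y\<in>T. loss h (f y) \<beta> * ennreal (A \<beta> y) + loss h (f y) (flip \<beta> h) * ennreal (A (flip \<beta> h) y))"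
    proof (rule sum_mono)
      fix y
      have "ennreal s * ennreal (min (A \<beta> y) (A (flip \<beta> h) y))
          \<le> (loss h (f y) \<beta> + loss h (f y) (flip \<beta> h)) * ennreal (min (A \<beta> y) (A (flip \<beta> h) y))"
        using loss_sep[OF fL \<beta> h] by (intro mult_right_mono) auto
      also have "\<dots> \<le> loss h (f y) \<beta> * ennreal (A \<beta> y) + loss h (f y) (flip \<beta> h) * ennreal (A (flip \<beta> h) y)"
        unfolding distrib_right by (intro add_mono mult_left_mono ennreal_leI) auto
      finally show "ennreal s * ennreal (min (A \<beta> y) (A (flip \<beta> h) y))
          \<le> loss h (f y) \<beta> * ennreal (A \<beta> y) + loss h (f y) (flip \<beta> h) * ennreal (A (flip \<beta> h) y)" .
    qed
    also have "\<dots> = K \<beta> h + K (flip \<beta> h) h" by (simp add: K_def sum.distrib)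
    finally show ?thesis .
  qed
  have M0: "0 \<le> M \<beta> h" for \<beta> h unfolding M_def by (intro sum_nonneg) (simp add: A0)
  define S where "S = (SUP f\<in>F. \<integral>\<^sup>+X. l2_dist_sq (est X) f \<partial>data_law \<mu> p n m f)"
  have riskS: "risk \<beta> \<le> S" if "\<beta> \<in> signs d" for \<beta>
    unfolding risk_def S_def data_def using F that by (intro SUP_upper) auto
  define c where "c = real (card (signs d))"
  have "(\<lambda>h\<in>{..<d}. 1) \<in> signs d" by (auto simp: signs_def)
  then have c: "0 < c" using finite_signs by (auto simp: c_def card_gt_0_iff)
  have "ennreal (c * (s * real d / 4)) \<le> (\<Sum>\<beta>\<in>signs d. ennreal (s * real d / 4))"
  proof -
    have "ennreal (c * (s * real d / 4)) = ennreal c * ennreal (s * real d / 4)"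
      using c s by (intro ennreal_mult) auto
    then show ?thesis by (simp add: c_def ennreal_of_nat_eq_real_of_nat)
  qed
  also have "\<dots> \<le> (\<Sum>\<beta>\<in>signs d. \<Sum>h<d. ennreal (s * M \<beta> h))"
  proof (rule sum_mono)
    fix \<beta> assume \<beta>: "\<beta> \<in> signs d"
    have "ennreal (s * real d / 4) = ennreal (s * (real d / 4))" by simp
    also have "\<dots> \<le> ennreal (s * (\<Sum>h<d. M \<beta> h))" using M[OF \<beta>] s by (intro ennreal_leI mult_left_mono)
    also have "\<dots> = (\<Sum>h<d. ennreal (s * M \<beta> h))" using s M0 by (simp add: sum_distrib_left)
    finally show "ennreal (s * real d / 4) \<le> (\<Sum>h<d. ennreal (s * M \<beta> h))" .
  qed
  also have "\<dots> \<le> (\<Sum>\<beta>\<in>signs d. \<Sum>h<d. K \<beta> h + K (flip \<beta> h) h)"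
    by (intro sum_mono pair) auto
  also have "\<dots> = (\<Sum>\<beta>\<in>signs d. \<Sum>h<d. K \<beta> h) + (\<Sum>h<d. \<Sum>\<beta>\<in>signs d. K (flip \<beta> h) h)"
    by (simp add: sum.distrib sum.swap[of _ "{..<d}"])
  also have "(\<Sum>h<d. \<Sum>\<beta>\<in>signs d. K (flip \<beta> h) h) = (\<Sum>h<d. \<Sum>\<beta>\<in>signs d. K \<beta> h)"
    by (intro sum.cong refl sum_signs_flip) simp
  also have "\<dots> = (\<Sum>\<beta>\<in>signs d. \<Sum>h<d. K \<beta> h)" by (rule sum.swap)
  also have "(\<Sum>\<beta>\<in>signs d. \<Sum>h<d. K \<beta> h) + (\<Sum>\<beta>\<in>signs d. \<Sum>h<d. K \<beta> h) \<le> (\<Sum>\<beta>\<in>signs d. S) + (\<Sum>\<beta>\<in>signs d. S)"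
    using order_trans[OF risk_ge riskS] by (intro add_mono sum_mono) auto
  also have "\<dots> = ennreal (2 * c) * S"
  proof -
    have "ennreal (2 * c) = ennreal c + ennreal c" using c by (simp flip: ennreal_plus)
    then show ?thesis by (simp add: c_def ennreal_of_nat_eq_real_of_nat distrib_right)
  qed
  finally have "ennreal (c * (s * real d / 4)) \<le> ennreal (2 * c) * S" .
  moreover have "ennreal (c * (s * real d / 4)) = ennreal (2 * c) * ennreal (s * real d / 8)"
    using c s by (subst ennreal_mult[symmetric]) auto
  ultimately have "ennreal (2 * c) * ennreal (s * real d / 8) \<le> ennreal (2 * c) * S" by simp
  then show ?thesis using c by (simp add: S_def ennreal_mult_le_mult_iff)
qed

end

section \<open>Separation of the sieve in quadratic loss\<close>

definition bin_loss :: "(nat \<Rightarrow> real set) \<Rightarrow> ((nat \<Rightarrow> real) \<Rightarrow> real \<Rightarrow> real) \<Rightarrow>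
    nat \<Rightarrow> (real \<Rightarrow> real) \<Rightarrow> (nat \<Rightarrow> real) \<Rightarrow> ennreal" where
  "bin_loss I g h f \<beta> = (\<integral>\<^sup>+x. ennreal ((f x - g \<beta> x)\<^sup>2) * indicator (I h) x \<partial>lebesgue_on {0..1})"

lemma interval_sets_lebesgue_on_unit:
  assumes "is_interval I" "I \<subseteq> {0..1::real}" shows "I \<in> sets (lebesgue_on {0..1})"
proof -
  have "I \<in> sets lebesgue" using real_interval_borel_measurable[OF assms(1)] by simp
  then show ?thesis using assms(2) by (auto simp: sets_restrict_space_iff)
qed

lemma sum_bin_loss_le:
  assumes I: "\<And>h. h < d \<Longrightarrow> is_interval (I h)" "disjoint_family_on I {..<d}" "(\<Union>h<d. I h) = {0..1}"
    and f: "f \<in> L2_unit" and g: "g \<beta> \<in> L2_unit"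
  shows "(\<Sum>h<d. bin_loss I g h f \<beta>) \<le> l2_dist_sq f (g \<beta>)"
proof -
  have [measurable]: "f \<in> borel_measurable (lebesgue_on {0..1})" "g \<beta> \<in> borel_measurable (lebesgue_on {0..1})"
    using f g by (auto simp: L2_unit_def)
  have [measurable]: "I h \<in> sets (lebesgue_on {0..1})" if "h < d" for h
    using I that by (intro interval_sets_lebesgue_on_unit) auto
  have "(\<Sum>h<d. bin_loss I g h f \<beta>)
      = (\<integral>\<^sup>+x. (\<Sum>h<d. ennreal ((f x - g \<beta> x)\<^sup>2) * indicator (I h) x) \<partial>lebesgue_on {0..1})"
    unfolding bin_loss_def by (intro nn_integral_sum[symmetric]) measurable
  also have "\<dots> \<le> l2_dist_sq f (g \<beta>)"
    unfolding l2_dist_sq_def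
  proof (rule nn_integral_mono)
    fix x
    have "(\<Sum>h<d. indicator (I h) x :: ennreal) = indicator (\<Union>h<d. I h) x"
      by (rule indicator_UN_disjoint[OF finite_lessThan I(2), symmetric])
    also have "\<dots> \<le> 1" by (simp add: indicator_def)
    finally have "ennreal ((f x - g \<beta> x)\<^sup>2) * (\<Sum>h<d. indicator (I h) x) \<le> ennreal ((f x - g \<beta> x)\<^sup>2) * 1"
      by (rule mult_left_mono) simp
    then show "(\<Sum>h<d. ennreal ((f x - g \<beta> x)\<^sup>2) * indicator (I h) x) \<le> ennreal ((f x - g \<beta> x)\<^sup>2)"
      by (simp add: sum_distrib_left)
  qed
  finally show ?thesis .
qed

lemma sieve_fn_flip:
  assumes h: "h < d"
  shows "sieve_fn w r d j \<kappa> C0 \<epsilon> \<beta> x - sieve_fn w r d j \<kappa> C0 \<epsilon> (flip \<beta> h) x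
       = 2 * (\<epsilon> * real d powr (- (r + 1/2))) * \<beta> h * w j (\<kappa> h) x"
proof -
  have "(\<Sum>h'<d. \<beta> h' * w j (\<kappa> h') x) - (\<Sum>h'<d. flip \<beta> h h' * w j (\<kappa> h') x)
      = (\<Sum>h'<d. if h' = h then 2 * \<beta> h * w j (\<kappa> h) x else 0)"
    unfolding sum_subtractf[symmetric] by (intro sum.cong) (auto simp: flip_def)
  also have "\<dots> = 2 * \<beta> h * w j (\<kappa> h) x" using h by simp
  finally have *: "(\<Sum>h'<d. \<beta> h' * w j (\<kappa> h') x) - (\<Sum>h'<d. flip \<beta> h h' * w j (\<kappa> h') x) = 2 * \<beta> h * w j (\<kappa> h) x" .
  have "sieve_fn w r d j \<kappa> C0 \<epsilon> \<beta> x - sieve_fn w r d j \<kappa> C0 \<epsilon> (flip \<beta> h) x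
      = \<epsilon> * real d powr (- (r + 1/2)) *
        ((\<Sum>h'<d. \<beta> h' * w j (\<kappa> h') x) - (\<Sum>h'<d. flip \<beta> h h' * w j (\<kappa> h') x))"
    by (simp add: sieve_fn_def right_diff_distrib)
  then show ?thesis unfolding * by simp
qed

text \<open>The two members of the sieve differ by \<open>2 \<delta>\<close> times a normalised wavelet supported in the interval \<open>I h\<close>, and no function
  can be close to both there.\<close>

lemma bin_loss_separation:
  assumes w: "cdv_wavelet_basis S J w" and lay: "sieve_layout J w d j I \<kappa>"
    and f: "f \<in> L2_unit" and \<beta>: "\<beta> \<in> signs d" and h: "h < d"
    and g: "\<And>\<beta>. \<beta> \<in> signs d \<Longrightarrow> sieve_fn w r d j \<kappa> C0 \<epsilon> \<beta> \<in> L2_unit"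
  defines "G \<equiv> sieve_fn w r d j \<kappa> C0 \<epsilon>" and "\<delta> \<equiv> \<epsilon> * real d powr (- (r + 1/2))"
  shows "ennreal (2 * \<delta>\<^sup>2) \<le> bin_loss I G h f \<beta> + bin_loss I G h f (flip \<beta> h)"
proof -
  define \<psi> where "\<psi> = w j (\<kappa> h)"
  have I: "is_interval (I h)" "I h \<subseteq> {0..1}" and \<kappa>: "\<kappa> h < level_size J j"
    and supp: "closure {x. \<psi> x \<noteq> 0} \<subseteq> I h"
    using lay h by (auto simp: sieve_layout_def \<psi>_def)
  have out: "\<psi> x = 0" if "x \<notin> I h" for x using supp closure_subset[of "{x. \<psi> x \<noteq> 0}"] that by auto
  note [measurable] = interval_sets_lebesgue_on_unit[OF I]
  have [measurable]: "f \<in> borel_measurable (lebesgue_on {0..1})" "G \<beta> \<in> borel_measurable (lebesgue_on {0..1})"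
    "G (flip \<beta> h) \<in> borel_measurable (lebesgue_on {0..1})"
    using f g[OF \<beta>] g[OF flip_signs[OF \<beta> h]] by (auto simp: L2_unit_def G_def)
  have inner: "(LINT x|lebesgue_on {0..1}. (\<psi> x)\<^sup>2) = 1"
    using w \<kappa> by (auto simp: cdv_wavelet_basis_def l2_inner_def \<psi>_def power2_eq_square)
  then have int: "integrable (lebesgue_on {0..1}) (\<lambda>x. (\<psi> x)\<^sup>2)"
    using not_integrable_integral_eq by fastforce
  have "ennreal (2 * \<delta>\<^sup>2) = (\<integral>\<^sup>+x. ennreal (2 * \<delta>\<^sup>2 * (\<psi> x)\<^sup>2) \<partial>lebesgue_on {0..1})"
    using int inner by (subst nn_integral_eq_integral) auto
  also have "\<dots> \<le> (\<integral>\<^sup>+x. ennreal ((f x - G \<beta> x)\<^sup>2) * indicator (I h) x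
      + ennreal ((f x - G (flip \<beta> h) x)\<^sup>2) * indicator (I h) x \<partial>lebesgue_on {0..1})"
  proof (rule nn_integral_mono)
    fix x
    show "ennreal (2 * \<delta>\<^sup>2 * (\<psi> x)\<^sup>2) \<le> ennreal ((f x - G \<beta> x)\<^sup>2) * indicator (I h) x
      + ennreal ((f x - G (flip \<beta> h) x)\<^sup>2) * indicator (I h) x"
    proof (cases "x \<in> I h")
      case True
      define u v where "u = f x - G \<beta> x" and "v = f x - G (flip \<beta> h) x"
      have "\<beta> h = 1 \<or> \<beta> h = -1" using \<beta> h by (auto simp: signs_def PiE_iff)
      then have "(v - u)\<^sup>2 = 4 * \<delta>\<^sup>2 * (\<psi> x)\<^sup>2"
        using sieve_fn_flip[OF h, of w r j \<kappa> C0 \<epsilon> \<beta> x]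
        by (auto simp: u_def v_def G_def \<delta>_def \<psi>_def power_mult_distrib)
      moreover have "(v - u)\<^sup>2 \<le> 2 * (u\<^sup>2 + v\<^sup>2)"
        using zero_le_power2[of "u + v"] by (simp add: power2_sum power2_diff algebra_simps)
      ultimately have "2 * \<delta>\<^sup>2 * (\<psi> x)\<^sup>2 \<le> u\<^sup>2 + v\<^sup>2" by simp
      then have "ennreal (2 * \<delta>\<^sup>2 * (\<psi> x)\<^sup>2) \<le> ennreal (u\<^sup>2 + v\<^sup>2)" by (rule ennreal_leI)
      then show ?thesis using True by (simp add: u_def v_def)
    qed (simp add: out)
  qed
  also have "\<dots> = bin_loss I G h f \<beta> + bin_loss I G h f (flip \<beta> h)"
    unfolding bin_loss_def by (intro nn_integral_add) measurable
  finally show ?thesis .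
qed

section \<open>The minimax lower bound\<close>

lemma N_bass_fixpoint:
  assumes "0 < r" "2 \<le> n * m"
  shows "0 < N_bass r n m B" "N_bass r n m B = bass_rhs r n m B (N_bass r n m B)"
  using theI'[OF bass_ex1[OF assms]] by (simp_all add: N_bass_def)

text \<open>Here \<open>D\<close> stands for \<open>N\<^sub>b\<^sub>a\<^sub>s\<^sub>s\<^bsup>1/(1+2r)\<^esup>\<close> and \<open>l\<close> for \<open>log N\<close>. The hypotheses \<open>noise\<close> and \<open>comm\<close> are the two branches of the
  maximum that defines the bit adjusted sample size. The first one bounds \<open>a\<close>, the second one bounds the sum of the
  machines' information, up to the tail probabilities, by a multiple of \<open>\<epsilon>\<^sup>2 D\<^bsup>-2r\<^esup> Nb = \<epsilon>\<^sup>2 D\<close>.\<close>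

lemma information_budget:
  fixes r C c1 \<epsilon> D Nb \<eta> :: real and B :: "nat \<Rightarrow> nat" and n m d :: nat
  assumes r: "0 < r" and C: "0 < C" and c1: "0 < c1" and \<epsilon>: "0 < \<epsilon>"
    and D: "0 < D" and Nb: "Nb = D powr (1 + 2 * r)" and d: "c1 * D \<le> real d"
    and l: "0 \<le> l"
    and noise: "real n * l \<le> Nb" and comm: "real n * (\<Sum>k<m. min (real (B k) * l / D) 1) \<le> Nb"
    and small: "((C + 32 * C\<^sup>2) * (1 + 1 / c1) * c1 powr (- 2 * r) / c1 + C\<^sup>2 * c1 powr (- 1 - 2 * r)) * \<epsilon>\<^sup>2 \<le> 1 / 8"
    and \<eta>: "0 \<le> \<eta>" "4 * real m * \<eta> \<le> 1 / 8"
  defines "a \<equiv> C * \<epsilon> * real d powr (- 1/2 - r) * sqrt (real n * l)"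
    and "b \<equiv> C * \<epsilon>\<^sup>2 * real d powr (- 2 * r)"
  shows "a \<le> 1" "(\<Sum>k<m. min (real n / 2 * b) (32 * a\<^sup>2 * real (B k) + 4 * real d * \<eta>)) \<le> real d / 4"
proof -
  define K where "K = C + 32 * C\<^sup>2"
  have K: "0 < K" using C by (simp add: K_def add_pos_nonneg)
  have d0: "0 < real d" using d c1 D by (smt (verit) mult_pos_pos)
  have split: "0 \<le> K * (1 + 1 / c1) * c1 powr (- 2 * r) / c1 * \<epsilon>\<^sup>2" "0 \<le> C\<^sup>2 * c1 powr (- 1 - 2 * r) * \<epsilon>\<^sup>2"
    using K c1 by auto
  have small1: "K * (1 + 1 / c1) * c1 powr (- 2 * r) / c1 * \<epsilon>\<^sup>2 \<le> 1 / 8"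
    and small2: "C\<^sup>2 * c1 powr (- 1 - 2 * r) * \<epsilon>\<^sup>2 \<le> 1 / 8"
    using small split unfolding K_def[symmetric] distrib_right by linarith+
  have a_sq: "a\<^sup>2 = C\<^sup>2 * \<epsilon>\<^sup>2 * real d powr (- 1 - 2 * r) * (real n * l)"
  proof -
    have "(real d powr (- 1/2 - r))\<^sup>2 = real d powr (- 1 - 2 * r)"
      using d0 by (simp add: power2_eq_square flip: powr_add)
    then show ?thesis using l by (simp add: a_def power_mult_distrib)
  qed
  have dpow: "real d powr (- e) \<le> c1 powr (- e) * D powr (- e)" if "0 < e" for e
  proof -
    have "real d powr (- e) \<le> (c1 * D) powr (- e)" using that c1 D d by (intro powr_mono2') auto
    then show ?thesis using c1 D by (simp add: powr_mult)
  qed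
  have "a\<^sup>2 \<le> C\<^sup>2 * \<epsilon>\<^sup>2 * (c1 powr (- 1 - 2 * r) * D powr (- 1 - 2 * r)) * Nb"
    unfolding a_sq using dpow[of "1 + 2 * r"] r noise l by (intro mult_mono) auto
  also have "\<dots> = C\<^sup>2 * c1 powr (- 1 - 2 * r) * \<epsilon>\<^sup>2"
  proof -
    have "D powr (- 1 - 2 * r) * Nb = 1" unfolding Nb using D by (simp flip: powr_add)
    then show ?thesis by (simp add: mult_ac)
  qed
  finally have "a\<^sup>2 \<le> 1\<^sup>2" using small2 by simp
  then show "a \<le> 1" by (rule power2_le_imp_le) simp
  define \<Gamma> where "\<Gamma> = K * \<epsilon>\<^sup>2 * real n * (c1 powr (- 2 * r) * D powr (- 2 * r)) * (1 + 1 / c1)"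
  have \<Gamma>: "0 \<le> \<Gamma>" using K c1 by (auto simp: \<Gamma>_def)
  have one: "min (real n / 2 * b) (32 * a\<^sup>2 * real (B k) + 4 * real d * \<eta>)
      \<le> \<Gamma> * min (real (B k) * l / D) 1 + 4 * real d * \<eta>" for k
  proof -
    define y where "y = real (B k) * l"
    have y: "0 \<le> y" using l by (simp add: y_def)
    define X where "X = K * \<epsilon>\<^sup>2 * real n * real d powr (- 2 * r)"
    have X: "0 \<le> X" using K by (auto simp: X_def)
    have XG: "X * (1 + 1 / c1) \<le> \<Gamma>"
      unfolding X_def \<Gamma>_def using dpow[of "2 * r"] r K c1 by (intro mult_right_mono mult_left_mono) auto
    have A: "real n / 2 * b \<le> X"
    proof -
      have "real n / 2 * b = C / 2 * (\<epsilon>\<^sup>2 * real n * real d powr (- 2 * r))" by (simp add: b_def)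
      also have "\<dots> \<le> K * (\<epsilon>\<^sup>2 * real n * real d powr (- 2 * r))"
        using C by (intro mult_right_mono) (auto simp: K_def intro: add_increasing2)
      finally show ?thesis by (simp add: X_def mult.assoc)
    qed
    have Bd: "32 * a\<^sup>2 * real (B k) \<le> X * (y / real d)"
    proof -
      have "real d powr (- 1 - 2 * r) = real d powr (- 2 * r) / real d"
      proof -
        have "- 1 - 2 * r = - 2 * r - 1" by simp
        then show ?thesis using d0 by (simp only: powr_diff) simp
      qed
      then have "32 * a\<^sup>2 * real (B k) = 32 * C\<^sup>2 * (\<epsilon>\<^sup>2 * real n * real d powr (- 2 * r) * (y / real d))"
        unfolding a_sq by (simp add: y_def mult_ac)
      also have "\<dots> \<le> K * (\<epsilon>\<^sup>2 * real n * real d powr (- 2 * r) * (y / real d))"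
        using C y d0 by (intro mult_right_mono) (auto simp: K_def)
      finally show ?thesis by (simp add: X_def mult.assoc)
    qed
    have "min (real n / 2 * b) (32 * a\<^sup>2 * real (B k) + 4 * real d * \<eta>)
        \<le> min X (X * (y / real d)) + 4 * real d * \<eta>"
    proof -
      have "min u (v + e) \<le> min u' v' + e" if "u \<le> u'" "v \<le> v'" "0 \<le> e" for u v e u' v' :: real
        using that by (auto simp: min_def)
      then show ?thesis using A Bd \<eta>(1) by simp
    qed
    also have "min X (X * (y / real d)) = X * min 1 (y / real d)"
      using X by (simp add: min_mult_distrib_left)
    also have "X * min 1 (y / real d) \<le> X * ((1 + 1 / c1) * min (y / D) 1)"
    proof (intro mult_left_mono X)
      have "y / real d \<le> y / (c1 * D)" using d y c1 D d0 by (intro divide_left_mono) auto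
      also have "\<dots> = 1 / c1 * (y / D)" by simp
      finally have 1: "min 1 (y / real d) \<le> 1 / c1 * (y / D)" by linarith
      show "min 1 (y / real d) \<le> (1 + 1 / c1) * min (y / D) 1"
      proof (cases "y / D \<le> 1")
        case True
        have "1 / c1 * (y / D) \<le> (1 + 1 / c1) * (y / D)" using y D by (intro mult_right_mono) auto
        then show ?thesis using 1 True by (simp add: min_absorb1)
      next
        case False
        then have "min (y / D) 1 = 1" by simp
        then show ?thesis using c1 by (simp add: min.coboundedI1)
      qed
    qed
    also have "X * ((1 + 1 / c1) * min (y / D) 1) \<le> \<Gamma> * min (y / D) 1"
      using XG y D unfolding mult.assoc[symmetric] by (intro mult_right_mono) auto
    finally show ?thesis by (simp add: y_def)
  qed
  have "(\<Sum>k<m. min (real n / 2 * b) (32 * a\<^sup>2 * real (B k) + 4 * real d * \<eta>))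
      \<le> (\<Sum>k<m. \<Gamma> * min (real (B k) * l / D) 1 + 4 * real d * \<eta>)" by (intro sum_mono one)
  also have "\<dots> = \<Gamma> * (\<Sum>k<m. min (real (B k) * l / D) 1) + 4 * real m * \<eta> * real d"
    by (simp add: sum.distrib sum_distrib_left mult_ac)
  also have "\<Gamma> * (\<Sum>k<m. min (real (B k) * l / D) 1)
      = K * \<epsilon>\<^sup>2 * (c1 powr (- 2 * r) * D powr (- 2 * r)) * (1 + 1 / c1) * (real n * (\<Sum>k<m. min (real (B k) * l / D) 1))"
    by (simp add: \<Gamma>_def mult_ac)
  also have "\<dots> \<le> K * \<epsilon>\<^sup>2 * (c1 powr (- 2 * r) * D powr (- 2 * r)) * (1 + 1 / c1) * Nb"
    using comm K c1 by (intro mult_left_mono) auto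
  also have "\<dots> = K * (1 + 1 / c1) * c1 powr (- 2 * r) / c1 * \<epsilon>\<^sup>2 * (c1 * D)"
  proof -
    have "D powr (- 2 * r) * Nb = D" unfolding Nb using D by (simp flip: powr_add)
    then have "K * \<epsilon>\<^sup>2 * (c1 powr (- 2 * r) * D powr (- 2 * r)) * (1 + 1 / c1) * Nb
        = K * \<epsilon>\<^sup>2 * c1 powr (- 2 * r) * (1 + 1 / c1) * D" by (simp add: mult_ac)
    then show ?thesis using c1 by (simp add: mult_ac)
  qed
  also have "\<dots> \<le> 1 / 8 * real d"
    using small1 d split c1 D by (intro mult_mono) auto
  also have "4 * real m * \<eta> * real d \<le> 1 / 8 * real d" using \<eta> by (intro mult_right_mono) auto
  finally show "(\<Sum>k<m. min (real n / 2 * b) (32 * a\<^sup>2 * real (B k) + 4 * real d * \<eta>)) \<le> real d / 4" by simp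
qed

lemma small_square_exists:
  fixes M \<epsilon>0 :: real
  assumes "0 \<le> M" "0 < \<epsilon>0"
  obtains \<epsilon> where "0 < \<epsilon>" "\<epsilon> < \<epsilon>0" "M * \<epsilon>\<^sup>2 \<le> 1 / 8"
proof
  define \<epsilon> where "\<epsilon> = min (\<epsilon>0 / 2) (min 1 (1 / (8 * (M + 1))))"
  have e: "0 < \<epsilon>" "\<epsilon> \<le> 1" "\<epsilon> \<le> 1 / (8 * (M + 1))"  unfolding \<epsilon>_def using assms by (simp, linarith, linarith)
  show "0 < \<epsilon>" "\<epsilon> < \<epsilon>0" using assms by (auto simp: \<epsilon>_def)
  have "\<epsilon>\<^sup>2 \<le> \<epsilon>" using e by (simp add: power2_eq_square mult_left_le)
  then have "M * \<epsilon>\<^sup>2 \<le> M * (1 / (8 * (M + 1)))" using assms e by (intro mult_left_mono) auto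
  also have "\<dots> \<le> 1 / 8" using assms by (simp add: field_simps)
  finally show "M * \<epsilon>\<^sup>2 \<le> 1 / 8" .
qed

text \<open>All that is asymptotic has been put into the smallness of \<open>\<epsilon>\<close> and \<open>\<eta>\<close>: the first is arranged once for all sample
  sizes, the second holds from some sample size on.\<close>

lemma minimax_risk_ge:
  fixes n m d j :: nat and B :: "nat \<Rightarrow> nat" and I :: "nat \<Rightarrow> real set" and \<kappa> :: "nat \<Rightarrow> nat"
    and \<mu> :: "'x measure" and r C c1 c2 \<epsilon> \<eta> :: real
  assumes r: "0 < r" and w: "cdv_wavelet_basis S J w" and model: "stat_model \<Theta> \<mu> p"
    and C: "0 < C" and c1: "0 < c1" and c2: "0 < c2" and \<epsilon>: "0 < \<epsilon>"
    and small: "((C + 32 * C\<^sup>2) * (1 + 1 / c1) * c1 powr (- 2 * r) / c1 + C\<^sup>2 * c1 powr (- 1 - 2 * r)) * \<epsilon>\<^sup>2 \<le> 1 / 8"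
    and n: "2 \<le> n" and m: "1 \<le> m"
    and d: "c1 * N_bass r n m B powr (1 / (1 + 2 * r)) \<le> real d" "real d \<le> c2 * N_bass r n m B powr (1 / (1 + 2 * r))"
    and lay: "sieve_layout J w d j I \<kappa>"
    and sub: "sieve_fn w r d j \<kappa> C0 \<epsilon> ` signs d \<subseteq> besov_ball J w r L \<inter> \<Theta>"
    and ec: "expectation_control \<mu> p n m d (sieve_fn w r d j \<kappa> C0 \<epsilon>) (C * \<epsilon>\<^sup>2 * real d powr (- 2 * r))"
    and ds: "decomposable_structure \<mu> p n m d (sieve_fn w r d j \<kappa> C0 \<epsilon>) \<Xi>"
    and tc: "tail_control \<mu> p n m d (sieve_fn w r d j \<kappa> C0 \<epsilon>) \<Xi>
        (C * \<epsilon> * real d powr (- 1/2 - r) * sqrt (real n * ln (real (n * m)))) \<eta>"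
    and \<eta>: "\<bar>\<eta>\<bar> \<le> 1 / 32 * (1 / ((real m)\<^sup>2 * (real d)\<^sup>2))"
  shows "ennreal (\<epsilon>\<^sup>2 * c2 powr (- 2 * r) / 4 * N_bass r n m B powr (- (2 * r / (1 + 2 * r))))
    \<le> minimax_risk \<mu> p (besov_ball J w r L \<inter> \<Theta>) n m B"
proof -
  define Nb where "Nb = N_bass r n m B"
  define D where "D = Nb powr (1 / (1 + 2 * r))"
  define l where "l = ln (real (n * m))"
  define a where "a = C * \<epsilon> * real d powr (- 1/2 - r) * sqrt (real n * l)"
  define b where "b = C * \<epsilon>\<^sup>2 * real d powr (- 2 * r)"
  define G where "G = sieve_fn w r d j \<kappa> C0 \<epsilon>"
  define \<delta> where "\<delta> = \<epsilon> * real d powr (- (r + 1/2))"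
  have nm: "2 \<le> n * m" using mult_le_mono[OF n m] by simp
  have Nb: "0 < Nb" "Nb = bass_rhs r n m B Nb" using N_bass_fixpoint[OF r nm] by (simp_all add: Nb_def)
  have D: "0 < D" "Nb = D powr (1 + 2 * r)" using Nb(1) r by (simp_all add: D_def powr_powr)
  have d': "c1 * D \<le> real d" "real d \<le> c2 * D" using d by (simp_all add: D_def Nb_def)
  have d0: "0 < real d" using d'(1) mult_pos_pos[OF c1 D(1)] by linarith
  have "2 \<le> real (n * m)" using nm by (metis of_nat_le_iff of_nat_numeral)
  then have l: "0 < l" unfolding l_def by (intro ln_gt_zero) linarith
  have noise: "real n * l \<le> Nb" and comm: "real n * (\<Sum>k<m. min (real (B k) * l / D) 1) \<le> Nb"
    using Nb(2) by (simp_all add: bass_rhs_def l_def D_def)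
  have a0: "0 < a" using C \<epsilon> d0 n l by (simp add: a_def)
  have tc': "tail_control \<mu> p n m d G \<Xi> a \<eta>" using tc by (simp add: G_def a_def l_def)
  have \<eta>0: "0 \<le> \<eta>"
  proof -
    have "(\<lambda>h\<in>{..<d}. 1) \<in> signs d" by (auto simp: signs_def)
    moreover have "0 < d" "0 < m" using d0 m by auto
    ultimately show ?thesis using tc' unfolding tail_control_def by (meson abs_ge_zero order_trans)
  qed
  have \<eta>1: "4 * real m * \<eta> \<le> 1 / 8"
  proof -
    have m1: "1 \<le> real m" and d1: "1 \<le> real d" using m d0 by auto
    have "real m * 1 \<le> (real m)\<^sup>2 * (real d)\<^sup>2"
      using m1 d1 by (intro mult_mono self_le_power one_le_power) auto
    then have "1 / ((real m)\<^sup>2 * (real d)\<^sup>2) \<le> 1 / real m" using m1 by (intro divide_left_mono) auto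
    then have "\<eta> \<le> 1 / 32 * (1 / real m)" using \<eta> \<eta>0 by linarith
    then have "4 * real m * \<eta> \<le> 4 * real m * (1 / 32 * (1 / real m))" by (intro mult_left_mono) auto
    then show ?thesis using m1 by simp
  qed
  have budget: "a \<le> 1" "(\<Sum>k<m. min (real n / 2 * b) (32 * a\<^sup>2 * real (B k) + 4 * real d * \<eta>)) \<le> real d / 4"
    using information_budget[OF r C c1 \<epsilon> D d'(1) less_imp_le[OF l] noise comm small \<eta>0 \<eta>1]
    by (simp_all add: a_def b_def)
  interpret sieve_experiment \<mu> p \<Theta> n m d G \<Xi> b a \<eta>
    using model sub n m d0 ec ds tc' a0 budget(1)
    by unfold_locales (auto simp: G_def b_def)
  have GL: "G \<beta> \<in> L2_unit" if "\<beta> \<in> signs d" for \<beta>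
    using sub that by (auto simp: G_def besov_ball_def)
  have lay': "\<And>h. h < d \<Longrightarrow> is_interval (I h)" "disjoint_family_on I {..<d}" "(\<Union>h<d. I h) = {0..1}"
    using lay by (auto simp: sieve_layout_def)
  have "ennreal (2 * \<delta>\<^sup>2 * real d / 8) \<le> minimax_risk \<mu> p (besov_ball J w r L \<inter> \<Theta>) n m B"
    unfolding minimax_risk_def
  proof (rule INF_greatest)
    fix est assume est: "est \<in> dist_estimators \<mu> p (besov_ball J w r L \<inter> \<Theta>) n m B"
    show "ennreal (2 * \<delta>\<^sup>2 * real d / 8)
        \<le> (SUP f\<in>besov_ball J w r L \<inter> \<Theta>. \<integral>\<^sup>+X. l2_dist_sq (est X) f \<partial>data_law \<mu> p n m f)"
    proof (rule distributed_assouad[OF est _ _ _ _ budget(2), where loss="bin_loss I G"])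
      show "G ` signs d \<subseteq> besov_ball J w r L \<inter> \<Theta>" using sub by (simp add: G_def)
      show "(\<Sum>h<d. bin_loss I G h f \<beta>) \<le> l2_dist_sq f (G \<beta>)" if "f \<in> L2_unit" "\<beta> \<in> signs d" for f \<beta>
        using lay' that GL by (intro sum_bin_loss_le) auto
      show "ennreal (2 * \<delta>\<^sup>2) \<le> bin_loss I G h f \<beta> + bin_loss I G h f (flip \<beta> h)"
        if "f \<in> L2_unit" "\<beta> \<in> signs d" "h < d" for f \<beta> h
        unfolding G_def \<delta>_def using GL
        by (intro bin_loss_separation[OF w lay that]) (simp add: G_def)
    qed simp
  qed
  moreover have "\<epsilon>\<^sup>2 * c2 powr (- 2 * r) / 4 * N_bass r n m B powr (- (2 * r / (1 + 2 * r))) \<le> 2 * \<delta>\<^sup>2 * real d / 8"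
  proof -
    have "(real d powr (- (r + 1/2)))\<^sup>2 * real d = real d powr (- (r + 1/2) + - (r + 1/2) + 1)"
      unfolding powr_add power2_eq_square using d0 by simp
    also have "- (r + 1/2) + - (r + 1/2) + 1 = - 2 * r" by simp
    finally have "2 * \<delta>\<^sup>2 * real d / 8 = \<epsilon>\<^sup>2 / 4 * real d powr (- 2 * r)"
      by (simp add: \<delta>_def power_mult_distrib mult.commute)
    moreover have "(c2 * D) powr (- 2 * r) \<le> real d powr (- 2 * r)"
      using d'(2) d0 r by (intro powr_mono2') auto
    moreover have "(c2 * D) powr (- 2 * r) = c2 powr (- 2 * r) * N_bass r n m B powr (- (2 * r / (1 + 2 * r)))"
      using c2 D(1) by (simp add: powr_mult D_def powr_powr Nb_def)
    ultimately show ?thesis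
      using mult_left_mono[of "(c2 * D) powr (- 2 * r)" "real d powr (- 2 * r)" "\<epsilon>\<^sup>2 / 4"] by simp
  qed
  ultimately show ?thesis by (meson ennreal_leI order_trans)
qed

theorem theorem1:
  fixes r L C C0 c c1 c2 \<epsilon>0 :: real and S J :: nat
    and w :: "nat \<Rightarrow> nat \<Rightarrow> real \<Rightarrow> real"
    and \<mu> :: "'x measure" and p :: "(real \<Rightarrow> real) \<Rightarrow> 'x \<Rightarrow> real" and \<Theta> :: "(real \<Rightarrow> real) set"
  assumes "0 < r" and "0 < L" and "r < real S"
    and "cdv_wavelet_basis S J w"
    and "stat_model \<Theta> \<mu> p"
    and "0 < C" and "0 < c" and "c < 1" and "0 < c1" and "0 < c2" and "0 < \<epsilon>0"
  shows
    "\<exists>c0>0. \<forall>(m :: nat \<Rightarrow> nat) (B :: nat \<Rightarrow> nat \<Rightarrow> nat) (d :: nat \<Rightarrow> nat) (j :: nat \<Rightarrow> nat)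
        (I :: nat \<Rightarrow> nat \<Rightarrow> real set) (\<kappa> :: nat \<Rightarrow> nat \<Rightarrow> nat).
       (\<forall>n. 1 \<le> m n) \<longrightarrow>
       (\<forall>\<^sub>F n in sequentially.
          c1 * N_bass r n (m n) (B n) powr (1 / (1 + 2 * r)) \<le> real (d n) \<and>
          real (d n) \<le> c2 * N_bass r n (m n) (B n) powr (1 / (1 + 2 * r))) \<longrightarrow>
       (\<forall>\<^sub>F n in sequentially.
          real (d n) = c * 2 ^ j n \<and> minimal_sieve_layout J w (d n) (j n) (I n) (\<kappa> n)) \<longrightarrow>
       (\<forall>\<epsilon>. 0 < \<epsilon> \<and> \<epsilon> < \<epsilon>0 \<longrightarrow>
          (\<forall>\<^sub>F n in sequentially.
             sieve_fn w r (d n) (j n) (\<kappa> n) C0 \<epsilon> ` signs (d n) \<subseteq> besov_ball J w r L \<inter> \<Theta> \<and>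
             expectation_control \<mu> p n (m n) (d n) (sieve_fn w r (d n) (j n) (\<kappa> n) C0 \<epsilon>)
               (C * \<epsilon>\<^sup>2 * real (d n) powr (- 2 * r))) \<and>
          (\<exists>\<Xi> :: nat \<Rightarrow> nat \<Rightarrow> 'x set.
             (\<forall>\<^sub>F n in sequentially.
                decomposable_structure \<mu> p n (m n) (d n) (sieve_fn w r (d n) (j n) (\<kappa> n) C0 \<epsilon>) (\<Xi> n)) \<and>
             (\<exists>\<eta> \<in> o(\<lambda>n. 1 / ((real (m n))\<^sup>2 * (real (d n))\<^sup>2)).
                \<forall>\<^sub>F n in sequentially.
                  tail_control \<mu> p n (m n) (d n) (sieve_fn w r (d n) (j n) (\<kappa> n) C0 \<epsilon>) (\<Xi> n)
                    (C * \<epsilon> * real (d n) powr (- 1/2 - r) * sqrt (real n * ln (real (n * m n))))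
                    (\<eta> n)))) \<longrightarrow>
       (\<forall>\<^sub>F n in sequentially.
          ennreal (c0 * N_bass r n (m n) (B n) powr (- (2 * r / (1 + 2 * r))))
            \<le> minimax_risk \<mu> p (besov_ball J w r L \<inter> \<Theta>) n (m n) (B n))"
proof -
  (* epsilon depends on r, C, c1 and epsilon0 only, so it is fixed before the sequences are chosen *)
  define M where "M = (C + 32 * C\<^sup>2) * (1 + 1 / c1) * c1 powr (- 2 * r) / c1 + C\<^sup>2 * c1 powr (- 1 - 2 * r)"
  have "0 \<le> M" using \<open>0 < C\<close> \<open>0 < c1\<close> by (auto simp: M_def)
  then obtain \<epsilon> where \<epsilon>: "0 < \<epsilon>" "\<epsilon> < \<epsilon>0" "M * \<epsilon>\<^sup>2 \<le> 1 / 8"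
    using \<open>0 < \<epsilon>0\<close> by (rule small_square_exists)
  define c0 where "c0 = \<epsilon>\<^sup>2 * c2 powr (- 2 * r) / 4"
  have "0 < c0" using \<epsilon> \<open>0 < c2\<close> by (simp add: c0_def)
  show ?thesis
  proof (rule exI[of _ c0], intro conjI allI impI)
    fix m B d j I \<kappa>
    assume m: "\<forall>n. 1 \<le> m n"
      and d: "\<forall>\<^sub>F n in sequentially.
          c1 * N_bass r n (m n) (B n) powr (1 / (1 + 2 * r)) \<le> real (d n) \<and>
          real (d n) \<le> c2 * N_bass r n (m n) (B n) powr (1 / (1 + 2 * r))"
      and lay: "\<forall>\<^sub>F n in sequentially.
          real (d n) = c * 2 ^ j n \<and> minimal_sieve_layout J w (d n) (j n) (I n) (\<kappa> n)"
      and ass: "\<forall>\<epsilon>. 0 < \<epsilon> \<and> \<epsilon> < \<epsilon>0 \<longrightarrow>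
          (\<forall>\<^sub>F n in sequentially.
             sieve_fn w r (d n) (j n) (\<kappa> n) C0 \<epsilon> ` signs (d n) \<subseteq> besov_ball J w r L \<inter> \<Theta> \<and>
             expectation_control \<mu> p n (m n) (d n) (sieve_fn w r (d n) (j n) (\<kappa> n) C0 \<epsilon>)
               (C * \<epsilon>\<^sup>2 * real (d n) powr (- 2 * r))) \<and>
          (\<exists>\<Xi> :: nat \<Rightarrow> nat \<Rightarrow> 'x set.
             (\<forall>\<^sub>F n in sequentially.
                decomposable_structure \<mu> p n (m n) (d n) (sieve_fn w r (d n) (j n) (\<kappa> n) C0 \<epsilon>) (\<Xi> n)) \<and>
             (\<exists>\<eta> \<in> o(\<lambda>n. 1 / ((real (m n))\<^sup>2 * (real (d n))\<^sup>2)).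
                \<forall>\<^sub>F n in sequentially.
                  tail_control \<mu> p n (m n) (d n) (sieve_fn w r (d n) (j n) (\<kappa> n) C0 \<epsilon>) (\<Xi> n)
                    (C * \<epsilon> * real (d n) powr (- 1/2 - r) * sqrt (real n * ln (real (n * m n))))
                    (\<eta> n)))"
    from ass \<epsilon> obtain \<Xi> \<eta> where
      ec: "\<forall>\<^sub>F n in sequentially.
             sieve_fn w r (d n) (j n) (\<kappa> n) C0 \<epsilon> ` signs (d n) \<subseteq> besov_ball J w r L \<inter> \<Theta> \<and>
             expectation_control \<mu> p n (m n) (d n) (sieve_fn w r (d n) (j n) (\<kappa> n) C0 \<epsilon>)
               (C * \<epsilon>\<^sup>2 * real (d n) powr (- 2 * r))"
      and ds: "\<forall>\<^sub>F n in sequentially.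
                decomposable_structure \<mu> p n (m n) (d n) (sieve_fn w r (d n) (j n) (\<kappa> n) C0 \<epsilon>) (\<Xi> n)"
      and \<eta>: "\<eta> \<in> o(\<lambda>n. 1 / ((real (m n))\<^sup>2 * (real (d n))\<^sup>2))"
      and tc: "\<forall>\<^sub>F n in sequentially.
                  tail_control \<mu> p n (m n) (d n) (sieve_fn w r (d n) (j n) (\<kappa> n) C0 \<epsilon>) (\<Xi> n)
                    (C * \<epsilon> * real (d n) powr (- 1/2 - r) * sqrt (real n * ln (real (n * m n))))
                    (\<eta> n)"
      by blast
    have \<eta>': "\<forall>\<^sub>F n in sequentially. norm (\<eta> n) \<le> 1 / 32 * norm (1 / ((real (m n))\<^sup>2 * (real (d n))\<^sup>2))"
      by (rule landau_o.smallD[OF \<eta>]) simp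
    show "\<forall>\<^sub>F n in sequentially.
          ennreal (c0 * N_bass r n (m n) (B n) powr (- (2 * r / (1 + 2 * r))))
            \<le> minimax_risk \<mu> p (besov_ball J w r L \<inter> \<Theta>) n (m n) (B n)"
      using d lay ec ds tc \<eta>' eventually_ge_at_top[of 2]
    proof eventually_elim
      case (elim n)
      show ?case
        unfolding c0_def
        by (rule minimax_risk_ge[where C=C and ?c1.0=c1 and \<eta>="\<eta> n" and \<Xi>="\<Xi> n"])
          (use elim assms \<epsilon> m in \<open>auto simp: M_def minimal_sieve_layout_def\<close>)
    qed
  qed (fact \<open>0 < c0\<close>)
qed

end
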